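(* Let $d\ge1$, $A>0$, $\alpha\ge2$, and for $R>0$ let $B_R^{\alpha,A}=\{(z,t)\in\mathbb{R}^{2d}\times\mathbb{R}: |z|^\alpha+A|t|^{\alpha/2}\le R^\alpha\}$, with $|B_R^{\alpha,A}|$ its Lebesgue measure. Then, for large $R$, $$\Big|\#(\mathbb{Z}^{2d+1}\cap B_R^{\alpha,A})-|B_R^{\alpha,A}|\Big|\lesssim\begin{cases}R^{2d}, & \alpha=2,\\ R^{2d}\log R, & 2<\alpha\le4,\\ R^{2d+\delta}, & \alpha>4,\end{cases}$$ where $\delta=\delta(\alpha)=\dfrac{2(\frac12-\frac2\alpha)}{d+\frac12-\frac2\alpha}$.
   Context: $f\lesssim g$ means $f\le Cg$ with $C$ independent of $R$ (possibly depending on $d,\alpha,A$). *)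

theory Defs
  imports "HOL-Analysis.Analysis"
begin

text \<open>
  \<open>\<real>\<^sup>2\<^sup>d\<close> is \<open>real ^ 'n\<close> for an index type with \<open>CARD('n) = 2 * d\<close>, so that \<open>norm z\<close> is the
  Euclidean norm. As \<open>0 powr a = 0\<close>, \<open>powr\<close> is the usual real power of a nonnegative base here.
\<close>

definition heis_ball :: "real \<Rightarrow> real \<Rightarrow> real \<Rightarrow> ((real ^ 'n) \<times> real) set"
  where "heis_ball \<alpha> A R =
    {(z, t). norm z powr \<alpha> + A * \<bar>t\<bar> powr (\<alpha> / 2) \<le> R powr \<alpha>}"

definition int_lattice :: "((real ^ 'n) \<times> real) set"
  where "int_lattice = {(z, t). (\<forall>i. z $ i \<in> \<int>) \<and> t \<in> \<int>}"

definition delta_exp :: "nat \<Rightarrow> real \<Rightarrow> real"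
  where "delta_exp d \<alpha> = 2 * (1/2 - 2/\<alpha>) / (real d + 1/2 - 2/\<alpha>)"

definition error_rate :: "nat \<Rightarrow> real \<Rightarrow> real \<Rightarrow> real"
  where "error_rate d \<alpha> R =
    (if \<alpha> = 2 then R ^ (2 * d)
     else if \<alpha> \<le> 4 then R ^ (2 * d) * ln R
     else R powr (2 * real d + delta_exp d \<alpha>))"

text \<open>
  \<open>card\<close> is \<open>0\<close> on infinite sets; for \<open>A > 0\<close> and \<open>\<alpha> > 0\<close> the set counted is finite.
\<close>

lemma finite_int_lattice_heis_ball:
  fixes A \<alpha> R :: real
  assumes A: "A > 0" and \<alpha>: "\<alpha> > 0"
  shows "finite (int_lattice \<inter> heis_ball \<alpha> A R :: ((real ^ 'n) \<times> real) set)"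
proof -
  have bnd: "norm z \<le> (R powr \<alpha>) powr (1 / \<alpha>) \<and> \<bar>t\<bar> \<le> (R powr \<alpha> / A) powr (2 / \<alpha>)"
    if "(z, t) \<in> heis_ball \<alpha> A R" for z :: "real ^ 'n" and t
  proof -
    have h: "norm z powr \<alpha> + A * \<bar>t\<bar> powr (\<alpha> / 2) \<le> R powr \<alpha>"
      using that by (simp add: heis_ball_def)
    have "0 \<le> A * \<bar>t\<bar> powr (\<alpha> / 2)"
      using A by simp
    with h have 1: "norm z powr \<alpha> \<le> R powr \<alpha>"
      by linarith
    have "A * \<bar>t\<bar> powr (\<alpha> / 2) \<le> R powr \<alpha>"
      using h powr_ge_zero[of "norm z" \<alpha>] by linarith
    then have 2: "\<bar>t\<bar> powr (\<alpha> / 2) \<le> R powr \<alpha> / A"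
      using A by (simp add: pos_le_divide_eq mult.commute)
    have "norm z = (norm z powr \<alpha>) powr (1 / \<alpha>)"
      using \<alpha> by (simp add: powr_powr)
    also have "\<dots> \<le> (R powr \<alpha>) powr (1 / \<alpha>)"
      using \<alpha> by (intro powr_mono2[OF _ _ 1]) simp_all
    finally have 3: "norm z \<le> (R powr \<alpha>) powr (1 / \<alpha>)" .
    have "\<bar>t\<bar> = (\<bar>t\<bar> powr (\<alpha> / 2)) powr (2 / \<alpha>)"
      using \<alpha> by (simp add: powr_powr)
    also have "\<dots> \<le> (R powr \<alpha> / A) powr (2 / \<alpha>)"
      using \<alpha> by (intro powr_mono2[OF _ _ 2]) simp_all
    finally have "\<bar>t\<bar> \<le> (R powr \<alpha> / A) powr (2 / \<alpha>)" .
    with 3 show ?thesis by blast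
  qed
  define M where "M = (R powr \<alpha>) powr (1 / \<alpha>) + (R powr \<alpha> / A) powr (2 / \<alpha>)"
  have fin: "finite {x :: real. x \<in> \<int> \<and> \<bar>x\<bar> \<le> M}"
    by (rule finite_abs_int_segment)
  have sub: "int_lattice \<inter> heis_ball \<alpha> A R \<subseteq>
    (\<lambda>f. \<chi> i. f i) ` (PiE (UNIV :: 'n set) (\<lambda>_. {x :: real. x \<in> \<int> \<and> \<bar>x\<bar> \<le> M}))
      \<times> {x. x \<in> \<int> \<and> \<bar>x\<bar> \<le> M}"
  proof (rule subrelI, rule SigmaI)
    fix z :: "real ^ 'n" and t
    assume "(z, t) \<in> int_lattice \<inter> heis_ball \<alpha> A R"
    then have m: "(z, t) \<in> int_lattice" and b: "(z, t) \<in> heis_ball \<alpha> A R"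
      by auto
    have "\<bar>z $ i\<bar> \<le> M" for i
      using bnd[OF b] component_le_norm_cart[of z i] powr_ge_zero[of "R powr \<alpha> / A" "2 / \<alpha>"]
      unfolding M_def by linarith
    then have "(\<lambda>i. z $ i) \<in> PiE UNIV (\<lambda>_. {x. x \<in> \<int> \<and> \<bar>x\<bar> \<le> M})"
      using m by (auto simp: int_lattice_def)
    then have "(\<chi> i. z $ i) \<in> (\<lambda>f. \<chi> i. f i) ` (PiE UNIV (\<lambda>_. {x. x \<in> \<int> \<and> \<bar>x\<bar> \<le> M}))"
      by (rule imageI)
    then show "z \<in> (\<lambda>f. \<chi> i. f i) ` (PiE UNIV (\<lambda>_. {x. x \<in> \<int> \<and> \<bar>x\<bar> \<le> M}))"
      by (simp only: vec_nth_inverse)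
    show "t \<in> {x. x \<in> \<int> \<and> \<bar>x\<bar> \<le> M}"
      using m bnd[OF b] powr_ge_zero[of "R powr \<alpha>" "1 / \<alpha>"]
      unfolding int_lattice_def M_def mem_Collect_eq by (simp del: powr_ge_zero)
  qed
  show ?thesis
    by (rule finite_subset[OF sub]) (intro finite_cartesian_product finite_imageI finite_PiE fin, auto)
qed

end

theory Submission
  imports Defs "HOL-Real_Asymp.Real_Asymp"
begin

text \<open>
  Write \<open>n = 2 d\<close> and \<open>\<beta> = 2 / \<alpha>\<close>. Counting along the \<open>t\<close>-axis costs \<open>O(1)\<close> for every \<open>z\<close>, so up
  to \<open>O(R\<^sup>n)\<close> the problem is to compare the sum of \<open>h z = (R\<^sup>\<alpha> - |z|\<^sup>\<alpha>)\<^sub>+\<^sup>\<beta>\<close> over the integer points \<open>z\<close> with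
  its integral.

  The Fourier transform of \<open>h\<close> at \<open>\<xi>\<close> is bounded by \<open>R\<close> to the power \<open>(n + 3) / 2 - \<beta>\<close> times \<open>|\<xi>|\<close> to the
  power \<open>- (n + 1) / 2 - \<beta>\<close>. Instead of Bessel functions, the Riesz means
  \<open>U\<^sub>k r = \<integral> (r\<^sup>2 - |x|\<^sup>2)\<^sub>+\<^sup>k cos (\<xi> \<bullet> x) dx\<close> are used: Green's identity relates \<open>U\<^sub>2\<close>, \<open>U\<^sub>1\<close> and \<open>U\<^sub>0\<close>, and
  together with \<open>U\<^sub>k\<^sub>+\<^sub>1' = 2 (k + 1) r U\<^sub>k\<close> this is a first-order system in \<open>r\<close> which an energy estimate
  controls. As \<open>h\<close> is a superposition of indicators of balls with the increasing weight
  \<open>- h' r / r\<close>, one integration by parts up to distance \<open>1 / |\<xi>|\<close> from the boundary gives the bound.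

  Poisson summation is replaced by integration against a nonnegative trigonometric polynomial \<open>\<Phi>\<close> of
  degree \<open>O(M)\<close> with mass 1 and second moment \<open>O(1 / M\<^sup>2)\<close> on the unit cube. Its tails are absorbed by
  iterating the resulting inequality, since they only see a fixed fraction of the error at nearby
  radii. The total error is \<open>O(R\<^sup>n\<^sup>+\<^sup>1 / M)\<close> plus the sum of the Fourier bounds over frequencies up to \<open>O(M)\<close>;
  the choice is \<open>M = R\<close> for \<open>\<alpha> \<le> 4\<close>, and \<open>R\<close> to the power \<open>(n - 1 + 2 \<beta>) / (n + 1 - 2 \<beta>)\<close> for \<open>\<alpha> > 4\<close>.
\<close>

section \<open>Differentiation under the integral sign\<close>

text \<open>The rate is decided at the edge of the support. There \<open>h\<close> grows like
  \<open>R powr (2 - \<beta>)\<close> times the \<beta>-th power of the distance to the sphere, and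
  its Fourier bound is that of a ball indicator multiplied by
  \<open>R powr (2 - \<beta>) * norm \<xi> powr (- \<beta>)\<close>. While
  \<open>(n - 1) / 2 - \<beta>\<close> is positive, frequencies up to \<open>M\<close> contribute in
  total about \<open>R powr ((n + 3) / 2 - \<beta>) * M powr ((n - 1) / 2 - \<beta>)\<close>. At
  \<open>M = R\<close> this is \<open>R powr (n + 1 - 2 * \<beta>)\<close>, which stays within
  \<open>R powr n\<close> as long as \<beta> is at least 1/2; hence the threshold at \<alpha> = 4.
  For smaller \<beta> this total is balanced against the smoothing error, and the balance produces
  \<delta>. The obstacle in smoothing is that a nonzero trigonometric polynomial cannot vanish off a
  small ball, so the usual comparison with the radii \<open>R + \<epsilon>\<close> and
  \<open>R - \<epsilon>\<close> fails on part of the unit cube. There the comparison is made with a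
  quadratic function of the displacement, which a second moment controls.\<close>

lemma has_real_derivative_lebesgue_integral:
  fixes \<phi> :: "real \<Rightarrow> 'a \<Rightarrow> real"
  assumes e: "e > 0"
    and int: "\<And>t. \<bar>t - t0\<bar> < e \<Longrightarrow> integrable M (\<phi> t)"
    and der: "AE x in M. ((\<lambda>t. \<phi> t x) has_real_derivative \<phi>' x) (at t0)"
    and meas: "\<phi>' \<in> borel_measurable M"
    and lip: "\<And>t x. \<bar>t - t0\<bar> < e \<Longrightarrow> \<bar>\<phi> t x - \<phi> t0 x\<bar> \<le> B x * \<bar>t - t0\<bar>"
    and B: "integrable M B"
  shows "((\<lambda>t. \<integral>x. \<phi> t x \<partial>M) has_real_derivative (\<integral>x. \<phi>' x \<partial>M)) (at t0)"
  unfolding has_field_derivative_iff tendsto_at_iff_sequentially comp_def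
proof (intro allI impI)
  fix X :: "nat \<Rightarrow> real"
  assume ne: "\<forall>i. X i \<in> UNIV - {t0}" and X: "X \<longlonglongrightarrow> t0"
  have "eventually (\<lambda>i. \<bar>X i - t0\<bar> < e) sequentially"
    using X e by (auto simp: tendsto_iff dist_real_def)
  then obtain N where N: "\<And>i. i \<ge> N \<Longrightarrow> \<bar>X i - t0\<bar> < e"
    by (auto simp: eventually_sequentially)
  \<comment> \<open>Dropping the first \<open>N\<close> terms keeps the sequence in the interval
    where \<open>int\<close> and \<open>lip\<close> are available; \<open>LIMSEQ_offset\<close>
    restores the full sequence at the end.\<close>
  have X': "filterlim (\<lambda>i. X (i + N)) (at t0) sequentially"
    using ne LIMSEQ_ignore_initial_segment[OF X] by (auto simp: filterlim_at)
  have "(\<lambda>i. \<integral>x. (\<phi> (X (i + N)) x - \<phi> t0 x) / (X (i + N) - t0) \<partial>M) \<longlonglongrightarrow> (\<integral>x. \<phi>' x \<partial>M)"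
  proof (rule integral_dominated_convergence[where w = B])
    show "(\<lambda>x. (\<phi> (X (i + N)) x - \<phi> t0 x) / (X (i + N) - t0)) \<in> borel_measurable M" for i
      using int[OF N, of "i + N"] int[of t0] e by (auto dest!: borel_measurable_integrable)
    show "AE x in M. (\<lambda>i. (\<phi> (X (i + N)) x - \<phi> t0 x) / (X (i + N) - t0)) \<longlonglongrightarrow> \<phi>' x"
      using der
    proof eventually_elim
      case (elim x)
      then have "((\<lambda>t. (\<phi> t x - \<phi> t0 x) / (t - t0)) \<longlongrightarrow> \<phi>' x) (at t0)"
        by (simp add: has_field_derivative_iff)
      from filterlim_compose[OF this X'] show ?case .
    qed
    show "AE x in M. norm ((\<phi> (X (i + N)) x - \<phi> t0 x) / (X (i + N) - t0)) \<le> B x" for i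
      using lip[OF N, of "i + N"] ne by (auto simp: pos_divide_le_eq)
  qed (use meas B in auto)
  also have "(\<lambda>i. \<integral>x. (\<phi> (X (i + N)) x - \<phi> t0 x) / (X (i + N) - t0) \<partial>M) =
     (\<lambda>i. ((\<integral>x. \<phi> (X (i + N)) x \<partial>M) - (\<integral>x. \<phi> t0 x \<partial>M)) / (X (i + N) - t0))"
    using int[OF N] int[of t0] e by (auto simp: fun_eq_iff)
  finally show "(\<lambda>i. ((\<integral>x. \<phi> (X i) x \<partial>M) - (\<integral>x. \<phi> t0 x \<partial>M)) / (X i - t0)) \<longlonglongrightarrow> (\<integral>x. \<phi>' x \<partial>M)"
    by (rule LIMSEQ_offset)
qed

section \<open>Bounded support and translation invariance\<close>

lemma integrable_bounded_support:
  fixes f :: "'a::euclidean_space \<Rightarrow> real"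
  assumes "f \<in> borel_measurable borel" and "\<And>x. \<bar>f x\<bar> \<le> B" and "\<And>x. norm x > r \<Longrightarrow> f x = 0"
  shows "integrable lborel f"
proof (rule integrableI_bounded_set[of "cball 0 r"])
  show "emeasure lborel (cball (0::'a) r) < \<infinity>"
    using emeasure_lborel_cball_finite by auto
qed (use assms in \<open>auto simp: not_le\<close>)

lemma lborel_integral_shift:
  fixes f :: "'a::euclidean_space \<Rightarrow> real"
  assumes f: "f \<in> borel_measurable borel"
  shows "(LBINT x. f (c + x)) = (LBINT x. f x)"
proof -
  have "(LBINT x. f x) = (\<integral>x. f x \<partial>(distr lborel borel (\<lambda>x. c + x)))"
    by (simp add: lborel_distr_plus)
  also have "\<dots> = (LBINT x. f (c + x))"
    by (subst integral_distr) (use f in auto)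
  finally show ?thesis by simp
qed

lemma integrable_shift:
  fixes f :: "'a::euclidean_space \<Rightarrow> real"
  assumes f: "integrable lborel f"
  shows "integrable lborel (\<lambda>x. f (c + x))"
proof -
  have "integrable (distr lborel borel (\<lambda>x. c + x)) f"
    using f by (simp add: lborel_distr_plus)
  then show ?thesis
    by (subst (asm) integrable_distr_eq) (use f in auto)
qed

text \<open>By translation invariance the integral of \<open>f (x + t b)\<close> does not depend on
  \<open>t\<close>, so its derivative, taken under the integral sign, is 0. This serves as the
  divergence theorem without boundary terms for Lipschitz fields of bounded support.\<close>

lemma integral_directional_derivative_eq_0:
  fixes f :: "'a::euclidean_space \<Rightarrow> real"
  assumes f: "integrable lborel f" and e: "e > 0"
    and der: "AE x in lborel. ((\<lambda>t. f (x + t *\<^sub>R b)) has_real_derivative f' x) (at 0)"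
    and meas: "f' \<in> borel_measurable borel"
    and lip: "\<And>t x. \<bar>t\<bar> < e \<Longrightarrow> \<bar>f (x + t *\<^sub>R b) - f x\<bar> \<le> B x * \<bar>t\<bar>"
    and B: "integrable lborel B"
  shows "(LBINT x. f' x) = 0"
proof -
  have shift: "integrable lborel (\<lambda>x. f (x + c))" "(LBINT x. f (x + c)) = (LBINT x. f x)" for c
    using integrable_shift[OF f, of c] lborel_integral_shift[of f c] f by (auto simp: add.commute)
  have "((\<lambda>t. LBINT x. f (x + t *\<^sub>R b)) has_real_derivative (LBINT x. f' x)) (at 0)"
    by (rule has_real_derivative_lebesgue_integral[where B = B, OF e])
       (use assms shift in auto)
  then have "((\<lambda>t::real. LBINT x. f x) has_real_derivative (LBINT x. f' x)) (at 0)"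
    by (simp add: shift)
  then show ?thesis
    using DERIV_const DERIV_unique by blast
qed

section \<open>Fourier transforms of Riesz means of balls\<close>

text \<open>For \<open>r > 0\<close> and nonzero \<xi> this is a constant multiple of
  \<open>(r / norm \<xi>) powr (n / 2 + k)\<close> times the Bessel function of order
  \<open>n / 2 + k\<close> at \<open>r * norm \<xi>\<close>, where \<open>n = DIM('a)\<close>. The
  cosine alone gives the Fourier transform because the weight is even.\<close>

definition riesz_ft :: "nat \<Rightarrow> 'a::euclidean_space \<Rightarrow> real \<Rightarrow> real" where
  "riesz_ft k \<xi> r = (LBINT x. indicator (ball 0 r) x * (r\<^sup>2 - (norm x)\<^sup>2) ^ k * cos (\<xi> \<bullet> x))"

lemma abs_power_Suc_diff_le:
  fixes a b C :: real
  assumes "\<bar>a\<bar> \<le> C" "\<bar>b\<bar> \<le> C"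
  shows "\<bar>a ^ Suc k - b ^ Suc k\<bar> \<le> real (Suc k) * C ^ k * \<bar>a - b\<bar>"
proof (induction k)
  case 0
  then show ?case by simp
next
  case (Suc k)
  have C: "0 \<le> C" using assms by linarith
  have "\<bar>a ^ Suc (Suc k) - b ^ Suc (Suc k)\<bar> = \<bar>a * (a ^ Suc k - b ^ Suc k) + (a - b) * b ^ Suc k\<bar>"
    by (simp add: algebra_simps)
  also have "\<dots> \<le> \<bar>a\<bar> * \<bar>a ^ Suc k - b ^ Suc k\<bar> + \<bar>a - b\<bar> * \<bar>b\<bar> ^ Suc k"
    by (metis abs_mult abs_triangle_ineq power_abs)
  also have "\<dots> \<le> C * (real (Suc k) * C ^ k * \<bar>a - b\<bar>) + \<bar>a - b\<bar> * C ^ Suc k"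
    by (intro add_mono mult_mono Suc power_mono assms) (use C in auto)
  also have "\<dots> = real (Suc (Suc k)) * C ^ Suc k * \<bar>a - b\<bar>"
    by (simp add: algebra_simps)
  finally show ?case .
qed

text \<open>The truncated integrands below are differentiated pointwise everywhere except on one
  sphere; this discards it.\<close>

lemma AE_lborel_norm_neq: "AE x in lborel. norm (x :: 'a::euclidean_space) \<noteq> r"
proof -
  have "negligible (sphere (0::'a) r)" by (rule negligible_sphere)
  then have "AE x in lebesgue. x \<notin> sphere (0::'a) r"
    using negligible_iff_null_sets AE_not_in by blast
  then have "AE x in lebesgue. norm (x :: 'a) \<noteq> r"
    by (rule AE_mp) (auto intro!: AE_I2)
  then show ?thesis
    by (auto simp: AE_completion_iff)
qed

lemma integrable_riesz:
  fixes g :: "'a::euclidean_space \<Rightarrow> real"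
  assumes g: "g \<in> borel_measurable borel" "\<And>x. \<bar>g x\<bar> \<le> C"
  shows "integrable lborel (\<lambda>x. indicator (ball 0 r) x * (r\<^sup>2 - (norm x)\<^sup>2) ^ k * g x)"
proof (rule integrable_bounded_support[where r = r and B = "(r\<^sup>2) ^ k * C"])
  have C: "0 \<le> C" using g(2) by (meson abs_ge_zero order_trans)
  show "(\<lambda>x. indicator (ball 0 r) x * (r\<^sup>2 - (norm x)\<^sup>2) ^ k * g x) \<in> borel_measurable borel"
    by (intro borel_measurable_times borel_measurable_indicator g(1) borel_measurable_power
        borel_measurable_diff borel_measurable_const borel_measurable_norm measurable_ident_sets) auto
  show "\<bar>indicator (ball 0 r) x * (r\<^sup>2 - (norm x)\<^sup>2) ^ k * g x\<bar> \<le> (r\<^sup>2) ^ k * C" for x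
  proof (cases "x \<in> ball 0 r")
    case True
    then have "(norm x)\<^sup>2 \<le> r\<^sup>2" by (intro power_mono) auto
    then have "\<bar>r\<^sup>2 - (norm x)\<^sup>2\<bar> \<le> r\<^sup>2" by (simp add: abs_if)
    then show ?thesis using True g(2)[of x]
      by (auto simp: abs_mult power_abs intro!: mult_mono power_mono)
  qed (use C in auto)
qed auto

text \<open>The extra power makes the truncated integrand vanish on the sphere and hence Lipschitz
  in the radius, so the derivative passes under the integral and the moving domain leaves no
  boundary term.\<close>

lemma has_real_derivative_riesz_ft:
  fixes \<xi> :: "'a::euclidean_space"
  assumes r: "r > 0"
  shows "(riesz_ft (Suc k) \<xi> has_real_derivative (2 * real (Suc k) * r * riesz_ft k \<xi> r)) (at r)"
proof -
  define C where "C = (r + 1)\<^sup>2"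
  define e where "e = min 1 r"
  \<comment> \<open>With the positive part in place of the indicator, the integrand becomes a power
    of a function that is Lipschitz in \<open>t\<close>; \<open>C\<close> bounds that function for
    all radii up to \<open>r + 1\<close>.\<close>
  define m where "m = (\<lambda>t (x::'a). max 0 (t\<^sup>2 - (norm x)\<^sup>2))"
  have eq: "indicator (ball 0 t) x * (t\<^sup>2 - (norm x)\<^sup>2) ^ Suc k = m t x ^ Suc k" if "t > 0" for t x
  proof (cases "norm x < t")
    case True
    then have "(norm x)\<^sup>2 \<le> t\<^sup>2" by (intro power_mono) auto
    then show ?thesis using True by (simp add: m_def)
  next
    case False
    then have "(norm x)\<^sup>2 \<ge> t\<^sup>2" using that by (intro power_mono) auto
    then show ?thesis using False by (simp add: m_def)
  qed
  have "((\<lambda>t. LBINT x. indicator (ball 0 t) x * (t\<^sup>2 - (norm x)\<^sup>2) ^ Suc k * cos (\<xi> \<bullet> x))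
     has_real_derivative (LBINT x. 2 * real (Suc k) * r * (indicator (ball 0 r) x * (r\<^sup>2 - (norm x)\<^sup>2) ^ k * cos (\<xi> \<bullet> x)))) (at r)"
  proof (rule has_real_derivative_lebesgue_integral)
    show "e > 0" using r by (simp add: e_def)
    show "integrable lborel (\<lambda>x. indicator (ball 0 t) x * (t\<^sup>2 - (norm x)\<^sup>2) ^ Suc k * cos (\<xi> \<bullet> x))" for t
      by (rule integrable_riesz[where C = 1]) auto
    show "AE x in lborel. ((\<lambda>t. indicator (ball 0 t) x * (t\<^sup>2 - (norm x)\<^sup>2) ^ Suc k * cos (\<xi> \<bullet> x))
      has_real_derivative 2 * real (Suc k) * r * (indicator (ball 0 r) x * (r\<^sup>2 - (norm x)\<^sup>2) ^ k * cos (\<xi> \<bullet> x))) (at r)"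
      using AE_lborel_norm_neq[of r]
    proof eventually_elim
      case (elim x)
      show ?case
      proof (cases "norm x < r")
        case True
        have "((\<lambda>t. (t\<^sup>2 - (norm x)\<^sup>2) ^ Suc k * cos (\<xi> \<bullet> x))
          has_real_derivative 2 * real (Suc k) * r * (indicator (ball 0 r) x * (r\<^sup>2 - (norm x)\<^sup>2) ^ k * cos (\<xi> \<bullet> x))) (at r)"
          using True by (auto intro!: derivative_eq_intros simp del: power_Suc)
        then show ?thesis
          by (rule has_field_derivative_transform_within[where d = "r - norm x"])
             (use True in \<open>auto simp: dist_real_def indicator_def\<close>)
      next
        case False
        with elim have lt: "r < norm x" by simp
        have "((\<lambda>t. 0) has_real_derivative 2 * real (Suc k) * r * (indicator (ball 0 r) x * (r\<^sup>2 - (norm x)\<^sup>2) ^ k * cos (\<xi> \<bullet> x))) (at r)"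
          using lt by auto
        then show ?thesis
          by (rule has_field_derivative_transform_within[where d = "norm x - r"])
             (use lt in \<open>auto simp: dist_real_def indicator_def\<close>)
      qed
    qed
    show "(\<lambda>x. 2 * real (Suc k) * r * (indicator (ball 0 r) x * (r\<^sup>2 - (norm x)\<^sup>2) ^ k * cos (\<xi> \<bullet> x))) \<in> borel_measurable lborel"
      by (rule borel_measurable_integrable, rule integrable_mult_right, rule integrable_riesz[where C = 1]) auto
    show "integrable lborel (\<lambda>x::'a. indicator (cball 0 (r + 1)) x * (real (Suc k) * C ^ k * (2 * r + 1)))"
      by (rule integrable_bounded_support[where B = "real (Suc k) * C ^ k * (2 * r + 1)" and r = "r + 1"])
         (use r in \<open>auto simp: C_def indicator_def\<close>)
    show "\<bar>indicator (ball 0 t) x * (t\<^sup>2 - (norm x)\<^sup>2) ^ Suc k * cos (\<xi> \<bullet> x)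
           - indicator (ball 0 r) x * (r\<^sup>2 - (norm x)\<^sup>2) ^ Suc k * cos (\<xi> \<bullet> x)\<bar>
          \<le> indicator (cball 0 (r + 1)) x * (real (Suc k) * C ^ k * (2 * r + 1)) * \<bar>t - r\<bar>"
      if t: "\<bar>t - r\<bar> < e" for t x
    proof -
      have t0: "t > 0" "t < r + 1" using t by (auto simp: e_def)
      show ?thesis
      proof (cases "norm x \<le> r + 1")
        case True
        have "\<bar>m t x\<bar> \<le> C" "\<bar>m r x\<bar> \<le> C"
        proof -
          have "t\<^sup>2 \<le> C" "r\<^sup>2 \<le> C" unfolding C_def using t0 r by (auto intro!: power_mono)
          then show "\<bar>m t x\<bar> \<le> C" "\<bar>m r x\<bar> \<le> C" unfolding m_def by (smt (verit) zero_le_power2)+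
        qed
        then have "\<bar>m t x ^ Suc k - m r x ^ Suc k\<bar> \<le> real (Suc k) * C ^ k * \<bar>m t x - m r x\<bar>"
          by (rule abs_power_Suc_diff_le)
        also have "\<bar>m t x - m r x\<bar> \<le> \<bar>t\<^sup>2 - r\<^sup>2\<bar>" unfolding m_def by linarith
        also have "\<bar>t\<^sup>2 - r\<^sup>2\<bar> = \<bar>t - r\<bar> * \<bar>t + r\<bar>" by (simp add: power2_eq_square abs_mult[symmetric] algebra_simps)
        also have "\<dots> \<le> \<bar>t - r\<bar> * (2 * r + 1)" using t0 r by (intro mult_left_mono) auto
        finally have *: "\<bar>m t x ^ Suc k - m r x ^ Suc k\<bar> \<le> real (Suc k) * C ^ k * (\<bar>t - r\<bar> * (2 * r + 1))"
          by (simp add: C_def mult_left_mono)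
        have "\<bar>indicator (ball 0 t) x * (t\<^sup>2 - (norm x)\<^sup>2) ^ Suc k * cos (\<xi> \<bullet> x)
           - indicator (ball 0 r) x * (r\<^sup>2 - (norm x)\<^sup>2) ^ Suc k * cos (\<xi> \<bullet> x)\<bar>
           = \<bar>m t x ^ Suc k - m r x ^ Suc k\<bar> * \<bar>cos (\<xi> \<bullet> x)\<bar>"
          unfolding eq[OF t0(1)] eq[OF r] by (simp add: abs_mult[symmetric] left_diff_distrib del: power_Suc)
        also have "\<dots> \<le> \<bar>m t x ^ Suc k - m r x ^ Suc k\<bar> * 1"
          by (intro mult_left_mono) auto
        finally show ?thesis using * True by (simp add: mult_ac)
      next
        case False
        then show ?thesis using t0 by (simp add: indicator_def)
      qed
    qed
  qed
  then show ?thesis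
    unfolding riesz_ft_def[abs_def] by (simp only: integral_mult_right_zero)
qed

lemma lipschitz_on_mult_bounded:
  fixes f g :: "'a::euclidean_space \<Rightarrow> real"
  assumes S: "bounded S" and f: "\<exists>L. L-lipschitz_on S f" and g: "\<exists>L. L-lipschitz_on S g"
  shows "\<exists>L. L-lipschitz_on S (\<lambda>x. f x * g x)"
proof -
  obtain L M where L: "L-lipschitz_on S f" and M: "M-lipschitz_on S g" using f g by blast
  have "bounded (f ` S)" "bounded (g ` S)"
    by (rule bounded_uniformly_continuous_image[OF lipschitz_on_uniformly_continuous[OF L] S]
        bounded_uniformly_continuous_image[OF lipschitz_on_uniformly_continuous[OF M] S])+
  then obtain A B where A: "\<And>x. x \<in> S \<Longrightarrow> \<bar>f x\<bar> \<le> A" and B: "\<And>x. x \<in> S \<Longrightarrow> \<bar>g x\<bar> \<le> B"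
    unfolding bounded_iff by auto
  have nonneg: "0 \<le> L" "0 \<le> M" using L M lipschitz_on_nonneg by auto
  have "(\<bar>A\<bar> * M + \<bar>B\<bar> * L)-lipschitz_on S (\<lambda>x. f x * g x)"
  proof (rule lipschitz_onI)
    fix x y assume xy: "x \<in> S" "y \<in> S"
    have "dist (f x * g x) (f y * g y) = \<bar>f x * (g x - g y) + g y * (f x - f y)\<bar>"
      by (simp add: dist_real_def algebra_simps)
    also have "\<dots> \<le> \<bar>f x\<bar> * \<bar>g x - g y\<bar> + \<bar>g y\<bar> * \<bar>f x - f y\<bar>"
      by (metis abs_mult abs_triangle_ineq)
    also have "\<dots> \<le> \<bar>A\<bar> * (M * dist x y) + \<bar>B\<bar> * (L * dist x y)"
      using A[OF xy(1)] B[OF xy(2)] lipschitz_onD[OF L xy] lipschitz_onD[OF M xy]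
      by (intro add_mono mult_mono) (auto simp: dist_real_def nonneg)
    finally show "dist (f x * g x) (f y * g y) \<le> (\<bar>A\<bar> * M + \<bar>B\<bar> * L) * dist x y"
      by (simp add: algebra_simps)
  qed (use nonneg in auto)
  then show ?thesis by blast
qed

lemma cos_diff_le: "\<bar>cos x - cos y\<bar> \<le> \<bar>x - y :: real\<bar>"
proof -
  have "\<bar>cos x - cos y\<bar> = 2 * \<bar>sin ((x + y) / 2)\<bar> * \<bar>sin ((y - x) / 2)\<bar>"
    by (simp add: cos_diff_cos abs_mult)
  also have "\<dots> \<le> 2 * 1 * \<bar>(y - x) / 2\<bar>"
    by (intro mult_mono) (use abs_sin_x_le_abs_x[of "(y - x) / 2"] in auto)
  finally show ?thesis by (simp add: abs_minus_commute)
qed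

lemma sin_diff_le: "\<bar>sin x - sin y\<bar> \<le> \<bar>x - y :: real\<bar>"
  using cos_diff_le[of "x - pi/2" "y - pi/2"] by (simp add: cos_diff)

text \<open>Let \<open>u x = cos (\<xi> \<bullet> x)\<close> and let \<open>m\<close> be the
  positive part of \<open>r^2 - |x|^2\<close>. The field \<open>m^2 grad u - u grad (m^2)\<close>
  keeps a factor \<open>m\<close>, so it is Lipschitz across the sphere and its divergence
  integrates to 0. The divergence is computed from \<open>laplace u = - |\<xi>|^2 u\<close> and,
  inside the ball, \<open>laplace (m^2) = 8 |x|^2 - 4 DIM('a) m\<close>.\<close>

lemma riesz_ft_laplacian:
  fixes \<xi> :: "'a::euclidean_space"
  assumes r: "r > 0"
  shows "(norm \<xi>)\<^sup>2 * riesz_ft 2 \<xi> r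
    = (4 * real DIM('a) + 8) * riesz_ft 1 \<xi> r - 8 * r\<^sup>2 * riesz_ft 0 \<xi> r"
proof -
  define S where "S = cball (0::'a) (r + 1)"
  define m where "m = (\<lambda>x::'a. max 0 (r\<^sup>2 - (norm x)\<^sup>2))"
  define ch where "ch = (indicator (ball (0::'a) r) :: 'a \<Rightarrow> real)"
  \<comment> \<open>\<open>f b\<close> is the \<open>b\<close>-component of the Green field, and
    \<open>f' b\<close> its derivative along \<open>b\<close> off the sphere.\<close>
  define f where "f = (\<lambda>b (x::'a). - (\<xi> \<bullet> b) * (m x * m x * sin (\<xi> \<bullet> x)) + 4 * (x \<bullet> b * m x * cos (\<xi> \<bullet> x)))"
  define f' where "f' = (\<lambda>b (x::'a). - (\<xi> \<bullet> b)\<^sup>2 * (ch x * (r\<^sup>2 - (norm x)\<^sup>2) ^ 2 * cos (\<xi> \<bullet> x))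
     + 4 * (ch x * (r\<^sup>2 - (norm x)\<^sup>2) ^ 1 * cos (\<xi> \<bullet> x)) - 8 * (ch x * (x \<bullet> b)\<^sup>2 * cos (\<xi> \<bullet> x)))"
  have m0: "m x = 0" if "norm x \<ge> r" for x
    using power_mono[OF that, of 2] r by (simp add: m_def)
  have m1: "m x = r\<^sup>2 - (norm x)\<^sup>2" if "norm x \<le> r" for x
    using power_mono[OF that, of 2] r by (simp add: m_def)
  have cont: "continuous_on UNIV (f b)" for b
    unfolding f_def m_def by (intro continuous_intros)
  have lip_m: "\<exists>L. L-lipschitz_on S m"
  proof -
    have "(2 * r + 2)-lipschitz_on S m"
    proof (rule lipschitz_onI)
      fix x y assume "x \<in> S" "y \<in> S"
      then have n: "norm x \<le> r + 1" "norm y \<le> r + 1" by (auto simp: S_def)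
      have "dist (m x) (m y) \<le> \<bar>(norm x)\<^sup>2 - (norm y)\<^sup>2\<bar>"
        unfolding m_def dist_real_def by linarith
      also have "\<dots> = \<bar>norm x - norm y\<bar> * (norm x + norm y)"
        by (simp add: power2_eq_square square_diff_square_factored abs_mult)
      also have "\<dots> \<le> dist x y * (2 * r + 2)"
        using n by (intro mult_mono) (auto simp: dist_norm norm_triangle_ineq3)
      finally show "dist (m x) (m y) \<le> (2 * r + 2) * dist x y" by (simp add: mult.commute)
    qed (use r in auto)
    then show ?thesis by blast
  qed
  have lip_inner: "\<exists>L. L-lipschitz_on S (\<lambda>x. x \<bullet> b)" for b
  proof -
    have "(norm b)-lipschitz_on S (\<lambda>x. x \<bullet> b)"
      by (rule lipschitz_onI)
         (auto simp: dist_real_def dist_norm inner_diff_left[symmetric] mult.commute[of "norm b"] Cauchy_Schwarz_ineq2)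
    then show ?thesis by blast
  qed
  have lip_trig: "\<exists>L. L-lipschitz_on S (\<lambda>x. sin (\<xi> \<bullet> x))" "\<exists>L. L-lipschitz_on S (\<lambda>x. cos (\<xi> \<bullet> x))"
  proof -
    have *: "\<bar>\<xi> \<bullet> x - \<xi> \<bullet> y\<bar> \<le> norm \<xi> * dist x y" for x y
      by (simp add: inner_diff_right[symmetric] dist_norm Cauchy_Schwarz_ineq2)
    have "(norm \<xi>)-lipschitz_on S (\<lambda>x. sin (\<xi> \<bullet> x))" "(norm \<xi>)-lipschitz_on S (\<lambda>x. cos (\<xi> \<bullet> x))"
      by (rule lipschitz_onI;
          use order_trans[OF sin_diff_le *] order_trans[OF cos_diff_le *] in \<open>auto simp: dist_real_def\<close>)+
    then show "\<exists>L. L-lipschitz_on S (\<lambda>x. sin (\<xi> \<bullet> x))" "\<exists>L. L-lipschitz_on S (\<lambda>x. cos (\<xi> \<bullet> x))"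
      by blast+
  qed
  have bS: "bounded S" by (simp add: S_def)
  have lip_f: "\<exists>L. L-lipschitz_on S (f b)" for b
  proof -
    obtain L1 where L1: "L1-lipschitz_on S (\<lambda>x. m x * m x * sin (\<xi> \<bullet> x))"
      using lipschitz_on_mult_bounded[OF bS lipschitz_on_mult_bounded[OF bS lip_m lip_m] lip_trig(1)] by blast
    obtain L2 where L2: "L2-lipschitz_on S (\<lambda>x. x \<bullet> b * m x * cos (\<xi> \<bullet> x))"
      using lipschitz_on_mult_bounded[OF bS lipschitz_on_mult_bounded[OF bS lip_inner lip_m] lip_trig(2)] by blast
    show ?thesis
      unfolding f_def by (rule exI, rule lipschitz_on_add[OF lipschitz_on_cmult_real[OF L1] lipschitz_on_cmult_real[OF L2]])
  qed
  have int2: "integrable lborel (\<lambda>x. ch x * (r\<^sup>2 - (norm x)\<^sup>2) ^ k * cos (\<xi> \<bullet> x))" for k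
    unfolding ch_def by (rule integrable_riesz[where C = 1]) auto
  have int3: "integrable lborel (\<lambda>x. ch x * (x \<bullet> b)\<^sup>2 * cos (\<xi> \<bullet> x))" if b: "b \<in> Basis" for b
  proof (rule integrable_bounded_support[where B = "r\<^sup>2" and r = r])
    show "(\<lambda>x. ch x * (x \<bullet> b)\<^sup>2 * cos (\<xi> \<bullet> x)) \<in> borel_measurable borel"
      unfolding ch_def by (intro borel_measurable_times borel_measurable_indicator) auto
    show "\<bar>ch x * (x \<bullet> b)\<^sup>2 * cos (\<xi> \<bullet> x)\<bar> \<le> r\<^sup>2" for x
    proof (cases "norm x < r")
      case True
      have "(x \<bullet> b)\<^sup>2 \<le> r\<^sup>2"
        using Basis_le_norm[OF b, of x] True r by (intro abs_le_square_iff[THEN iffD1]) auto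
      then have "(x \<bullet> b)\<^sup>2 * \<bar>cos (\<xi> \<bullet> x)\<bar> \<le> r\<^sup>2 * 1" by (intro mult_mono) auto
      then show ?thesis using True by (simp add: ch_def abs_mult)
    qed (auto simp: ch_def)
  qed (auto simp: ch_def)
  have int_f': "integrable lborel (f' b)" if b: "b \<in> Basis" for b
    unfolding f'_def by (intro Bochner_Integration.integrable_add Bochner_Integration.integrable_diff
        integrable_mult_right int2 int3 b)
  have zero: "(LBINT x. f' b x) = 0" if b: "b \<in> Basis" for b
  proof -
    obtain L where L: "L-lipschitz_on S (f b)" using lip_f by blast
    have f0: "f b x = 0" if "norm x \<ge> r" for x using m0[OF that] by (simp add: f_def)
    show ?thesis
    proof (rule integral_directional_derivative_eq_0[where f = "f b" and e = 1 and b = b])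
      have "bounded (f b ` S)"
        by (rule bounded_uniformly_continuous_image[OF lipschitz_on_uniformly_continuous[OF L] bS])
      then obtain A where A: "\<And>x. x \<in> S \<Longrightarrow> \<bar>f b x\<bar> \<le> A"
        unfolding bounded_iff by auto
      show "integrable lborel (f b)"
      proof (rule integrable_bounded_support[where B = "\<bar>A\<bar>" and r = r])
        show "\<bar>f b x\<bar> \<le> \<bar>A\<bar>" for x
          using A[of x] f0[of x] by (cases "x \<in> S") (auto simp: S_def)
      qed (use cont f0 in \<open>auto intro: borel_measurable_continuous_onI\<close>)
      show "f' b \<in> borel_measurable borel" using int_f'[OF b] by auto
      show "integrable lborel (\<lambda>x::'a. indicator (cball 0 (r + 1)) x * L)"
        by (rule integrable_bounded_support[where B = "\<bar>L\<bar>" and r = "r + 1"])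
           (auto simp: indicator_def)
      show "\<bar>f b (x + t *\<^sub>R b) - f b x\<bar> \<le> indicator (cball 0 (r + 1)) x * L * \<bar>t\<bar>"
        if t: "\<bar>t\<bar> < 1" for t x
      proof (cases "x \<in> S \<and> x + t *\<^sub>R b \<in> S")
        case True
        then show ?thesis
          using lipschitz_onD[OF L, of "x + t *\<^sub>R b" x] b
          by (auto simp: dist_real_def dist_norm S_def)
      next
        case False
        have n: "norm (t *\<^sub>R b) < 1" using b t by simp
        \<comment> \<open>\<open>S\<close> reaches one unit beyond the ball and the shift is shorter
          than one unit. So if either point leaves \<open>S\<close>, both have norm above
          \<open>r\<close>, where the field vanishes.\<close>
        have "f b (x + t *\<^sub>R b) = 0 \<and> f b x = 0"
        proof (cases "x \<in> S")
          case True
          then have "norm (x + t *\<^sub>R b) > r + 1" using False by (simp add: S_def)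
          then have "norm x > r" using n norm_triangle_ineq[of x "t *\<^sub>R b"] by linarith
          then show ?thesis using \<open>norm (x + t *\<^sub>R b) > r + 1\<close> by (auto intro!: f0)
        next
          case False
          then have "norm x > r + 1" by (simp add: S_def)
          moreover have "norm x \<le> norm (x + t *\<^sub>R b) + norm (t *\<^sub>R b)"
            using norm_triangle_ineq[of "x + t *\<^sub>R b" "- (t *\<^sub>R b)"] by simp
          ultimately show ?thesis using n by (auto intro!: f0)
        qed
        then show ?thesis using lipschitz_on_nonneg[OF L] by simp
      qed
      show "AE x in lborel. ((\<lambda>t. f b (x + t *\<^sub>R b)) has_real_derivative f' b x) (at 0)"
        using AE_lborel_norm_neq[of r]
      proof eventually_elim
        case (elim x)
        have inn: "(x + t *\<^sub>R b) \<bullet> b = x \<bullet> b + t" "\<xi> \<bullet> (x + t *\<^sub>R b) = \<xi> \<bullet> x + t * (\<xi> \<bullet> b)"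
          and nrm: "(norm (x + t *\<^sub>R b))\<^sup>2 = (norm x)\<^sup>2 + 2 * t * (x \<bullet> b) + t\<^sup>2" for t
          unfolding power2_norm_eq_inner using b
          by (auto simp: inner_add_left inner_add_right algebra_simps inner_commute power2_eq_square)
        show ?case
        proof (cases "norm x < r")
          case True
          define M where "M = (\<lambda>t. r\<^sup>2 - ((norm x)\<^sup>2 + 2 * t * (x \<bullet> b) + t\<^sup>2))"
          have "((\<lambda>t. - (\<xi> \<bullet> b) * (M t * M t * sin (\<xi> \<bullet> x + t * (\<xi> \<bullet> b)))
             + 4 * ((x \<bullet> b + t) * M t * cos (\<xi> \<bullet> x + t * (\<xi> \<bullet> b)))) has_real_derivative f' b x) (at 0)"
            unfolding M_def using True
            by (auto intro!: derivative_eq_intros simp: f'_def ch_def power2_eq_square) (simp add: algebra_simps)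
          then show ?thesis
          proof (rule has_field_derivative_transform_within[where d = "r - norm x"])
            fix t :: real assume "dist t 0 < r - norm x"
            then have "norm (x + t *\<^sub>R b) \<le> r"
              using norm_triangle_ineq[of x "t *\<^sub>R b"] b by simp
            from m1[OF this] show "- (\<xi> \<bullet> b) * (M t * M t * sin (\<xi> \<bullet> x + t * (\<xi> \<bullet> b)))
             + 4 * ((x \<bullet> b + t) * M t * cos (\<xi> \<bullet> x + t * (\<xi> \<bullet> b))) = f b (x + t *\<^sub>R b)"
              by (simp add: f_def inn nrm M_def)
          qed (use True in auto)
        next
          case False
          with elim have lt: "r < norm x" by simp
          have "((\<lambda>t. 0) has_real_derivative f' b x) (at 0)"
            using lt by (auto simp: f'_def ch_def)
          then show ?thesis
          proof (rule has_field_derivative_transform_within[where d = "norm x - r"])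
            fix t :: real assume "dist t 0 < norm x - r"
            moreover have "norm x \<le> norm (x + t *\<^sub>R b) + norm (t *\<^sub>R b)"
              using norm_triangle_ineq[of "x + t *\<^sub>R b" "- (t *\<^sub>R b)"] by simp
            ultimately show "0 = f b (x + t *\<^sub>R b)"
              using b f0[of "x + t *\<^sub>R b"] by simp
          qed (use lt in auto)
        qed
      qed
    qed simp
  qed
  have "0 = (\<Sum>b\<in>Basis. LBINT x. f' b x)" by (simp add: zero)
  also have "\<dots> = (LBINT x. (\<Sum>b\<in>Basis. f' b x))"
    by (rule Bochner_Integration.integral_sum[symmetric]) (use int_f' in auto)
  \<comment> \<open>After summation over the basis, \<open>|x|^2\<close> is written as
    \<open>r^2 - (r^2 - |x|^2)\<close>. This adds the 8 to \<open>4 * DIM('a)\<close> and leaves the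
    multiple of \<open>riesz_ft 0\<close>.\<close>
  also have "(\<lambda>x. \<Sum>b\<in>Basis. f' b x) = (\<lambda>x. - (norm \<xi>)\<^sup>2 * (ch x * (r\<^sup>2 - (norm x)\<^sup>2) ^ 2 * cos (\<xi> \<bullet> x))
     + (4 * real DIM('a) + 8) * (ch x * (r\<^sup>2 - (norm x)\<^sup>2) ^ 1 * cos (\<xi> \<bullet> x))
     - 8 * r\<^sup>2 * (ch x * (r\<^sup>2 - (norm x)\<^sup>2) ^ 0 * cos (\<xi> \<bullet> x)))" (is "?L = ?R")
  proof
    fix x
    have sq: "(\<Sum>b\<in>Basis. (v \<bullet> b)\<^sup>2) = (norm v)\<^sup>2" for v :: 'a
      unfolding power2_norm_eq_inner by (subst euclidean_inner) (simp add: power2_eq_square)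
    have "?L x = - (\<Sum>b\<in>Basis. (\<xi> \<bullet> b)\<^sup>2) * (ch x * (r\<^sup>2 - (norm x)\<^sup>2) ^ 2 * cos (\<xi> \<bullet> x))
     + 4 * real DIM('a) * (ch x * (r\<^sup>2 - (norm x)\<^sup>2) ^ 1 * cos (\<xi> \<bullet> x))
     - 8 * (ch x * (\<Sum>b\<in>Basis. (x \<bullet> b)\<^sup>2) * cos (\<xi> \<bullet> x))"
      unfolding f'_def
      by (simp add: sum.distrib sum_subtractf sum_distrib_right sum_distrib_left sum_negf mult_ac)
    also have "\<dots> = ?R x" unfolding sq by (simp add: algebra_simps)
    finally show "?L x = ?R x" .
  qed
  also have "(LBINT x. ?R x) = - (norm \<xi>)\<^sup>2 * riesz_ft 2 \<xi> r
    + (4 * real DIM('a) + 8) * riesz_ft 1 \<xi> r - 8 * r\<^sup>2 * riesz_ft 0 \<xi> r"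
    unfolding riesz_ft_def ch_def[symmetric]
    by (subst Bochner_Integration.integral_diff Bochner_Integration.integral_add,
        (intro Bochner_Integration.integrable_add Bochner_Integration.integrable_diff integrable_mult_right int2)+)+
       (simp only: integral_mult_right_zero)
  finally show ?thesis by simp
qed

text \<open>No oscillation is exploited here. The bound is sharp enough while
  \<open>r * norm \<xi>\<close> stays bounded, and it supplies the initial values for the energy
  estimate.\<close>

lemma abs_riesz_ft_le:
  fixes \<xi> :: "'a::euclidean_space"
  assumes r: "r > 0"
  shows "\<bar>riesz_ft k \<xi> r\<bar> \<le> unit_ball_vol (real DIM('a)) * r ^ (DIM('a) + 2 * k)"
proof -
  have "\<bar>riesz_ft k \<xi> r\<bar> \<le> (LBINT x. indicator (ball (0::'a) r) x * r ^ (2 * k))"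
    unfolding riesz_ft_def real_norm_def[symmetric]
  proof (rule Bochner_Integration.integral_norm_bound_integral)
    show "integrable lborel (\<lambda>x::'a. indicator (ball 0 r) x * (r\<^sup>2 - (norm x)\<^sup>2) ^ k * cos (\<xi> \<bullet> x))"
      by (rule integrable_riesz[where C = 1]) auto
    show "integrable lborel (\<lambda>x. indicator (ball (0::'a) r) x * r ^ (2 * k))"
      by (rule integrable_bounded_support[where B = "r ^ (2 * k)" and r = r])
         (use r in \<open>auto simp: indicator_def\<close>)
    show "norm (indicator (ball 0 r) x * (r\<^sup>2 - (norm x)\<^sup>2) ^ k * cos (\<xi> \<bullet> x))
      \<le> indicator (ball 0 r) x * r ^ (2 * k)" for x :: 'a
    proof (cases "x \<in> ball 0 r")
      case True
      then have "(norm x)\<^sup>2 \<le> r\<^sup>2" by (intro power_mono) auto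
      then have "\<bar>r\<^sup>2 - (norm x)\<^sup>2\<bar> ^ k * \<bar>cos (\<xi> \<bullet> x)\<bar> \<le> (r\<^sup>2) ^ k * 1"
        by (intro mult_mono power_mono) (auto simp: abs_if)
      then show ?thesis using True by (simp add: abs_mult power_abs power_mult)
    qed auto
  qed
  also have "\<dots> = measure lborel (ball (0::'a) r) * r ^ (2 * k)"
    by simp
  also have "measure lborel (ball (0::'a) r) = unit_ball_vol (real DIM('a)) * r ^ DIM('a)"
    using r content_ball[of r "0::'a"] by simp
  finally show ?thesis by (simp add: power_add mult_ac)
qed

text \<open>The integrand of \<open>riesz_ft 0\<close> jumps at the sphere, so it is not
  differentiated under the integral. Green's identity is solved for \<open>riesz_ft 0\<close>
  instead, and the two higher means on the other side have known derivatives.\<close>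

lemma has_real_derivative_riesz_ft_0:
  fixes \<xi> :: "'a::euclidean_space"
  assumes r: "r > 0"
  shows "(riesz_ft 0 \<xi> has_real_derivative
    (real DIM('a) * riesz_ft 0 \<xi> r - (norm \<xi>)\<^sup>2 / 2 * riesz_ft 1 \<xi> r) / r) (at r)"
proof -
  let ?n = "real DIM('a)"
  have eq: "riesz_ft 0 \<xi> s = ((4 * ?n + 8) * riesz_ft 1 \<xi> s - (norm \<xi>)\<^sup>2 * riesz_ft 2 \<xi> s) / (8 * s\<^sup>2)"
    if "s > 0" for s
    using riesz_ft_laplacian[OF that, of \<xi>] that by (simp add: field_simps)
  have d1: "(riesz_ft 1 \<xi> has_real_derivative 2 * r * riesz_ft 0 \<xi> r) (at r)"
    using has_real_derivative_riesz_ft[OF r, of 0 \<xi>] unfolding One_nat_def of_nat_1 mult_1_right by simp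
  have d2: "(riesz_ft 2 \<xi> has_real_derivative 4 * r * riesz_ft 1 \<xi> r) (at r)"
    using has_real_derivative_riesz_ft[OF r, of 1 \<xi>] by (simp add: numeral_2_eq_2)
  have "((\<lambda>s. ((4 * ?n + 8) * riesz_ft 1 \<xi> s - (norm \<xi>)\<^sup>2 * riesz_ft 2 \<xi> s) / (8 * s\<^sup>2)) has_real_derivative
     (((4 * ?n + 8) * (2 * r * riesz_ft 0 \<xi> r) - (norm \<xi>)\<^sup>2 * (4 * r * riesz_ft 1 \<xi> r)) * (8 * r\<^sup>2)
       - ((4 * ?n + 8) * riesz_ft 1 \<xi> r - (norm \<xi>)\<^sup>2 * riesz_ft 2 \<xi> r) * (16 * r)) / (8 * r\<^sup>2 * (8 * r\<^sup>2))) (at r)"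
    using r by (auto intro!: derivative_eq_intros d1[unfolded One_nat_def] d2)
  also have "(4 * ?n + 8) * riesz_ft 1 \<xi> r - (norm \<xi>)\<^sup>2 * riesz_ft 2 \<xi> r = 8 * r\<^sup>2 * riesz_ft 0 \<xi> r"
    using riesz_ft_laplacian[OF r, of \<xi>] by simp
  also have "(((4 * ?n + 8) * (2 * r * riesz_ft 0 \<xi> r) - (norm \<xi>)\<^sup>2 * (4 * r * riesz_ft 1 \<xi> r)) * (8 * r\<^sup>2)
       - 8 * r\<^sup>2 * riesz_ft 0 \<xi> r * (16 * r)) / (8 * r\<^sup>2 * (8 * r\<^sup>2))
     = (?n * riesz_ft 0 \<xi> r - (norm \<xi>)\<^sup>2 / 2 * riesz_ft 1 \<xi> r) / r"
    using r by (simp add: field_simps power2_eq_square)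
  finally show ?thesis
    by (rule has_field_derivative_transform_within[where d = r])
       (use r eq in \<open>auto simp: dist_real_def\<close>)
qed

text \<open>
  The pair \<open>(p, q)\<close> below satisfies \<open>p' = a / r * p - w * q\<close> and \<open>q' = - a / r * q + w * p\<close>. As
  \<open>(p * q)' = w * (p\<^sup>2 - q\<^sup>2)\<close>, subtracting \<open>2 * a / (w * r) * p * q\<close> from \<open>p\<^sup>2 + q\<^sup>2\<close> leaves an
  energy whose logarithmic derivative is integrable at infinity.
\<close>

lemma riesz_ft_decay:
  obtains C where "C > 0"
    and "\<And>(\<xi>::'a::euclidean_space) r. \<xi> \<noteq> 0 \<Longrightarrow> r > 0 \<Longrightarrow>
      \<bar>riesz_ft 0 \<xi> r\<bar> \<le> C * r powr ((real DIM('a) - 1) / 2) * norm \<xi> powr (- (real DIM('a) + 1) / 2)"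
    and "\<And>(\<xi>::'a::euclidean_space) r. \<xi> \<noteq> 0 \<Longrightarrow> r > 0 \<Longrightarrow>
      \<bar>riesz_ft 1 \<xi> r\<bar> \<le> C * r powr ((real DIM('a) + 1) / 2) * norm \<xi> powr (- (real DIM('a) + 3) / 2)"
proof -
  define n where "n = real DIM('a)"
  \<comment> \<open>The weight exponent for which the diagonal coefficients of the system for
    \<open>(p, q)\<close> become opposite: \<open>DIM('a) = 2 * a - 1\<close> turns them into
    \<open>a / s\<close> and \<open>- a / s\<close>.\<close>
  define a where "a = (n + 1) / 2"
  define v where "v = unit_ball_vol n"
  define c where "c = v * (2 * a) powr (a + 1)"
  have n1: "n \<ge> 1" by (simp add: n_def Suc_leI)
  have a1: "a \<ge> 1" using n1 by (simp add: a_def)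
  have v: "v > 0" unfolding v_def n_def by (intro unit_ball_vol_pos) simp
  have c: "c > 0" using v a1 by (simp add: c_def)
  have triv: "\<bar>riesz_ft 0 \<xi> r\<bar> \<le> v * (r powr (a - 1) * r powr a)" 
             "\<bar>riesz_ft 1 \<xi> r\<bar> \<le> v * (r powr a * r powr (a + 1))"
    if "r > 0" for \<xi> :: 'a and r
  proof -
    have "r powr (a - 1) * r powr a = r powr n"
      by (simp add: powr_add[symmetric] a_def field_simps)
    then have "r powr (a - 1) * r powr a = r ^ DIM('a)"
      using that by (simp add: n_def powr_realpow)
    then show "\<bar>riesz_ft 0 \<xi> r\<bar> \<le> v * (r powr (a - 1) * r powr a)"
      using abs_riesz_ft_le[OF that, of 0 \<xi>] by (simp add: v_def n_def)
    have "a + (a + 1) = n + 2" by (simp add: a_def field_simps)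
    then have "r powr a * r powr (a + 1) = r powr (n + 2)"
      by (simp only: powr_add[symmetric])
    also have "n + 2 = real (DIM('a) + 2)" by (simp add: n_def)
    finally have "r powr a * r powr (a + 1) = r ^ (DIM('a) + 2)"
      using that by (simp only: powr_realpow)
    then show "\<bar>riesz_ft 1 \<xi> r\<bar> \<le> v * (r powr a * r powr (a + 1))"
      using abs_riesz_ft_le[OF that, of 1 \<xi>] by (simp add: v_def n_def)
  qed
  have main: "\<bar>riesz_ft 0 \<xi> r\<bar> \<le> 10 * c * r powr (a - 1) * norm \<xi> powr (- a) \<and>
        \<bar>riesz_ft 1 \<xi> r\<bar> \<le> 10 * c * r powr a * norm \<xi> powr (- (a + 1))"
    if \<xi>: "\<xi> \<noteq> 0" and r: "r > 0" for \<xi> :: 'a and r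
  proof -
    define w where "w = norm \<xi>"
    \<comment> \<open>Up to \<open>r0\<close> the product \<open>s * w\<close> is at most
      \<open>2 * a\<close>, so the trivial bound has the right size. From \<open>r0\<close> on the
      factor \<open>2 * a / (w * s)\<close> is at most 1, so the cross term in the energy is at most
      half of \<open>p^2 + q^2\<close>.\<close>
    define r0 where "r0 = 2 * a / w"
    have w: "w > 0" using \<xi> by (simp add: w_def)
    have r0: "r0 > 0" using w a1 by (simp add: r0_def)
    have small: "s powr a \<le> (2 * a) powr (a + 1) * w powr (- a)"
      "s powr (a + 1) \<le> (2 * a) powr (a + 1) * w powr (- (a + 1))"
      if s: "s > 0" "s \<le> r0" for s
    proof -
      have "s powr a \<le> r0 powr a" using s a1 by (intro powr_mono2) auto
      also have "\<dots> = (2 * a) powr a * w powr (- a)"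
        using a1 w by (simp add: r0_def powr_divide powr_minus_divide)
      also have "\<dots> \<le> (2 * a) powr (a + 1) * w powr (- a)"
        using a1 by (intro mult_right_mono powr_mono) auto
      finally show "s powr a \<le> (2 * a) powr (a + 1) * w powr (- a)" .
      have "s powr (a + 1) \<le> r0 powr (a + 1)" using s a1 by (intro powr_mono2) auto
      also have "\<dots> = (2 * a) powr (a + 1) * w powr (- (a + 1))"
        unfolding powr_minus_divide r0_def using a1 w by (simp add: powr_divide)
      finally show "s powr (a + 1) \<le> (2 * a) powr (a + 1) * w powr (- (a + 1))" .
    qed
    have near: "\<bar>riesz_ft 0 \<xi> s\<bar> \<le> c * (s powr (a - 1) * w powr (- a))"
      "\<bar>riesz_ft 1 \<xi> s\<bar> \<le> c * (s powr a * w powr (- (a + 1)))"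
      if s: "s > 0" "s \<le> r0" for s
    proof -
      have "\<bar>riesz_ft 0 \<xi> s\<bar> \<le> v * (s powr (a - 1) * s powr a)" by (rule triv(1)[OF s(1)])
      also have "\<dots> \<le> v * (s powr (a - 1) * ((2 * a) powr (a + 1) * w powr (- a)))"
        using small(1)[OF s] v by (intro mult_left_mono) auto
      finally show "\<bar>riesz_ft 0 \<xi> s\<bar> \<le> c * (s powr (a - 1) * w powr (- a))"
        by (simp add: c_def mult_ac)
      have "\<bar>riesz_ft 1 \<xi> s\<bar> \<le> v * (s powr a * s powr (a + 1))" by (rule triv(2)[OF s(1)])
      also have "\<dots> \<le> v * (s powr a * ((2 * a) powr (a + 1) * w powr (- (a + 1))))"
        using small(2)[OF s] v by (intro mult_left_mono) auto
      finally show "\<bar>riesz_ft 1 \<xi> s\<bar> \<le> c * (s powr a * w powr (- (a + 1)))"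
        by (simp add: c_def mult_ac)
    qed
    show ?thesis
    proof (cases "r \<le> r0")
      case True
      have "c * (r powr (a - 1) * w powr (- a)) \<le> 10 * (c * (r powr (a - 1) * w powr (- a)))"
        "c * (r powr a * w powr (- (a + 1))) \<le> 10 * (c * (r powr a * w powr (- (a + 1))))"
        using c by auto
      with near[OF r True] show ?thesis unfolding w_def by (simp add: mult_ac)
    next
      case False
      define p where "p = (\<lambda>s. s * (s powr (- a) * riesz_ft 0 \<xi> s))"
      define q where "q = (\<lambda>s. w / 2 * (s powr (- a) * riesz_ft 1 \<xi> s))"
      define E where "E = (\<lambda>s. (p s)\<^sup>2 + (q s)\<^sup>2 - 2 * a / w * (p s * q s / s))"
      \<comment> \<open>Since \<open>E' = 2 * a / (w * s^2) * p * q\<close> and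
        \<open>p * q \<le> E\<close> beyond \<open>r0\<close>, the integrating factor with exponent
        \<open>2 * a / (w * s)\<close> makes \<open>G\<close> nonincreasing there.\<close>
      define G where "G = (\<lambda>s. E s * exp (2 * a / w / s))"
      have n: "real DIM('a) = 2 * a - 1" by (simp add: a_def n_def field_simps)
      have dp: "(p has_real_derivative (a / s * p s - w * q s)) (at s)" if "s > 0" for s
        unfolding p_def q_def
        using that
        by (auto intro!: derivative_eq_intros has_real_derivative_riesz_ft_0)
           (simp add: w_def[symmetric] n powr_diff field_simps power2_eq_square)
      have d1: "(riesz_ft 1 \<xi> has_real_derivative 2 * s * riesz_ft 0 \<xi> s) (at s)" if "s > 0" for s
        using has_real_derivative_riesz_ft[OF that, of 0 \<xi>] by simp
      have dq: "(q has_real_derivative (- a / s * q s + w * p s)) (at s)" if "s > 0" for s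
        unfolding p_def q_def
        using that
        by (auto intro!: derivative_eq_intros d1[unfolded One_nat_def])
           (simp add: powr_diff field_simps power2_eq_square)
      have dE: "(E has_real_derivative (2 * a / w * (p s * q s / s\<^sup>2))) (at s)" if "s > 0" for s
        unfolding E_def
        using that w
        by (auto intro!: derivative_eq_intros dp dq)
           (simp add: field_simps power2_eq_square)
      have dG: "(G has_real_derivative (2 * a / w / s\<^sup>2 * (p s * q s - E s) * exp (2 * a / w / s))) (at s)"
        if "s > 0" for s
        unfolding G_def
        using that w
        by (auto intro!: derivative_eq_intros dE)
           (simp add: field_simps power2_eq_square)
      have pq: "\<bar>p s * q s\<bar> \<le> ((p s)\<^sup>2 + (q s)\<^sup>2) / 2" for s
        using sum_squares_bound[of "\<bar>p s\<bar>" "\<bar>q s\<bar>"] by (simp add: abs_mult)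
      have cross: "\<bar>2 * a / w * (p s * q s / s)\<bar> \<le> ((p s)\<^sup>2 + (q s)\<^sup>2) / 2" if "s \<ge> r0" for s
      proof -
        have s: "s > 0" using that r0 by linarith
        have "2 * a / w / s \<le> 1" using that s w by (simp add: r0_def field_simps)
        then have "(2 * a / w / s) * \<bar>p s * q s\<bar> \<le> 1 * \<bar>p s * q s\<bar>"
          by (intro mult_right_mono) auto
        moreover have "\<bar>2 * a / w * (p s * q s / s)\<bar> = (2 * a / w / s) * \<bar>p s * q s\<bar>"
          using a1 w s by (simp add: abs_mult)
        ultimately show ?thesis using pq[of s] by linarith
      qed
      have E_bounds: "((p s)\<^sup>2 + (q s)\<^sup>2) / 2 \<le> E s" "E s \<le> 3 / 2 * ((p s)\<^sup>2 + (q s)\<^sup>2)"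
        if "s \<ge> r0" for s
        unfolding E_def using abs_le_D1[OF cross[OF that]] abs_le_D2[OF cross[OF that]] by argo+
      have "G r \<le> G r0"
      proof (rule DERIV_nonpos_imp_nonincreasing[where f = G])
        fix s assume s: "r0 \<le> s" "s \<le> r"
        have s0: "s > 0" using s r0 by linarith
        have "p s * q s \<le> E s" using E_bounds(1)[OF s(1)] pq[of s] by linarith
        then have "2 * a / w / s\<^sup>2 * (p s * q s - E s) * exp (2 * a / w / s) \<le> 0"
          using a1 w s0 by (intro mult_nonpos_nonneg mult_nonneg_nonpos) auto
        then show "\<exists>y. (G has_real_derivative y) (at s) \<and> y \<le> 0" using dG[OF s0] by blast
      qed (use False in simp)
      have Er: "((p r)\<^sup>2 + (q r)\<^sup>2) / 2 \<le> E r" using E_bounds(1)[of r] False by simp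
      have "p r ^ 2 + q r ^ 2 \<le> 2 * E r" using Er by simp
      also have "E r \<le> G r"
      proof -
        have "E r \<ge> 0" by (rule order_trans[OF _ Er]) simp
        moreover have "1 \<le> exp (2 * a / w / r)" using a1 w r by simp
        ultimately show ?thesis unfolding G_def by (metis mult.right_neutral mult_left_mono)
      qed
      also note \<open>G r \<le> G r0\<close>
      \<comment> \<open>At \<open>r0\<close> the exponent equals 1. With
        \<open>exp 1 \<le> 3\<close> and the comparison factors 2 and 3/2 between \<open>E\<close>
        and \<open>p^2 + q^2\<close>, the constant becomes 9.\<close>
      also have "G r0 = E r0 * exp 1" using w a1 by (simp add: G_def r0_def)
      also have "E r0 * exp 1 \<le> (3 / 2 * ((p r0)\<^sup>2 + (q r0)\<^sup>2)) * 3"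
        using E_bounds(2)[of r0] exp_le by (intro mult_mono) auto
      finally have 1: "(p r)\<^sup>2 + (q r)\<^sup>2 \<le> 9 * ((p r0)\<^sup>2 + (q r0)\<^sup>2)" by simp
      have "\<bar>p r0\<bar> \<le> c * w powr (- a)"
      proof -
        have "\<bar>p r0\<bar> \<le> r0 * (r0 powr (- a) * (c * (r0 powr (a - 1) * w powr (- a))))"
          using near(1)[OF r0] r0 unfolding p_def by (simp add: abs_mult mult_left_mono)
        also have "\<dots> = c * w powr (- a)" using r0 by (simp add: powr_diff powr_minus)
        finally show ?thesis .
      qed
      then have 2: "(p r0)\<^sup>2 \<le> (c * w powr (- a))\<^sup>2"
        using c by (intro abs_le_square_iff[THEN iffD1]) (simp add: abs_mult)
      have "\<bar>q r0\<bar> \<le> c * w powr (- a)"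
      proof -
        have "\<bar>q r0\<bar> \<le> w / 2 * (r0 powr (- a) * (c * (r0 powr a * w powr (- (a + 1)))))"
          using near(2)[OF r0] w unfolding q_def by (simp add: abs_mult mult_left_mono)
        also have "\<dots> = c * w powr (- a) / 2"
          using r0 w by (simp add: powr_add powr_minus powr_diff)
        also have "\<dots> \<le> c * w powr (- a)" using c by simp
        finally show ?thesis .
      qed
      then have 3: "(q r0)\<^sup>2 \<le> (c * w powr (- a))\<^sup>2"
        using c by (intro abs_le_square_iff[THEN iffD1]) (simp add: abs_mult)
      \<comment> \<open>Both initial squares obey the same bound, so the constant is 18, which is
        below the square of 5. Undoing the factor \<open>w / 2\<close> in \<open>q\<close> turns 5
        into 10.\<close>
      have 4: "(p r)\<^sup>2 + (q r)\<^sup>2 \<le> (5 * (c * w powr (- a)))\<^sup>2"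
      proof -
        have "x \<le> (5 * X)\<^sup>2" if "x \<le> 9 * (y + z)" "y \<le> X\<^sup>2" "z \<le> X\<^sup>2" for x y z X :: real
        proof -
          have "(5 * X)\<^sup>2 = 25 * X\<^sup>2" by (simp add: power_mult_distrib)
          with that show ?thesis by (smt (verit) zero_le_power2)
        qed
        from this[OF 1 2 3] show ?thesis .
      qed
      have "(p r)\<^sup>2 \<le> (5 * (c * w powr (- a)))\<^sup>2" "(q r)\<^sup>2 \<le> (5 * (c * w powr (- a)))\<^sup>2"
        using 4 by (smt (verit) zero_le_power2)+
      then have pr: "\<bar>p r\<bar> \<le> 5 * (c * w powr (- a))" and qr: "\<bar>q r\<bar> \<le> 5 * (c * w powr (- a))"
        using c by (auto intro!: power2_le_imp_le[of "\<bar>_\<bar>"] simp del: power_mult_distrib simp: power2_abs)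
      have "riesz_ft 0 \<xi> r = r powr (a - 1) * p r" using r by (simp add: p_def powr_diff powr_minus)
      then have "\<bar>riesz_ft 0 \<xi> r\<bar> \<le> r powr (a - 1) * (5 * (c * w powr (- a)))"
        using pr by (simp add: abs_mult mult_left_mono)
      also have "\<dots> \<le> 10 * c * r powr (a - 1) * w powr (- a)" using c by simp
      finally have I: "\<bar>riesz_ft 0 \<xi> r\<bar> \<le> 10 * c * r powr (a - 1) * w powr (- a)" .
      have "riesz_ft 1 \<xi> r = 2 / w * (r powr a * q r)" using r w by (simp add: q_def powr_minus)
      then have "\<bar>riesz_ft 1 \<xi> r\<bar> = 2 / w * (r powr a * \<bar>q r\<bar>)"
        using w by (simp add: abs_mult)
      also have "\<dots> \<le> 2 / w * (r powr a * (5 * (c * w powr (- a))))"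
        using qr w by (intro mult_left_mono) auto
      also have "\<dots> = 10 * c * r powr a * w powr (- (a + 1))"
        using w by (simp add: powr_add powr_minus powr_diff field_simps)
      finally show ?thesis using I by (simp add: w_def)
    qed
  qed
  show ?thesis
  proof (rule that)
    show "10 * c > 0" using c by simp
    have e: "(real DIM('a) - 1) / 2 = a - 1" "- (real DIM('a) + 1) / 2 = - a"
      "(real DIM('a) + 1) / 2 = a" "- (real DIM('a) + 3) / 2 = - (a + 1)"
      by (simp_all add: a_def n_def field_simps)
    show "\<bar>riesz_ft 0 \<xi> r\<bar> \<le> 10 * c * r powr ((real DIM('a) - 1) / 2) * norm \<xi> powr (- (real DIM('a) + 1) / 2)"
      "\<bar>riesz_ft 1 \<xi> r\<bar> \<le> 10 * c * r powr ((real DIM('a) + 1) / 2) * norm \<xi> powr (- (real DIM('a) + 3) / 2)"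
      if "\<xi> \<noteq> 0" "r > 0" for \<xi> :: 'a and r
      unfolding e using main[OF that] by auto
  qed
qed

section \<open>Fourier transform of the profile\<close>

text \<open>Both \<open>k - f\<close> and \<open>k + f\<close> are nondecreasing. This takes the
  place of integrating the inequality between the derivatives: the estimates below run on
  antiderivatives alone.\<close>

lemma abs_diff_le_of_derivative_le:
  fixes f k f' k' :: "real \<Rightarrow> real"
  assumes "a \<le> b"
    and f: "\<And>s. a \<le> s \<Longrightarrow> s \<le> b \<Longrightarrow> (f has_real_derivative f' s) (at s)"
    and k: "\<And>s. a \<le> s \<Longrightarrow> s \<le> b \<Longrightarrow> (k has_real_derivative k' s) (at s)"
    and le: "\<And>s. a \<le> s \<Longrightarrow> s \<le> b \<Longrightarrow> \<bar>f' s\<bar> \<le> k' s"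
  shows "\<bar>f b - f a\<bar> \<le> k b - k a"
proof -
  have "k a - f a \<le> k b - f b"
  proof (rule DERIV_nonneg_imp_nondecreasing[OF \<open>a \<le> b\<close>, of "\<lambda>s. k s - f s"])
    fix s assume s: "a \<le> s" "s \<le> b"
    show "\<exists>y. ((\<lambda>s. k s - f s) has_real_derivative y) (at s) \<and> 0 \<le> y"
      using DERIV_diff[OF k[OF s] f[OF s]] le[OF s] by (intro exI[of _ "k' s - f' s"]) auto
  qed
  moreover have "k a + f a \<le> k b + f b"
  proof (rule DERIV_nonneg_imp_nondecreasing[OF \<open>a \<le> b\<close>, of "\<lambda>s. k s + f s"])
    fix s assume s: "a \<le> s" "s \<le> b"
    show "\<exists>y. ((\<lambda>s. k s + f s) has_real_derivative y) (at s) \<and> 0 \<le> y"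
      using DERIV_add[OF k[OF s] f[OF s]] le[OF s] by (intro exI[of _ "k' s + f' s"]) auto
  qed
  ultimately show ?thesis by linarith
qed

text \<open>Near the edge, \<open>R powr \<alpha> - \<rho> powr \<alpha>\<close> is comparable to
  \<open>R powr (\<alpha> - 1) * (R - \<rho>)\<close>. Both directions matter: the profile raises
  this difference to the power \<beta>, its derivative to the power \<open>\<beta> - 1\<close>,
  which is not positive.\<close>

lemma powr_diff_bounds:
  fixes \<alpha> :: real
  assumes "\<alpha> \<ge> 1" "0 < \<rho>" "\<rho> \<le> R"
  shows "R powr (\<alpha> - 1) * (R - \<rho>) \<le> R powr \<alpha> - \<rho> powr \<alpha>"
    and "R powr \<alpha> - \<rho> powr \<alpha> \<le> \<alpha> * R powr (\<alpha> - 1) * (R - \<rho>)"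
proof -
  have "\<rho> powr \<alpha> = \<rho> powr (\<alpha> - 1) * \<rho>" "R powr \<alpha> = R powr (\<alpha> - 1) * R"
    using assms by (simp_all add: powr_diff)
  moreover have "\<rho> powr (\<alpha> - 1) * \<rho> \<le> R powr (\<alpha> - 1) * \<rho>"
    using assms by (intro mult_right_mono powr_mono2) auto
  ultimately show "R powr (\<alpha> - 1) * (R - \<rho>) \<le> R powr \<alpha> - \<rho> powr \<alpha>"
    by (simp add: right_diff_distrib)
  have "\<bar>R powr \<alpha> - \<rho> powr \<alpha>\<bar> \<le> \<alpha> * R powr (\<alpha> - 1) * R - \<alpha> * R powr (\<alpha> - 1) * \<rho>"
  proof (rule abs_diff_le_of_derivative_le[where f' = "\<lambda>s. \<alpha> * s powr (\<alpha> - 1)" and k' = "\<lambda>s. \<alpha> * R powr (\<alpha> - 1)"])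
    show "\<bar>\<alpha> * s powr (\<alpha> - 1)\<bar> \<le> \<alpha> * R powr (\<alpha> - 1)" if "\<rho> \<le> s" "s \<le> R" for s
      using assms that by (simp add: abs_mult powr_mono2)
  qed (use assms in \<open>auto intro!: derivative_eq_intros\<close>)
  then show "R powr \<alpha> - \<rho> powr \<alpha> \<le> \<alpha> * R powr (\<alpha> - 1) * (R - \<rho>)"
    by (simp add: right_diff_distrib)
qed

text \<open>Up to the factor \<open>A powr (- (2 / \<alpha>))\<close>, half the length of the slice
  of the Heisenberg ball over any \<open>z\<close> with \<open>norm z = s\<close>; the
  \<open>max\<close> makes it 0 outside the ball of radius \<open>R\<close>.\<close>

definition profile :: "real \<Rightarrow> real \<Rightarrow> real \<Rightarrow> real" where
  "profile \<alpha> R s = (max 0 (R powr \<alpha> - s powr \<alpha>)) powr (2 / \<alpha>)"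

lemma profile_nonneg [simp]: "0 \<le> profile \<alpha> R s"
  by (simp add: profile_def)

lemma profile_eq_0: "\<alpha> > 0 \<Longrightarrow> 0 \<le> R \<Longrightarrow> R \<le> s \<Longrightarrow> profile \<alpha> R s = 0"
  by (simp add: profile_def powr_mono2)

lemma profile_antimono: "\<alpha> > 0 \<Longrightarrow> 0 \<le> s \<Longrightarrow> s \<le> t \<Longrightarrow> profile \<alpha> R t \<le> profile \<alpha> R s"
  unfolding profile_def by (intro powr_mono2) (auto simp: max_def powr_mono2 intro: order_trans[OF powr_mono2])

lemma profile_mono: "\<alpha> > 0 \<Longrightarrow> 0 \<le> R \<Longrightarrow> R \<le> R' \<Longrightarrow> profile \<alpha> R s \<le> profile \<alpha> R' s"
  unfolding profile_def by (intro powr_mono2) (auto simp: max_def powr_mono2 intro: order_trans[OF _ powr_mono2])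

lemma profile_0: "\<alpha> > 0 \<Longrightarrow> 0 \<le> R \<Longrightarrow> profile \<alpha> R 0 = R\<^sup>2"
  by (cases "R = 0") (simp_all add: profile_def powr_powr)

lemma profile_strict_antimono:
  assumes "\<alpha> > 0" "0 \<le> s" "s < t" "t \<le> R"
  shows "profile \<alpha> R t < profile \<alpha> R s"
proof -
  have "s powr \<alpha> < t powr \<alpha>" "t powr \<alpha> \<le> R powr \<alpha>"
    using assms by (auto intro: powr_less_mono2 powr_mono2)
  then show ?thesis
    unfolding profile_def using assms by (intro powr_less_mono2) auto
qed

lemma profile_measurable [measurable]: "profile \<alpha> R \<in> borel_measurable borel"
  unfolding profile_def[abs_def] by measurable

lemma profile_le: "\<alpha> > 0 \<Longrightarrow> 0 \<le> R \<Longrightarrow> 0 \<le> s \<Longrightarrow> profile \<alpha> R s \<le> R\<^sup>2"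
  using profile_antimono[of \<alpha> 0 s R] by (simp add: profile_0)

text \<open>The superposition of balls is handled through a variable cut height. \<open>J s\<close>
  is the transform of the part of the profile above the height \<open>g s\<close>. Its derivative is
  \<open>W s * s * riesz_ft 0 \<xi> s\<close>, and it grows from 0 at the centre to the full
  transform at \<open>R\<close>. The hypothesis \<open>R * norm \<xi> \<ge> 2\<close> puts the
  splitting radius, at distance \<open>1 / norm \<xi>\<close> from the edge, into the outer half of
  the ball.\<close>

lemma profile_ft_bound:
  fixes \<alpha> :: real
  assumes \<alpha>: "\<alpha> \<ge> 2"
  obtains C where "C > 0"
    and "\<And>(\<xi>::'a::euclidean_space) R. R > 0 \<Longrightarrow> R * norm \<xi> \<ge> 2 \<Longrightarrow>
      \<bar>LBINT x. profile \<alpha> R (norm x) * cos (\<xi> \<bullet> x)\<bar>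
      \<le> C * R powr ((real DIM('a) + 3) / 2 - 2 / \<alpha>) * norm \<xi> powr (- (real DIM('a) + 1) / 2 - 2 / \<alpha>)"
proof -
  obtain C where C: "C > 0"
    and U0: "\<And>(\<xi>::'a) r. \<xi> \<noteq> 0 \<Longrightarrow> r > 0 \<Longrightarrow>
      \<bar>riesz_ft 0 \<xi> r\<bar> \<le> C * r powr ((real DIM('a) - 1) / 2) * norm \<xi> powr (- (real DIM('a) + 1) / 2)"
    and U1: "\<And>(\<xi>::'a) r. \<xi> \<noteq> 0 \<Longrightarrow> r > 0 \<Longrightarrow>
      \<bar>riesz_ft 1 \<xi> r\<bar> \<le> C * r powr ((real DIM('a) + 1) / 2) * norm \<xi> powr (- (real DIM('a) + 3) / 2)"
    using riesz_ft_decay by blast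
  define n where "n = real DIM('a)"
  define \<beta> where "\<beta> = 2 / \<alpha>"
  have n1: "n \<ge> 1" by (simp add: n_def Suc_leI)
  have \<beta>: "0 < \<beta>" "\<beta> \<le> 1" using \<alpha> by (simp_all add: \<beta>_def)
  have \<alpha>\<beta>: "\<alpha> * \<beta> = 2" using \<alpha> by (simp add: \<beta>_def)
  have "\<bar>LBINT x. profile \<alpha> R (norm x) * cos (\<xi> \<bullet> x)\<bar>
      \<le> C * (2 + \<alpha> powr \<beta>) * R powr ((n + 3) / 2 - \<beta>) * norm \<xi> powr (- (n + 1) / 2 - \<beta>)"
    if R: "R > 0" and wR: "R * norm \<xi> \<ge> 2" for \<xi> :: 'a and R
  proof -
    define w where "w = norm \<xi>"
    have \<xi>0: "\<xi> \<noteq> 0" using wR by auto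
    have w: "w > 0" using \<xi>0 by (simp add: w_def)
    define g where "g = profile \<alpha> R"
    \<comment> \<open>\<open>W s\<close> is \<open>- g' s / s\<close>, the density of ball
      indicators in the profile. Both of its factors are nondecreasing because
      \<open>\<alpha> \<ge> 2\<close> and \<open>\<beta> \<le> 1\<close>, whence
      \<open>W' \<ge> 0\<close>.\<close>
    define W where "W = (\<lambda>s. 2 * (s powr (\<alpha> - 2) * (R powr \<alpha> - s powr \<alpha>) powr (\<beta> - 1)))"
    define W' where "W' = (\<lambda>s. 2 * ((\<alpha> - 2) * s powr (\<alpha> - 3) * (R powr \<alpha> - s powr \<alpha>) powr (\<beta> - 1)
      + s powr (\<alpha> - 2) * ((1 - \<beta>) * (R powr \<alpha> - s powr \<alpha>) powr (\<beta> - 2) * (\<alpha> * s powr (\<alpha> - 1)))))"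
    define \<Psi> where "\<Psi> = (\<lambda>c. LBINT x. max 0 (g (norm x) - c) * cos (\<xi> \<bullet> x))"
    define J where "J = (\<lambda>s. \<Psi> (g s))"
    define m where "m = C * R powr ((n + 1) / 2) * w powr (- (n + 3) / 2)"
    define M where "M = C * R powr ((n - 1) / 2) * w powr (- (n + 1) / 2)"
    have pos: "R powr \<alpha> - s powr \<alpha> > 0" if "0 < s" "s < R" for s
      using that \<alpha> by (simp add: powr_less_mono2)
    have mbd: "\<bar>riesz_ft 1 \<xi> s\<bar> \<le> m" if s: "0 < s" "s \<le> R" for s
    proof -
      have "\<bar>riesz_ft 1 \<xi> s\<bar> \<le> C * s powr ((n + 1) / 2) * w powr (- (n + 3) / 2)"
        using U1[OF \<xi>0 s(1)] by (simp add: n_def w_def)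
      also have "\<dots> \<le> m" unfolding m_def
        using s n1 C by (intro mult_right_mono mult_left_mono powr_mono2) auto
      finally show ?thesis .
    qed
    have Mbd: "\<bar>riesz_ft 0 \<xi> s\<bar> \<le> M" if s: "0 < s" "s \<le> R" for s
    proof -
      have "\<bar>riesz_ft 0 \<xi> s\<bar> \<le> C * s powr ((n - 1) / 2) * w powr (- (n + 1) / 2)"
        using U0[OF \<xi>0 s(1)] by (simp add: n_def w_def)
      also have "\<dots> \<le> M" unfolding M_def
        using s n1 C by (intro mult_right_mono mult_left_mono powr_mono2) auto
      finally show ?thesis .
    qed
    have m0: "0 \<le> m" "0 \<le> M" using C by (auto simp: m_def M_def)
    have dpow: "((\<lambda>s. (R powr \<alpha> - s powr \<alpha>) powr c) has_real_derivative
      c * (R powr \<alpha> - s powr \<alpha>) powr (c - 1) * (0 - \<alpha> * s powr (\<alpha> - 1))) (at s)" if s: "0 < s" "s < R" for s c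
      by (rule DERIV_chain2[OF has_real_derivative_powr[OF pos[OF s]]
            DERIV_diff[OF DERIV_const has_real_derivative_powr[OF s(1)]]])
    have dg: "(g has_real_derivative - (W s * s)) (at s)" if s: "0 < s" "s < R" for s
    proof -
      have e: "s powr (\<alpha> - 1) = s powr (\<alpha> - 2) * s"
        using s by (simp add: powr_diff power2_eq_square)
      have "\<beta> * (R powr \<alpha> - s powr \<alpha>) powr (\<beta> - 1) * (0 - \<alpha> * s powr (\<alpha> - 1))
        = - ((\<alpha> * \<beta>) * (s powr (\<alpha> - 2) * (R powr \<alpha> - s powr \<alpha>) powr (\<beta> - 1)) * s)"
        unfolding e by simp
      also have "\<dots> = - (W s * s)" unfolding \<alpha>\<beta> W_def by simp
      finally have "((\<lambda>s. (R powr \<alpha> - s powr \<alpha>) powr \<beta>) has_real_derivative - (W s * s)) (at s)"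
        using dpow[OF s, of \<beta>] by simp
      then show ?thesis
      proof (rule has_field_derivative_transform_within_open[of _ _ _ "{0<..<R}"])
        fix t assume "t \<in> {0<..<R}"
        then show "(R powr \<alpha> - t powr \<alpha>) powr \<beta> = g t"
          using pos[of t] by (simp add: g_def profile_def \<beta>_def)
      qed (use s in auto)
    qed
    have dW: "(W has_real_derivative W' s) (at s)" if s: "0 < s" "s < R" for s
    proof -
      have "\<alpha> - 2 - 1 = \<alpha> - 3" "\<beta> - 1 - 1 = \<beta> - 2" by simp_all
      note * = DERIV_cmult[OF DERIV_mult[OF has_real_derivative_powr[OF s(1), of "\<alpha> - 2"] dpow[OF s, of "\<beta> - 1"]], of 2,
          unfolded this]
      show ?thesis
        unfolding W_def by (rule DERIV_cong[OF *]) (simp add: W'_def algebra_simps)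
    qed
    have W'0: "0 \<le> W' s" if s: "0 < s" "s < R" for s
      unfolding W'_def using \<alpha> \<beta> s by (intro mult_nonneg_nonneg add_nonneg_nonneg) auto
    have W0: "0 \<le> W s" for s by (simp add: W_def)
    have g_meas: "(\<lambda>x::'a. g (norm x)) \<in> borel_measurable borel"
      unfolding g_def by measurable
    have int: "integrable lborel (\<lambda>x::'a. max 0 (g (norm x) - c) * cos (\<xi> \<bullet> x))"
      if c: "c \<ge> 0" for c
    proof (rule integrable_bounded_support[where B = "R\<^sup>2" and r = R])
      show "(\<lambda>x::'a. max 0 (g (norm x) - c) * cos (\<xi> \<bullet> x)) \<in> borel_measurable borel"
        using g_meas by (intro borel_measurable_times borel_measurable_max borel_measurable_diff) auto
      show "\<bar>max 0 (g (norm x) - c) * cos (\<xi> \<bullet> x)\<bar> \<le> R\<^sup>2" for x :: 'a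
      proof -
        have "g (norm x) \<le> R\<^sup>2" unfolding g_def using \<alpha> R by (intro profile_le) auto
        then have "\<bar>max 0 (g (norm x) - c)\<bar> * \<bar>cos (\<xi> \<bullet> x)\<bar> \<le> R\<^sup>2 * 1"
          using c by (intro mult_mono) auto
        then show ?thesis by (simp add: abs_mult)
      qed
      show "max 0 (g (norm x) - c) * cos (\<xi> \<bullet> x) = 0" if "norm x > R" for x :: 'a
        using that c R \<alpha> profile_eq_0[of \<alpha> R "norm x"] by (simp add: g_def)
    qed
    have int_ball: "integrable lborel (\<lambda>x::'a. indicator (ball 0 r) x * c)" for r c :: real
      by (rule integrable_bounded_support[where B = "\<bar>c\<bar>" and r = r]) (auto simp: indicator_def)
    \<comment> \<open>The points where the profile exceeds \<open>g \<rho>\<close> form the ball of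
      radius \<rho>, so off the sphere the derivative of the truncated profile in the height is
      minus the indicator of that ball.\<close>
    have d\<Psi>: "(\<Psi> has_real_derivative - riesz_ft 0 \<xi> \<rho>) (at (g \<rho>))" if \<rho>: "0 < \<rho>" "\<rho> < R" for \<rho>
    proof -
      have g\<rho>: "g \<rho> > 0"
        using profile_strict_antimono[of \<alpha> \<rho> R R] \<rho> \<alpha> profile_eq_0[of \<alpha> R R] by (simp add: g_def)
      have "(\<Psi> has_real_derivative (LBINT x. - (indicator (ball 0 \<rho>) x * (\<rho>\<^sup>2 - (norm x)\<^sup>2) ^ 0 * cos (\<xi> \<bullet> x)))) (at (g \<rho>))"
        unfolding \<Psi>_def
      proof (rule has_real_derivative_lebesgue_integral[OF g\<rho>])
        show "integrable lborel (\<lambda>x. max 0 (g (norm x) - t) * cos (\<xi> \<bullet> x))" if "\<bar>t - g \<rho>\<bar> < g \<rho>" for t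
          by (rule int) (use that in linarith)
        show "(\<lambda>x. - (indicator (ball 0 \<rho>) x * (\<rho>\<^sup>2 - (norm x)\<^sup>2) ^ 0 * cos (\<xi> \<bullet> x))) \<in> borel_measurable lborel"
          by (rule borel_measurable_integrable, rule integrable_minus, rule integrable_riesz[where C = 1]) auto
        show "integrable lborel (\<lambda>x::'a. indicator (cball 0 R) x * (1::real))"
          by (rule integrable_bounded_support[where B = 1 and r = R]) (auto simp: indicator_def)
        show "\<bar>max 0 (g (norm x) - t) * cos (\<xi> \<bullet> x) - max 0 (g (norm x) - g \<rho>) * cos (\<xi> \<bullet> x)\<bar>
          \<le> indicator (cball 0 R) x * 1 * \<bar>t - g \<rho>\<bar>" if t: "\<bar>t - g \<rho>\<bar> < g \<rho>" for t and x :: 'a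
        proof (cases "norm x \<le> R")
          case True
          have "\<bar>max 0 (g (norm x) - t) - max 0 (g (norm x) - g \<rho>)\<bar> * \<bar>cos (\<xi> \<bullet> x)\<bar> \<le> \<bar>t - g \<rho>\<bar> * 1"
            by (intro mult_mono) auto
          then show ?thesis using True by (simp add: left_diff_distrib[symmetric] abs_mult)
        next
          case False
          then have "g (norm x) = 0" using \<alpha> R by (simp add: g_def profile_eq_0)
          moreover have "t > 0" using t by linarith
          ultimately show ?thesis using g\<rho> False by simp
        qed
        show "AE x in lborel. ((\<lambda>t. max 0 (g (norm x) - t) * cos (\<xi> \<bullet> x)) has_real_derivative
           - (indicator (ball 0 \<rho>) x * (\<rho>\<^sup>2 - (norm x)\<^sup>2) ^ 0 * cos (\<xi> \<bullet> x))) (at (g \<rho>))"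
          using AE_lborel_norm_neq[of \<rho>]
        proof eventually_elim
          case (elim x)
          show ?case
          proof (cases "norm x < \<rho>")
            case True
            then have lt: "g \<rho> < g (norm x)"
              unfolding g_def using \<alpha> \<rho> by (intro profile_strict_antimono) auto
            have "((\<lambda>t. (g (norm x) - t) * cos (\<xi> \<bullet> x)) has_real_derivative
              - (indicator (ball 0 \<rho>) x * (\<rho>\<^sup>2 - (norm x)\<^sup>2) ^ 0 * cos (\<xi> \<bullet> x))) (at (g \<rho>))"
              using True by (auto intro!: derivative_eq_intros)
            then show ?thesis
              by (rule has_field_derivative_transform_within_open[of _ _ _ "{..<g (norm x)}"]) (use lt in auto)
          next
            case False
            then have "norm x > \<rho>" using elim by simp
            have lt: "g (norm x) < g \<rho>"
            proof (cases "norm x \<le> R")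
              case True
              then show ?thesis
                unfolding g_def using \<alpha> \<rho> \<open>norm x > \<rho>\<close> by (intro profile_strict_antimono) auto
            next
              case False
              then have "g (norm x) = 0" using \<alpha> R by (simp add: g_def profile_eq_0)
              then show ?thesis using g\<rho> by simp
            qed
            have "((\<lambda>t. 0) has_real_derivative
              - (indicator (ball 0 \<rho>) x * (\<rho>\<^sup>2 - (norm x)\<^sup>2) ^ 0 * cos (\<xi> \<bullet> x))) (at (g \<rho>))"
              using False by auto
            then show ?thesis
              by (rule has_field_derivative_transform_within_open[of _ _ _ "{g (norm x)<..}"]) (use lt in auto)
          qed
        qed
      qed
      then show ?thesis by (simp add: riesz_ft_def)
    qed
    have dJ: "(J has_real_derivative W s * s * riesz_ft 0 \<xi> s) (at s)" if s: "0 < s" "s < R" for s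
      unfolding J_def using DERIV_chain2[OF d\<Psi>[OF s] dg[OF s]] by (simp add: mult_ac)
    define v where "v = measure lborel (ball (0::'a) 1)"
    have vol: "measure lborel (ball (0::'a) r) = v * r ^ DIM('a)" if "r \<ge> 0" for r
      using content_ball[of r "0::'a"] content_ball[of 1 "0::'a"] that by (simp add: v_def)
    have v0: "v \<ge> 0" by (simp add: v_def)
    \<comment> \<open>The derivative of \<open>J\<close> is known only strictly between 0 and
      \<open>R\<close>. This bound and \<open>\<Psi>_near0\<close> allow the two endpoints to be
      reached as limits.\<close>
    have J_small: "\<bar>J a\<bar> \<le> R\<^sup>2 * v * a" if a: "0 < a" "a \<le> 1" "a < R" for a
    proof -
      have ga: "g a \<ge> 0" by (simp add: g_def)
      have "\<bar>J a\<bar> \<le> (LBINT x. indicator (ball (0::'a) a) x * R\<^sup>2)"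
        unfolding J_def \<Psi>_def real_norm_def[symmetric]
      proof (rule Bochner_Integration.integral_norm_bound_integral[OF int[OF ga] int_ball])
        show "norm (max 0 (g (norm x) - g a) * cos (\<xi> \<bullet> x)) \<le> indicator (ball 0 a) x * R\<^sup>2" for x :: 'a
        proof (cases "norm x < a")
          case True
          have "g (norm x) \<le> R\<^sup>2" unfolding g_def using \<alpha> R by (intro profile_le) auto
          then have "\<bar>max 0 (g (norm x) - g a)\<bar> * \<bar>cos (\<xi> \<bullet> x)\<bar> \<le> R\<^sup>2 * 1"
            using ga by (intro mult_mono) auto
          then show ?thesis using True by (simp add: abs_mult)
        next
          case False
          then have "g (norm x) \<le> g a"
            unfolding g_def using \<alpha> a by (intro profile_antimono) auto
          then show ?thesis by simp
        qed
      qed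
      also have "\<dots> = R\<^sup>2 * v * a ^ DIM('a)" using a by (simp add: vol)
      also have "\<dots> \<le> R\<^sup>2 * v * a ^ 1"
        using a v0 by (intro mult_left_mono power_decreasing) (auto simp: Suc_leI)
      finally show ?thesis by simp
    qed
    have \<Psi>_near0: "\<bar>\<Psi> 0 - \<Psi> c\<bar> \<le> c * (v * R ^ DIM('a))" if c: "c \<ge> 0" for c
    proof -
      have "\<bar>\<Psi> 0 - \<Psi> c\<bar> = norm (LBINT x. (max 0 (g (norm x) - 0) * cos (\<xi> \<bullet> x) - max 0 (g (norm x) - c) * cos (\<xi> \<bullet> x)))"
        unfolding \<Psi>_def using int[of 0] int[OF c] by simp
      also have "\<dots> \<le> (LBINT x. indicator (ball (0::'a) R) x * c)"
      proof (rule Bochner_Integration.integral_norm_bound_integral[OF _ int_ball])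
        show "integrable lborel (\<lambda>x::'a. max 0 (g (norm x) - 0) * cos (\<xi> \<bullet> x) - max 0 (g (norm x) - c) * cos (\<xi> \<bullet> x))"
          by (intro Bochner_Integration.integrable_diff int c) auto
        show "norm (max 0 (g (norm x) - 0) * cos (\<xi> \<bullet> x) - max 0 (g (norm x) - c) * cos (\<xi> \<bullet> x))
          \<le> indicator (ball 0 R) x * c" for x :: 'a
        proof (cases "norm x < R")
          case True
          have "\<bar>max 0 (g (norm x) - 0) - max 0 (g (norm x) - c)\<bar> * \<bar>cos (\<xi> \<bullet> x)\<bar> \<le> c * 1"
            using c by (intro mult_mono) auto
          then show ?thesis using True by (simp add: left_diff_distrib[symmetric] abs_mult)
        next
          case False
          then have "g (norm x) = 0" using \<alpha> R by (simp add: g_def profile_eq_0)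
          then show ?thesis using c False by simp
        qed
      qed
      also have "\<dots> = c * (v * R ^ DIM('a))" using R by (simp add: vol)
      finally show ?thesis .
    qed
    define \<rho> where "\<rho> = R - 1 / w"
    have \<rho>: "R / 2 \<le> \<rho>" "\<rho> < R" "0 < \<rho>" "R - \<rho> = 1 / w"
      using wR w R unfolding \<rho>_def w_def[symmetric] by (auto simp: field_simps)
    \<comment> \<open>Integration by parts: \<open>2 * s * riesz_ft 0\<close> is the derivative of
      \<open>riesz_ft 1\<close>, so subtracting \<open>W * riesz_ft 1 / 2\<close> leaves only
      \<open>W'\<close> in the derivative. Monotonicity of \<open>W\<close> makes the terms
      \<open>m / 2 * W a\<close> cancel, and the inner endpoint enters only through
      \<open>J a\<close>.\<close>
    have far: "\<bar>J \<rho>\<bar> \<le> R\<^sup>2 * v * a + W \<rho> * m" if a: "0 < a" "a \<le> 1" "a < \<rho>" for a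
    proof -
      define L where "L = (\<lambda>s. J s - W s * riesz_ft 1 \<xi> s / 2)"
      have "\<bar>L \<rho> - L a\<bar> \<le> m / 2 * W \<rho> - m / 2 * W a"
      proof (rule abs_diff_le_of_derivative_le[where f' = "\<lambda>s. - (W' s * riesz_ft 1 \<xi> s / 2)" and k' = "\<lambda>s. m / 2 * W' s"])
        fix s assume "a \<le> s" "s \<le> \<rho>"
        then have s: "0 < s" "s < R" using a \<rho> by auto
        have d1: "(riesz_ft 1 \<xi> has_real_derivative 2 * s * riesz_ft 0 \<xi> s) (at s)"
          using has_real_derivative_riesz_ft[OF s(1), of 0 \<xi>] by simp
        have "(L has_real_derivative (W s * s * riesz_ft 0 \<xi> s -
            (W' s * riesz_ft 1 \<xi> s + (2 * s * riesz_ft 0 \<xi> s) * W s) / 2)) (at s)"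
          unfolding L_def
          by (rule DERIV_diff[OF dJ[OF s] DERIV_cdivide[OF DERIV_mult[OF dW[OF s] d1]]])
        then show "(L has_real_derivative - (W' s * riesz_ft 1 \<xi> s / 2)) (at s)"
          by (simp add: field_simps)
        show "((\<lambda>s. m / 2 * W s) has_real_derivative m / 2 * W' s) (at s)"
          by (rule DERIV_cmult[OF dW[OF s]])
        show "\<bar>- (W' s * riesz_ft 1 \<xi> s / 2)\<bar> \<le> m / 2 * W' s"
          using mult_left_mono[OF mbd[of s] W'0[OF s]] s W'0[OF s] by (simp add: abs_mult mult.commute)
      qed (use a in simp)
      moreover have "\<bar>W s * riesz_ft 1 \<xi> s / 2\<bar> \<le> m / 2 * W s" if "0 < s" "s \<le> R" for s
        using mult_left_mono[OF mbd[of s] W0[of s]] that W0[of s] by (simp add: abs_mult mult.commute)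
      from this[of a] this[of \<rho>]
      have "\<bar>W a * riesz_ft 1 \<xi> a / 2\<bar> \<le> m / 2 * W a" "\<bar>W \<rho> * riesz_ft 1 \<xi> \<rho> / 2\<bar> \<le> m / 2 * W \<rho>"
        using a \<rho> by auto
      moreover have "\<bar>J a\<bar> \<le> R\<^sup>2 * v * a" using a \<rho> by (intro J_small) auto
      ultimately show ?thesis unfolding L_def by (simp add: mult.commute)
    qed
    have far': "\<bar>J \<rho>\<bar> \<le> W \<rho> * m"
    proof (rule tendsto_lowerbound)
      show "((\<lambda>a. R\<^sup>2 * v * a + W \<rho> * m) \<longlongrightarrow> W \<rho> * m) (at_right 0)"
        by (auto intro!: tendsto_eq_intros)
      show "eventually (\<lambda>a. \<bar>J \<rho>\<bar> \<le> R\<^sup>2 * v * a + W \<rho> * m) (at_right 0)"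
        unfolding eventually_at_right_field
        by (rule exI[of _ "min 1 \<rho>"]) (use far \<rho> in auto)
    qed simp
    \<comment> \<open>In the outer shell \<open>riesz_ft 0\<close> is replaced by its bound
      \<open>M\<close>, and \<open>W s * s\<close> integrates back to the profile. Only the drop of
      \<open>g\<close> is paid for, so the singularity that \<open>W\<close> may have at
      \<open>R\<close> does no harm.\<close>
    have near: "\<bar>\<Psi> 0\<bar> \<le> g b * (v * R ^ DIM('a)) + (M * g \<rho> + W \<rho> * m)" if b: "\<rho> < b" "b < R" for b
    proof -
      have "\<bar>J b - J \<rho>\<bar> \<le> - M * g b - (- M * g \<rho>)"
      proof (rule abs_diff_le_of_derivative_le[where f' = "\<lambda>s. W s * s * riesz_ft 0 \<xi> s" and k' = "\<lambda>s. - M * - (W s * s)"])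
        fix s assume "\<rho> \<le> s" "s \<le> b"
        then have s: "0 < s" "s < R" using b \<rho> by auto
        show "(J has_real_derivative W s * s * riesz_ft 0 \<xi> s) (at s)" by (rule dJ[OF s])
        show "((\<lambda>s. - M * g s) has_real_derivative - M * - (W s * s)) (at s)"
          by (rule DERIV_cmult[OF dg[OF s]])
        show "\<bar>W s * s * riesz_ft 0 \<xi> s\<bar> \<le> - M * - (W s * s)"
          using mult_left_mono[OF Mbd[of s], of "W s * s"] s W0[of s] by (simp add: abs_mult mult_ac)
      qed (use b in simp)
      moreover have "0 \<le> M * g b" using m0 by (simp add: g_def)
      moreover have "\<bar>\<Psi> 0 - J b\<bar> \<le> g b * (v * R ^ DIM('a))"
        unfolding J_def by (rule \<Psi>_near0) (simp add: g_def)
      ultimately show ?thesis using far' by linarith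
    qed
    have near': "\<bar>\<Psi> 0\<bar> \<le> M * g \<rho> + W \<rho> * m"
    proof (rule tendsto_lowerbound)
      have "((\<lambda>b. (max 0 (R powr \<alpha> - b powr \<alpha>)) powr \<beta>) \<longlongrightarrow> 0) (at_left R)"
      proof (rule tendsto_zero_powrI[where b = \<beta>])
        show "((\<lambda>b. max 0 (R powr \<alpha> - b powr \<alpha>)) \<longlongrightarrow> 0) (at_left R)"
          using R \<alpha> by (auto intro!: tendsto_eq_intros)
      qed (use \<beta> in auto)
      then have "(g \<longlongrightarrow> 0) (at_left R)"
        by (simp add: g_def profile_def[abs_def] \<beta>_def)
      from tendsto_add[OF tendsto_mult_right[OF this] tendsto_const]
      show "((\<lambda>b. g b * (v * R ^ DIM('a)) + (M * g \<rho> + W \<rho> * m)) \<longlongrightarrow> M * g \<rho> + W \<rho> * m) (at_left R)"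
        by simp
      show "eventually (\<lambda>b. \<bar>\<Psi> 0\<bar> \<le> g b * (v * R ^ DIM('a)) + (M * g \<rho> + W \<rho> * m)) (at_left R)"
        unfolding eventually_at_left_field
        by (rule exI[of _ \<rho>]) (use near \<rho> in auto)
    qed simp
    have gb: "g \<rho> \<le> \<alpha> powr \<beta> * R powr (2 - \<beta>) * w powr (- \<beta>)"
    proof -
      have "g \<rho> = (R powr \<alpha> - \<rho> powr \<alpha>) powr \<beta>"
        using pos[OF \<rho>(3,2)] by (simp add: g_def profile_def \<beta>_def max_def)
      also have "\<dots> \<le> (\<alpha> * R powr (\<alpha> - 1) * (1 / w)) powr \<beta>"
        using powr_diff_bounds(2)[of \<alpha> \<rho> R] \<rho> \<alpha> \<beta> pos[OF \<rho>(3,2)] by (intro powr_mono2) auto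
      also have "\<dots> = \<alpha> powr \<beta> * R powr ((\<alpha> - 1) * \<beta>) * w powr (- \<beta>)"
        using \<alpha> w by (simp add: powr_mult powr_divide powr_powr powr_minus_divide)
      also have "(\<alpha> - 1) * \<beta> = 2 - \<beta>" using \<alpha>\<beta> by (simp add: left_diff_distrib)
      finally show ?thesis .
    qed
    \<comment> \<open>As \<open>\<beta> - 1\<close> is not positive, an upper bound for
      \<open>W\<close> comes from the lower bound for
      \<open>R powr \<alpha> - \<rho> powr \<alpha>\<close>.\<close>
    have Wb: "W \<rho> \<le> 2 * R powr (1 - \<beta>) * w powr (1 - \<beta>)"
    proof -
      have "(R powr \<alpha> - \<rho> powr \<alpha>) powr (\<beta> - 1) \<le> (R powr (\<alpha> - 1) * (1 / w)) powr (\<beta> - 1)"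
        using powr_diff_bounds(1)[of \<alpha> \<rho> R] \<rho> \<alpha> \<beta> R w by (intro powr_mono2') auto
      also have "\<dots> = R powr ((\<alpha> - 1) * (\<beta> - 1)) * w powr (- (\<beta> - 1))"
      proof -
        have "(1 / w) powr e = w powr (- e)" for e
          using w by (simp add: powr_divide powr_minus_divide)
        then show ?thesis using w by (simp only: powr_mult powr_powr)
      qed
      finally have "W \<rho> \<le> 2 * (R powr (\<alpha> - 2) * (R powr ((\<alpha> - 1) * (\<beta> - 1)) * w powr (- (\<beta> - 1))))"
        unfolding W_def using \<rho> \<alpha> by (intro mult_left_mono mult_mono powr_mono2) auto
      also have "\<dots> = 2 * R powr (\<alpha> - 2 + (\<alpha> - 1) * (\<beta> - 1)) * w powr (- (\<beta> - 1))"
        by (simp add: powr_add)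
      also have "\<alpha> - 2 + (\<alpha> - 1) * (\<beta> - 1) = 1 - \<beta>"
        using \<alpha>\<beta> by (simp add: algebra_simps)
      finally show ?thesis by simp
    qed
    have "M * g \<rho> \<le> M * (\<alpha> powr \<beta> * R powr (2 - \<beta>) * w powr (- \<beta>))"
      using gb m0 by (intro mult_left_mono)
    also have "\<dots> = C * \<alpha> powr \<beta> * R powr ((n - 1) / 2 + (2 - \<beta>)) * w powr (- (n + 1) / 2 + - \<beta>)"
      unfolding M_def powr_add by (simp add: mult_ac)
    also have "(n - 1) / 2 + (2 - \<beta>) = (n + 3) / 2 - \<beta>" by (simp add: field_simps)
    also have "- (n + 1) / 2 + - \<beta> = - (n + 1) / 2 - \<beta>" by simp
    finally have I: "M * g \<rho> \<le> C * \<alpha> powr \<beta> * R powr ((n + 3) / 2 - \<beta>) * w powr (- (n + 1) / 2 - \<beta>)" .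
    have "W \<rho> * m \<le> (2 * R powr (1 - \<beta>) * w powr (1 - \<beta>)) * m"
      using Wb m0 by (intro mult_right_mono)
    also have "\<dots> = C * 2 * R powr ((n + 1) / 2 + (1 - \<beta>)) * w powr (- (n + 3) / 2 + (1 - \<beta>))"
      unfolding m_def powr_add by (simp add: mult_ac)
    also have "(n + 1) / 2 + (1 - \<beta>) = (n + 3) / 2 - \<beta>" by (simp add: field_simps)
    also have "- (n + 3) / 2 + (1 - \<beta>) = - (n + 1) / 2 - \<beta>" by (simp add: field_simps)
    finally have II: "W \<rho> * m \<le> C * 2 * R powr ((n + 3) / 2 - \<beta>) * w powr (- (n + 1) / 2 - \<beta>)" .
    have "\<Psi> 0 = (LBINT x. profile \<alpha> R (norm x) * cos (\<xi> \<bullet> x))"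
      by (simp add: \<Psi>_def g_def max_def)
    with near' I II show ?thesis by (simp add: w_def algebra_simps)
  qed
  then show ?thesis
    using C by (intro that[of "C * (2 + \<alpha> powr \<beta>)"]) (auto simp: n_def \<beta>_def add_pos_nonneg)
qed

section \<open>Integer points and the unit cube\<close>

definition zlat :: "'a::euclidean_space set" where
  "zlat = {z. \<forall>b\<in>Basis. z \<bullet> b \<in> \<int>}"

text \<open>Boxes in the infinity norm have an exact number of lattice points, and differences of
  their points lie again in such a box.\<close>

definition zbox :: "nat \<Rightarrow> 'a::euclidean_space set" where
  "zbox m = {z \<in> zlat. infnorm z \<le> real m}"

text \<open>Half-open, so that the integer translates tile the space without overlap; centred, so
  that moments of the kernel are taken about 0.\<close>

definition ucube :: "'a::euclidean_space set" where
  "ucube = {y. \<forall>b\<in>Basis. - 1 / 2 \<le> y \<bullet> b \<and> y \<bullet> b < 1 / 2}"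

definition zround :: "'a::euclidean_space \<Rightarrow> 'a" where
  "zround x = (\<Sum>b\<in>Basis. of_int \<lfloor>x \<bullet> b + 1 / 2\<rfloor> *\<^sub>R b)"

lemma infnorm_le_iff: "infnorm (x :: 'a::euclidean_space) \<le> c \<longleftrightarrow> (\<forall>b\<in>Basis. \<bar>x \<bullet> b\<bar> \<le> c)"
  unfolding infnorm_Max by (subst Max_le_iff) auto

lemma zlat_0 [simp]: "0 \<in> zlat"
  by (simp add: zlat_def)

lemma zlat_add: "x \<in> zlat \<Longrightarrow> y \<in> zlat \<Longrightarrow> x + y \<in> zlat"
  by (auto simp: zlat_def inner_add_left)

lemma zlat_diff: "x \<in> zlat \<Longrightarrow> y \<in> zlat \<Longrightarrow> x - y \<in> zlat"
  by (auto simp: zlat_def inner_diff_left)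

lemma zlat_uminus: "x \<in> zlat \<Longrightarrow> - x \<in> zlat"
  by (auto simp: zlat_def)

lemma zlat_Basis: "b \<in> Basis \<Longrightarrow> b \<in> zlat"
  by (auto simp: zlat_def inner_Basis)

lemma zlat_inner_Ints: "x \<in> zlat \<Longrightarrow> y \<in> zlat \<Longrightarrow> x \<bullet> y \<in> \<int>"
  unfolding euclidean_inner[of x y] by (auto simp: zlat_def intro!: Ints_sum Ints_mult)

lemma card_zbox: "card (zbox m :: 'a::euclidean_space set) = (2 * m + 1) ^ DIM('a)"
  and finite_zbox: "finite (zbox m :: 'a::euclidean_space set)"
proof -
  let ?P = "PiE (Basis :: 'a set) (\<lambda>_. {- int m..int m})"
  let ?f = "\<lambda>f. \<Sum>b\<in>(Basis :: 'a set). of_int (f b) *\<^sub>R b"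
  have bij: "bij_betw ?f ?P (zbox m)"
  proof (rule bij_betw_byWitness[where f' = "\<lambda>z. restrict (\<lambda>b. \<lfloor>z \<bullet> b\<rfloor>) Basis"])
    show "\<forall>f\<in>?P. restrict (\<lambda>b. \<lfloor>?f f \<bullet> b\<rfloor>) Basis = f"
      by (auto simp: fun_eq_iff PiE_def extensional_def)
    show "\<forall>z\<in>zbox m. ?f (restrict (\<lambda>b. \<lfloor>z \<bullet> b\<rfloor>) Basis) = z"
    proof
      fix z :: 'a assume z: "z \<in> zbox m"
      have "?f (restrict (\<lambda>b. \<lfloor>z \<bullet> b\<rfloor>) Basis) = (\<Sum>b\<in>Basis. (z \<bullet> b) *\<^sub>R b)"
        using z by (intro sum.cong) (auto simp: zbox_def zlat_def elim!: Ints_cases)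
      then show "?f (restrict (\<lambda>b. \<lfloor>z \<bullet> b\<rfloor>) Basis) = z" by (simp add: euclidean_representation)
    qed
    show "?f ` ?P \<subseteq> zbox m"
    proof
      fix z assume "z \<in> ?f ` ?P"
      then obtain f where f: "f \<in> ?P" "z = ?f f" by blast
      have "z \<bullet> b = of_int (f b)" if "b \<in> Basis" for b using that by (simp add: f(2))
      moreover have "\<bar>real_of_int (f b)\<bar> \<le> real m" if "b \<in> Basis" for b
      proof -
        have "f b \<in> {- int m..int m}" using f(1) that by (auto simp: PiE_def)
        then have "\<bar>f b\<bar> \<le> int m" by auto
        then show ?thesis by linarith
      qed
      ultimately show "z \<in> zbox m" by (auto simp: zbox_def zlat_def infnorm_le_iff)
    qed
    show "(\<lambda>z. restrict (\<lambda>b. \<lfloor>z \<bullet> b\<rfloor>) Basis) ` zbox m \<subseteq> ?P"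
    proof (intro image_subsetI, unfold restrict_PiE_iff, intro ballI)
      fix z b :: 'a assume z: "z \<in> zbox m" and b: "b \<in> Basis"
      then have "\<bar>z \<bullet> b\<bar> \<le> real m" by (auto simp: zbox_def infnorm_le_iff)
      then show "\<lfloor>z \<bullet> b\<rfloor> \<in> {- int m..int m}" by (auto simp: le_floor_iff floor_le_iff)
    qed
  qed
  have "card {- int m..int m} = 2 * m + 1" by simp
  then have "card ?P = (2 * m + 1) ^ DIM('a)"
    by (simp only: card_PiE[OF finite_Basis] prod_constant)
  then show "card (zbox m :: 'a set) = (2 * m + 1) ^ DIM('a)"
    using bij_betw_same_card[OF bij] by simp
  have "finite ?P" by (intro finite_PiE) auto
  then show "finite (zbox m :: 'a set)"
    using bij_betw_finite[OF bij] by simp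
qed

lemma ucube_infnorm: "y \<in> ucube \<Longrightarrow> infnorm y \<le> 1 / 2"
  unfolding infnorm_le_iff ucube_def by (auto simp: abs_le_iff intro: less_imp_le)

lemma zround_inner: "b \<in> Basis \<Longrightarrow> zround x \<bullet> b = of_int \<lfloor>x \<bullet> b + 1 / 2\<rfloor>"
  by (simp add: zround_def)

lemma zround_zlat [simp]: "zround x \<in> zlat"
  by (simp add: zlat_def zround_inner)

lemma ucube_iff_zround:
  assumes "z \<in> zlat"
  shows "x - z \<in> ucube \<longleftrightarrow> z = zround x"
proof
  assume u: "x - z \<in> ucube"
  show "z = zround x"
  proof (rule euclidean_eqI)
    fix b :: 'a assume b: "b \<in> Basis"
    then obtain k where k: "z \<bullet> b = of_int k" using assms by (auto simp: zlat_def elim: Ints_cases)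
    have "- 1 / 2 \<le> x \<bullet> b - of_int k" "x \<bullet> b - of_int k < 1 / 2"
      using u b by (auto simp: ucube_def inner_diff_left k)
    then have "\<lfloor>x \<bullet> b + 1 / 2\<rfloor> = k" by (intro floor_unique) auto
    then show "z \<bullet> b = zround x \<bullet> b" by (simp add: k zround_inner b)
  qed
next
  assume "z = zround x"
  then show "x - z \<in> ucube"
    unfolding ucube_def by (auto simp: inner_diff_left zround_inner) linarith+
qed

lemma infnorm_zround: "infnorm (zround x) \<le> infnorm x + 1 / 2"
proof -
  have "infnorm (x - zround x) \<le> 1 / 2"
    by (rule ucube_infnorm) (simp add: ucube_iff_zround)
  moreover have "infnorm (zround x) \<le> infnorm (zround x - x) + infnorm x"
    using infnorm_triangle[of "zround x - x" x] by simp
  ultimately show ?thesis by (simp add: infnorm_sub)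
qed

lemma ucube_sets [measurable]: "ucube \<in> sets borel"
proof -
  have "ucube = (\<Inter>b\<in>Basis. {y::'a. - 1 / 2 \<le> y \<bullet> b} \<inter> {y. y \<bullet> b < 1 / 2})"
    by (auto simp: ucube_def)
  also have "\<dots> \<in> sets borel"
    by (intro sets.finite_INT borel_closed borel_open sets.Int closed_Collect_le open_Collect_less
        continuous_intros) auto
  finally show ?thesis .
qed

lemma emeasure_ucube: "emeasure lborel (ucube :: 'a::euclidean_space set) = 1"
proof -
  define h where "h = (1 / 2) *\<^sub>R (One :: 'a)"
  have h: "h \<bullet> b = 1 / 2" if "b \<in> Basis" for b using that by (simp add: h_def)
  have "emeasure lborel (box (- h) h) = 1" "emeasure lborel (cbox (- h) h) = 1"
    by (simp_all add: emeasure_lborel_box_eq emeasure_lborel_cbox_eq h inner_add_left)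
  moreover have "box (- h) h \<subseteq> ucube" "ucube \<subseteq> cbox (- h) h"
    by (auto simp: ucube_def mem_box h less_imp_le)
  then have "emeasure lborel (box (- h) h) \<le> emeasure lborel (ucube :: 'a set)"
    "emeasure lborel (ucube :: 'a set) \<le> emeasure lborel (cbox (- h) h)"
    by (auto intro!: emeasure_mono)
  ultimately show ?thesis by simp
qed

text \<open>Exactly one lattice translate of the cube covers \<open>x\<close>, the one at
  \<open>zround x\<close>. Rounding raises the infinity norm by at most 1/2, which is why radius
  \<open>m + 1\<close> is enough.\<close>

lemma sum_indicator_ucube:
  fixes x :: "'a::euclidean_space"
  assumes "infnorm x \<le> real m"
  shows "(\<Sum>z\<in>zbox (m + 1). indicator ucube (x - z)) = (1::real)"
proof -
  have r: "zround x \<in> zbox (m + 1)"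
    using infnorm_zround[of x] assms by (simp add: zbox_def)
  have "(\<Sum>z\<in>zbox (m + 1). indicator ucube (x - z)) = (\<Sum>z\<in>zbox (m + 1). if z = zround x then 1 else (0::real))"
    by (intro sum.cong refl) (auto simp: zbox_def indicator_def ucube_iff_zround)
  then show ?thesis using r by (simp add: finite_zbox)
qed

text \<open>The function is cut up by the partition of unity into cubes and each piece is translated
  back to the central cube. The bounded support keeps this periodization a finite sum.\<close>

lemma integral_tiling:
  fixes f :: "'a::euclidean_space \<Rightarrow> real"
  assumes f: "integrable lborel f" and supp: "\<And>x. infnorm x > real m \<Longrightarrow> f x = 0"
  shows "(LBINT x. f x) = (LBINT y. indicator ucube y * (\<Sum>z\<in>zbox (m + 1). f (z + y)))"
    and "integrable lborel (\<lambda>y. indicator ucube y * (\<Sum>z\<in>zbox (m + 1). f (z + y)))"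
proof -
  have meas: "f \<in> borel_measurable borel" using f by auto
  have i: "integrable lborel (\<lambda>x. indicator ucube (x - z) * f x)" for z
  proof -
    have "integrable lborel (\<lambda>x. f x * indicator {x. x - z \<in> ucube} x)"
    proof (rule integrable_real_mult_indicator[OF _ f])
      have "(\<lambda>x. x - z) -` ucube \<inter> space borel \<in> sets borel"
        by (rule measurable_sets[of _ borel borel]) auto
      then show "{x. x - z \<in> ucube} \<in> sets lborel" by (simp add: vimage_def)
    qed
    then show ?thesis by (simp add: indicator_def mult.commute)
  qed
  have i': "integrable lborel (\<lambda>y. indicator ucube y * f (z + y))" for z
    using integrable_shift[OF i[of z], of z] by simp
  have "(LBINT x. f x) = (LBINT x. (\<Sum>z\<in>zbox (m + 1). indicator ucube (x - z) * f x))"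
  proof (rule Bochner_Integration.integral_cong)
    show "f x = (\<Sum>z\<in>zbox (m + 1). indicator ucube (x - z) * f x)" for x
      using sum_indicator_ucube[of x m] supp[of x]
      by (cases "infnorm x \<le> real m") (auto simp: sum_distrib_right[symmetric])
  qed simp
  also have "\<dots> = (\<Sum>z\<in>zbox (m + 1). LBINT x. indicator ucube (x - z) * f x)"
    by (rule Bochner_Integration.integral_sum) (rule i)
  also have "\<dots> = (\<Sum>z\<in>zbox (m + 1). LBINT y. indicator ucube y * f (z + y))"
  proof (rule sum.cong[OF refl])
    fix z :: 'a
    show "(LBINT x. indicator ucube (x - z) * f x) = (LBINT y. indicator ucube y * f (z + y))"
      using lborel_integral_shift[of "\<lambda>x. indicator ucube (x - z) * f x" z] i[of z] by (auto dest: borel_measurable_integrable)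
  qed
  also have "\<dots> = (LBINT y. (\<Sum>z\<in>zbox (m + 1). indicator ucube y * f (z + y)))"
    by (rule Bochner_Integration.integral_sum[symmetric]) (rule i')
  finally show "(LBINT x. f x) = (LBINT y. indicator ucube y * (\<Sum>z\<in>zbox (m + 1). f (z + y)))"
    by (simp add: sum_distrib_left)
  show "integrable lborel (\<lambda>y. indicator ucube y * (\<Sum>z\<in>zbox (m + 1). f (z + y)))"
    unfolding sum_distrib_left by (rule Bochner_Integration.integrable_sum) (rule i')
qed

lemma integrable_ucube:
  fixes f :: "'a::euclidean_space \<Rightarrow> real"
  assumes "continuous_on UNIV f"
  shows "integrable lborel (\<lambda>y. indicator ucube y * f y)"
proof -
  have bdd: "bounded (f ` cbox (- One) One)"
    by (intro compact_imp_bounded compact_continuous_image continuous_on_subset[OF assms]) auto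
  then obtain B where B: "\<And>y. y \<in> cbox (- One) One \<Longrightarrow> \<bar>f y\<bar> \<le> B"
    unfolding bounded_iff by auto
  have sub: "ucube \<subseteq> cbox (- One) (One :: 'a)"
    unfolding ucube_def by (force simp: mem_box)
  have "emeasure lborel (ucube :: 'a set) < \<infinity>"
    by (simp add: emeasure_ucube)
  then show ?thesis
    by (intro integrableI_bounded_set[where A = ucube and B = B] borel_measurable_times
        borel_measurable_indicator borel_measurable_continuous_onI assms AE_I2)
       (use B sub in \<open>auto intro: borel_measurable_continuous_onI assms\<close>)
qed

section \<open>Orthogonality of the cosines on the unit cube\<close>

lemma cos_add_2pi_Ints: "k \<in> \<int> \<Longrightarrow> cos (2 * pi * k + x) = cos x"
  by (auto elim!: Ints_cases simp: cos_add)

text \<open>For nonzero \<open>k\<close>, a translation by \<open>v\<close> with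
  \<open>k \<bullet> v = 1 / 2\<close> changes the sign of the cosine, while the integral of a
  periodic function over the cube is unchanged by translation. So the integral equals its own
  negative.\<close>

lemma integral_ucube_cos:
  fixes k :: "'a::euclidean_space"
  assumes k: "k \<in> zlat"
  shows "(LBINT y. indicator ucube y * cos (2 * pi * (k \<bullet> y))) = (if k = 0 then 1 else 0)"
proof (cases "k = 0")
  case True
  then show ?thesis by (simp add: measure_def emeasure_ucube)
next
  case False
  define c where "c = (\<lambda>y. cos (2 * pi * (k \<bullet> y)))"
  obtain b where b: "b \<in> Basis" "k \<bullet> b \<noteq> 0"
    using False by (metis euclidean_all_zero_iff)
  define v where "v = (1 / (2 * (k \<bullet> b))) *\<^sub>R b"
  have kv: "k \<bullet> v = 1 / 2" using b by (simp add: v_def)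
  \<comment> \<open>A nonzero integer coordinate makes \<open>v\<close> no longer than 1/2, so the
    shifted cube stays within infinity norm 1 and the tiling applies with
    \<open>m = 1\<close>.\<close>
  have "\<bar>k \<bullet> b\<bar> \<ge> 1" using k b by (auto simp: zlat_def elim!: Ints_cases)
  then have v: "infnorm v \<le> 1 / 2"
    unfolding infnorm_le_iff using b by (auto simp: v_def inner_Basis abs_mult field_simps)
  have cv: "c (v + y) = - c y" for y
    by (simp add: c_def inner_add_right kv distrib_left cos_add)
  have cz: "c (z + y) = c y" if "z \<in> zlat" for z y
    using cos_add_2pi_Ints[OF zlat_inner_Ints[OF k that], of "2 * pi * (k \<bullet> y)"]
    by (simp add: c_def inner_add_right distrib_left)
  have cont: "continuous_on UNIV c" unfolding c_def by (intro continuous_intros)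
  have int: "integrable lborel (\<lambda>y. indicator ucube y * c y)" by (rule integrable_ucube[OF cont])
  have int': "integrable lborel (\<lambda>y. indicator ucube (v + y) * c y)"
    using integrable_shift[OF int, of v] by (simp add: cv)
  have supp: "indicator ucube (v + y) * c y = 0" if "infnorm y > real 1" for y
  proof -
    have "infnorm y \<le> infnorm (v + y) + infnorm v"
      using infnorm_triangle[of "v + y" "- v"] by (simp add: infnorm_neg)
    then have "v + y \<notin> ucube" using that v ucube_infnorm[of "v + y"] by auto
    then show ?thesis by simp
  qed
  have one: "(\<Sum>z\<in>zbox (1 + 1). indicator ucube (v + (z + y))) = (1::real)" if y: "y \<in> ucube" for y
  proof -
    have "(\<Sum>z\<in>zbox (1 + 1). indicator ucube (v + (z + y))) = (\<Sum>z\<in>zbox (1 + 1). indicator ucube ((v + y) - z) :: real)"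
      by (rule sum.reindex_bij_witness[of _ uminus uminus])
         (auto simp: zbox_def zlat_uminus infnorm_neg algebra_simps)
    also have "\<dots> = 1"
      using infnorm_triangle[of v y] v ucube_infnorm[OF y] by (intro sum_indicator_ucube) simp
    finally show ?thesis .
  qed
  have "(LBINT y. indicator ucube y * c y) = (LBINT y. indicator ucube (v + y) * c (v + y))"
    by (rule lborel_integral_shift[symmetric]) (use int in auto)
  also have "\<dots> = - (LBINT y. indicator ucube (v + y) * c y)"
    by (simp add: cv)
  also have "(LBINT y. indicator ucube (v + y) * c y)
     = (LBINT y. indicator ucube y * (\<Sum>z\<in>zbox (1 + 1). indicator ucube (v + (z + y)) * c (z + y)))"
    by (rule integral_tiling(1)[OF int' supp])
  also have "\<dots> = (LBINT y. indicator ucube y * c y)"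
  proof (rule Bochner_Integration.integral_cong[OF refl])
    fix y :: 'a
    have "(\<Sum>z\<in>zbox (1 + 1). indicator ucube (v + (z + y)) * c (z + y))
      = (\<Sum>z\<in>zbox (1 + 1). indicator ucube (v + (z + y))) * c y"
      unfolding sum_distrib_right by (rule sum.cong) (auto simp: zbox_def cz)
    then show "indicator ucube y * (\<Sum>z\<in>zbox (1 + 1). indicator ucube (v + (z + y)) * c (z + y)) = indicator ucube y * c y"
      using one[of y] by (cases "y \<in> ucube") auto
  qed
  finally show ?thesis using False by (simp add: c_def)
qed

section \<open>A nonnegative smoothing kernel\<close>

text \<open>Bounds the second moment of the kernel by its Fourier coefficients at the basis vectors.
  The Taylor bound gives \<open>sin x \<ge> 5 / 6 * x\<close> up to 1; beyond,
  \<open>sin x \<ge> sin 1 \<ge> 5 / 6\<close> and \<open>x \<le> pi / 2 < 2\<close> give slope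
  5/12. With \<open>pi \<ge> 2\<close> the sine of \<open>pi * |t|\<close> is at least
  \<open>5 / 6 * |t|\<close>, and \<open>2 * 25 / 36\<close> exceeds 1.\<close>

lemma square_le_one_minus_cos:
  fixes t :: real
  assumes "\<bar>t\<bar> \<le> 1 / 2"
  shows "t\<^sup>2 \<le> 1 - cos (2 * pi * t)"
proof -
  have small: "5 / 6 * x \<le> sin x" if "0 \<le> x" "x \<le> 1" for x :: real
  proof -
    have s: "(\<Sum>m<3. sin_coeff m * x ^ m) = x"
      by (simp add: numeral_3_eq_3 sin_coeff_def)
    have "fact 3 = (6 :: real)" by (simp add: numeral_3_eq_3)
    then have "\<bar>sin x - x\<bar> \<le> x ^ 3 / 6"
      using Maclaurin_sin_bound[of x 3] that unfolding s by (simp add: field_simps)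
    moreover have "x ^ 3 \<le> x" using power_decreasing[of 1 3 x] that by simp
    ultimately show ?thesis by argo
  qed
  have sin_ge: "5 / 12 * x \<le> sin x" if "0 \<le> x" "x \<le> pi / 2" for x :: real
  proof (cases "x \<le> 1")
    case True
    then show ?thesis using small[of x] that by linarith
  next
    case False
    have "sin 1 \<le> sin x" using False that by (intro sin_monotone_2pi_le) auto
    then show ?thesis using small[of 1] that pi_less_4 by linarith
  qed
  have "5 / 6 * \<bar>t\<bar> \<le> 5 / 12 * (pi * \<bar>t\<bar>)"
    using pi_ge_two by (simp add: mult_right_mono)
  also have "\<dots> \<le> sin (pi * \<bar>t\<bar>)"
    using assms by (intro sin_ge) auto
  finally have "(5 / 6 * \<bar>t\<bar>)\<^sup>2 \<le> (sin (pi * \<bar>t\<bar>))\<^sup>2"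
    by (intro power_mono) auto
  also have "\<dots> = (sin (pi * t))\<^sup>2" by (cases "t \<ge> 0") simp_all
  finally have "25 / 36 * t\<^sup>2 \<le> (sin (pi * t))\<^sup>2"
    by (simp add: power_mult_distrib power2_eq_square)
  moreover have "cos (2 * pi * t) = 1 - 2 * (sin (pi * t))\<^sup>2"
    using cos_double_sin[of "pi * t"] by (simp add: mult.assoc)
  ultimately show ?thesis using zero_le_power2[of t] by linarith
qed

text \<open>These are the coefficients of the polynomial whose squared modulus will be the kernel. A
  tent over a box varies by at most 1 per step while most of its values are of size
  \<open>M\<close>. After normalization a unit shift therefore changes it by \<open>O(1 / M)\<close>
  in mean square, and this is the autocorrelation defect.\<close>

lemma smoothing_weights:
  fixes M :: nat
  assumes M: "M \<ge> 1"
  obtains w :: "'a::euclidean_space \<Rightarrow> real" where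
    "\<And>j. w j \<ge> 0" "\<And>j. j \<in> zlat \<Longrightarrow> j \<notin> zbox (2 * M + 1) \<Longrightarrow> w j = 0"
    "(\<Sum>j\<in>zbox (2 * M + 1). (w j)\<^sup>2) = 1"
    "\<And>b. b \<in> Basis \<Longrightarrow> 1 - (\<Sum>j\<in>zbox (2 * M + 1). w j * w (j + b)) \<le> 3 ^ DIM('a) / (real M)\<^sup>2"
proof -
  define a where "a = (\<lambda>j::'a. max 0 (2 * real M - infnorm j))"
  \<comment> \<open>The tent vanishes from infinity norm \<open>2 * M\<close> on; the extra layer
    leaves room to shift its support by a basis vector within \<open>J\<close>.\<close>
  define J where "J = (zbox (2 * M + 1) :: 'a set)"
  define N where "N = (\<Sum>j\<in>J. (a j)\<^sup>2)"
  define w where "w = (\<lambda>j. a j / sqrt N)"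
  have fin: "finite J" by (simp add: J_def finite_zbox)
  \<comment> \<open>On the inner box of radius \<open>M\<close> the tent is at least
    \<open>M\<close>. The factor \<open>(2 * M + 1) ^ DIM('a)\<close> is later compared with the
    size of \<open>J\<close>, at the cost of \<open>3 ^ DIM('a)\<close>.\<close>
  have N_ge: "(real M)\<^sup>2 * real ((2 * M + 1) ^ DIM('a)) \<le> N"
  proof -
    have "(real M)\<^sup>2 * real ((2 * M + 1) ^ DIM('a)) = (\<Sum>j\<in>(zbox M :: 'a set). (real M)\<^sup>2)"
      by (simp add: card_zbox)
    also have "\<dots> \<le> (\<Sum>j\<in>zbox M. (a j)\<^sup>2)"
      by (intro sum_mono power_mono) (auto simp: zbox_def a_def)
    also have "\<dots> \<le> N"
      unfolding N_def by (intro sum_mono2 fin) (auto simp: J_def zbox_def)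
    finally show ?thesis .
  qed
  have N0: "N > 0"
  proof -
    have "(real M)\<^sup>2 * real ((2 * M + 1) ^ DIM('a)) > 0" using M by simp
    with N_ge show ?thesis by linarith
  qed
  have sum1: "(\<Sum>j\<in>J. (w j)\<^sup>2) = 1"
    using N0 by (simp add: w_def power_divide sum_divide_distrib[symmetric] N_def[symmetric])
  have supp: "w j = 0" if "infnorm j \<ge> 2 * real M" for j
    using that by (simp add: w_def a_def)
  have main: "1 - (\<Sum>j\<in>J. w j * w (j + b)) \<le> 3 ^ DIM('a) / (real M)\<^sup>2" if b: "b \<in> Basis" for b
  proof -
    have nb: "infnorm b \<le> 1" unfolding infnorm_le_iff using b by (auto simp: inner_Basis)
    have "(\<Sum>j\<in>J. (w (j + b))\<^sup>2) = (\<Sum>i\<in>(\<lambda>j. j + b) ` J. (w i)\<^sup>2)"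
      by (subst sum.reindex) (auto simp: inj_on_def)
    also have "\<dots> = (\<Sum>i\<in>J. (w i)\<^sup>2)"
    proof (rule sum.mono_neutral_cong)
      fix i assume i: "i \<in> J - (\<lambda>j. j + b) ` J"
      show "(w i)\<^sup>2 = 0"
      proof (rule ccontr)
        assume "(w i)\<^sup>2 \<noteq> 0"
        then have "infnorm i < 2 * real M" using supp[of i] by force
        moreover have "infnorm (i - b) \<le> infnorm i + infnorm b"
          using infnorm_triangle[of i "- b"] by (simp add: infnorm_neg)
        ultimately have "i - b \<in> J"
          using i zlat_diff[OF _ zlat_Basis[OF b]] nb by (auto simp: J_def zbox_def)
        then have "i \<in> (\<lambda>j. j + b) ` J" by (intro image_eqI[of _ _ "i - b"]) auto
        then show False using i by blast
      qed
    next
      fix i assume i: "i \<in> (\<lambda>j. j + b) ` J - J"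
      then have "i \<in> zlat" using zlat_add[OF _ zlat_Basis[OF b]] by (auto simp: J_def zbox_def)
      then show "(w i)\<^sup>2 = 0" using i supp[of i] by (auto simp: J_def zbox_def)
    qed (use fin in auto)
    also have "\<dots> = 1" by (rule sum1)
    finally have sum2: "(\<Sum>j\<in>J. (w (j + b))\<^sup>2) = 1" .
    \<comment> \<open>The weights and their shift both have square sum 1, so the defect is half the
      squared distance between them.\<close>
    have "2 * (1 - (\<Sum>j\<in>J. w j * w (j + b))) = (\<Sum>j\<in>J. (w j)\<^sup>2) + (\<Sum>j\<in>J. (w (j + b))\<^sup>2) - 2 * (\<Sum>j\<in>J. w j * w (j + b))"
      unfolding sum1 sum2 by simp
    also have "\<dots> = (\<Sum>j\<in>J. (w j - w (j + b))\<^sup>2)"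
      by (simp add: power2_diff sum.distrib sum_subtractf sum_distrib_left mult.assoc)
    also have "\<dots> \<le> (\<Sum>j\<in>J. 1 / N)"
    proof (rule sum_mono)
      fix j
      have "infnorm j \<le> infnorm (j + b) + infnorm b"
        using infnorm_triangle[of "j + b" "- b"] by (simp add: infnorm_neg)
      moreover have "infnorm (j + b) \<le> infnorm j + infnorm b" by (rule infnorm_triangle)
      ultimately have "\<bar>a j - a (j + b)\<bar> \<le> 1" using nb unfolding a_def by linarith
      then have "(a j - a (j + b))\<^sup>2 \<le> 1" by (simp add: abs_square_le_1)
      moreover have "(w j - w (j + b))\<^sup>2 = (a j - a (j + b))\<^sup>2 / N"
        using N0 by (simp add: w_def diff_divide_distrib[symmetric] power_divide)
      ultimately show "(w j - w (j + b))\<^sup>2 \<le> 1 / N"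
        using N0 by (simp add: divide_right_mono)
    qed
    also have "\<dots> = real ((4 * M + 3) ^ DIM('a)) / N"
      by (simp add: J_def card_zbox algebra_simps)
    also have "\<dots> \<le> real ((3 * (2 * M + 1)) ^ DIM('a)) / ((real M)\<^sup>2 * real ((2 * M + 1) ^ DIM('a)))"
    proof (rule frac_le)
      show "real ((4 * M + 3) ^ DIM('a)) \<le> real ((3 * (2 * M + 1)) ^ DIM('a))"
        unfolding of_nat_le_iff by (intro power_mono) auto
    qed (use M N_ge in auto)
    also have "\<dots> = 3 ^ DIM('a) / (real M)\<^sup>2"
    proof -
      have "real ((2 * M + 1) ^ DIM('a)) \<noteq> 0" by simp
      then show ?thesis unfolding power_mult_distrib of_nat_mult by simp
    qed
    finally have *: "2 * (1 - (\<Sum>j\<in>J. w j * w (j + b))) \<le> 3 ^ DIM('a) / (real M)\<^sup>2" .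
    have "x \<le> y" if "2 * x \<le> y" "0 \<le> y" for x y :: real using that by linarith
    from this[OF *] show ?thesis by simp
  qed
  show ?thesis
  proof (rule that[of w])
    show "w j \<ge> 0" for j using N0 by (simp add: w_def a_def)
    show "w j = 0" if "j \<in> zlat" "j \<notin> zbox (2 * M + 1)" for j
      using that supp[of j] by (auto simp: zbox_def)
  qed (use sum1 main in \<open>auto simp: J_def\<close>)
qed

text \<open>\<Phi> is the squared modulus of the sum of
  \<open>w j * exp (2 * pi * i * (j \<bullet> x))\<close>, hence nonnegative, and its Fourier
  coefficients are autocorrelations of \<open>w\<close>: at 0 the mass 1, at a basis vector almost
  1. The latter controls the mean of \<open>1 - cos\<close> and thereby the second moment. The last
  property is the finite substitute for Poisson summation.\<close>

lemma smoothing_kernel: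
  fixes M :: nat
  assumes M: "M \<ge> 1"
  obtains \<Phi> :: "'a::euclidean_space \<Rightarrow> real" where
    "continuous_on UNIV \<Phi>" "\<And>x. 0 \<le> \<Phi> x" "\<And>z x. z \<in> zlat \<Longrightarrow> \<Phi> (z + x) = \<Phi> x"
    "(LBINT y. indicator ucube y * \<Phi> y) = 1"
    "(LBINT y. indicator ucube y * (\<Phi> y * (norm y)\<^sup>2)) \<le> real DIM('a) * 3 ^ DIM('a) / (real M)\<^sup>2"
    "\<And>f. integrable lborel f \<Longrightarrow> \<bar>(LBINT x. f x * \<Phi> x) - (LBINT x. f x)\<bar>
       \<le> (\<Sum>k\<in>zbox (6 * M) - {0}. \<bar>LBINT x. f x * cos (2 * pi * (k \<bullet> x))\<bar>)"
proof -
  define J where "J = (zbox (2 * M + 1) :: 'a set)"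
  obtain w :: "'a \<Rightarrow> real" where w0: "\<And>j. w j \<ge> 0" and wsupp: "\<And>j. j \<in> zlat \<Longrightarrow> j \<notin> J \<Longrightarrow> w j = 0"
    and w1: "(\<Sum>j\<in>J. (w j)\<^sup>2) = 1"
    and wb: "\<And>b. b \<in> Basis \<Longrightarrow> 1 - (\<Sum>j\<in>J. w j * w (j + b)) \<le> 3 ^ DIM('a) / (real M)\<^sup>2"
    using smoothing_weights[OF M, where 'a = 'a] unfolding J_def by blast
  have fin: "finite J" by (simp add: J_def finite_zbox)
  have JZ: "J \<subseteq> zlat" by (auto simp: J_def zbox_def)
  define c where "c = (\<lambda>k x::'a. cos (2 * pi * (k \<bullet> x)))"
  define \<Phi> where "\<Phi> = (\<lambda>x. \<Sum>j\<in>J. \<Sum>l\<in>J. w j * w l * c (j - l) x)"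
  have cont_c: "continuous_on UNIV (c k)" for k unfolding c_def by (intro continuous_intros)
  have cont: "continuous_on UNIV \<Phi>" unfolding \<Phi>_def by (intro continuous_intros cont_c)
  have ic: "integrable lborel (\<lambda>y. indicator ucube y * c k y)" for k by (rule integrable_ucube[OF cont_c])
  have int_c: "(LBINT y. indicator ucube y * c k y) = (if k = 0 then 1 else 0)" if "k \<in> zlat" for k
    unfolding c_def by (rule integral_ucube_cos[OF that])
  have nonneg: "0 \<le> \<Phi> x" for x
  proof -
    have "\<Phi> x = (\<Sum>j\<in>J. w j * cos (2 * pi * (j \<bullet> x)))\<^sup>2 + (\<Sum>j\<in>J. w j * sin (2 * pi * (j \<bullet> x)))\<^sup>2"
      unfolding \<Phi>_def c_def power2_eq_square sum_product sum.distrib[symmetric]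
      by (intro sum.cong refl) (simp add: inner_diff_left right_diff_distrib cos_diff algebra_simps)
    then show ?thesis by simp
  qed
  have periodic: "\<Phi> (z + x) = \<Phi> x" if z: "z \<in> zlat" for z x
    unfolding \<Phi>_def c_def
  proof (intro sum.cong refl)
    fix j l assume "j \<in> J" "l \<in> J"
    then have "(j - l) \<bullet> z \<in> \<int>" using JZ z by (intro zlat_inner_Ints zlat_diff) auto
    from cos_add_2pi_Ints[OF this, of "2 * pi * ((j - l) \<bullet> x)"]
    show "w j * w l * cos (2 * pi * ((j - l) \<bullet> (z + x))) = w j * w l * cos (2 * pi * ((j - l) \<bullet> x))"
      by (simp add: inner_add_right distrib_left)
  qed
  have int_\<Phi>: "(LBINT y. indicator ucube y * (\<Phi> y * g y))
      = (\<Sum>j\<in>J. \<Sum>l\<in>J. w j * w l * (LBINT y. indicator ucube y * (c (j - l) y * g y)))"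
    if g: "continuous_on UNIV g" for g
  proof -
    have i: "integrable lborel (\<lambda>y. indicator ucube y * (c k y * g y))" for k
      by (intro integrable_ucube continuous_on_mult cont_c g)
    have "(LBINT y. indicator ucube y * (\<Phi> y * g y))
       = (LBINT y. (\<Sum>j\<in>J. \<Sum>l\<in>J. w j * w l * (indicator ucube y * (c (j - l) y * g y))))"
      unfolding \<Phi>_def by (simp add: sum_distrib_left sum_distrib_right mult_ac)
    also have "\<dots> = (\<Sum>j\<in>J. \<Sum>l\<in>J. w j * w l * (LBINT y. indicator ucube y * (c (j - l) y * g y)))"
      by (subst Bochner_Integration.integral_sum,
          (intro Bochner_Integration.integrable_sum integrable_mult_right i),
          intro sum.cong refl, subst Bochner_Integration.integral_sum,
          (intro integrable_mult_right i), simp)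
    finally show ?thesis .
  qed
  have one: "(LBINT y. indicator ucube y * \<Phi> y) = 1"
  proof -
    have "(LBINT y. indicator ucube y * \<Phi> y) = (LBINT y. indicator ucube y * (\<Phi> y * 1))" by simp
    also have "\<dots> = (\<Sum>j\<in>J. \<Sum>l\<in>J. w j * w l * (if j = l then 1 else 0))"
    proof (subst int_\<Phi>[OF continuous_on_const], intro sum.cong refl)
      fix j l assume "j \<in> J" "l \<in> J"
      then have "j - l \<in> zlat" using JZ zlat_diff by blast
      then show "w j * w l * (LBINT y. indicator ucube y * (c (j - l) y * 1)) = w j * w l * (if j = l then 1 else 0)"
        by (simp add: int_c)
    qed
    also have "\<dots> = (\<Sum>j\<in>J. (w j)\<^sup>2)"
      using fin by (intro sum.cong refl) (simp add: power2_eq_square if_distrib cong: if_cong)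
    finally show ?thesis using w1 by simp
  qed
  have cos_moment: "(LBINT y. indicator ucube y * (\<Phi> y * c b y)) = (\<Sum>j\<in>J. w j * w (j + b))"
    if b: "b \<in> Basis" for b
  proof -
    \<comment> \<open>The product of two cosines is half the sum of those at \<open>k + b\<close>
      and \<open>k - b\<close>, so by orthogonality only \<open>k = - b\<close> and
      \<open>k = b\<close> survive.\<close>
    have prod: "(LBINT y. indicator ucube y * (c k y * c b y))
        = ((if k + b = 0 then 1 else 0) + (if k - b = 0 then 1 else 0)) / 2" if k: "k \<in> zlat" for k
    proof -
      have "(LBINT y. indicator ucube y * (c k y * c b y))
        = (LBINT y. (indicator ucube y * c (k + b) y + indicator ucube y * c (k - b) y) / 2)"
        unfolding c_def
        by (intro Bochner_Integration.integral_cong refl)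
           (simp add: inner_add_left inner_diff_left distrib_left right_diff_distrib cos_add cos_diff field_simps)
      also have "\<dots> = ((LBINT y. indicator ucube y * c (k + b) y) + (LBINT y. indicator ucube y * c (k - b) y)) / 2"
        using ic by simp
      also have "\<dots> = ((if k + b = 0 then 1 else 0) + (if k - b = 0 then 1 else 0)) / 2"
        using k zlat_Basis[OF b] by (simp only: int_c zlat_add zlat_diff)
      finally show ?thesis .
    qed
    have wl: "(\<Sum>l\<in>J. w l * (if l = j + b then 1 else 0)) = w (j + b)" if "j \<in> J" for j
    proof (cases "j + b \<in> J")
      case True
      then show ?thesis using fin by (simp add: if_distrib cong: if_cong)
    next
      case False
      have "j + b \<in> zlat" using that JZ zlat_add[OF _ zlat_Basis[OF b]] by blast
      then have "w (j + b) = 0" using wsupp False by blast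
      moreover have "(\<Sum>l\<in>J. w l * (if l = j + b then 1 else 0)) = 0"
        using False by (intro sum.neutral) auto
      ultimately show ?thesis by simp
    qed
    have "(LBINT y. indicator ucube y * (\<Phi> y * c b y))
      = (\<Sum>j\<in>J. \<Sum>l\<in>J. w j * w l * (((if l = j + b then 1 else 0) + (if j = l + b then 1 else 0)) / 2))"
    proof (subst int_\<Phi>[OF cont_c], intro sum.cong refl)
      fix j l assume "j \<in> J" "l \<in> J"
      then have "j - l \<in> zlat" using JZ zlat_diff by blast
      moreover have "j - l + b = 0 \<longleftrightarrow> l = j + b" "j - l - b = 0 \<longleftrightarrow> j = l + b"
        by (auto simp: algebra_simps)
      ultimately show "w j * w l * (LBINT y. indicator ucube y * (c (j - l) y * c b y))
        = w j * w l * (((if l = j + b then 1 else 0) + (if j = l + b then 1 else 0)) / 2)"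
        by (simp only: prod)
    qed
    also have "\<dots> = ((\<Sum>j\<in>J. \<Sum>l\<in>J. w j * w l * (if l = j + b then 1 else 0))
       + (\<Sum>j\<in>J. \<Sum>l\<in>J. w j * w l * (if j = l + b then 1 else 0))) / 2"
      unfolding sum.distrib[symmetric] sum_divide_distrib by (intro sum.cong refl) (simp add: algebra_simps add_divide_distrib)
    also have "(\<Sum>j\<in>J. \<Sum>l\<in>J. w j * w l * (if j = l + b then 1 else 0))
      = (\<Sum>j\<in>J. \<Sum>l\<in>J. w j * w l * (if l = j + b then 1 else 0))"
      by (subst sum.swap) (simp add: mult.commute)
    also have "(\<Sum>j\<in>J. \<Sum>l\<in>J. w j * w l * (if l = j + b then 1 else 0)) = (\<Sum>j\<in>J. w j * w (j + b))"
      by (intro sum.cong refl) (simp only: mult.assoc sum_distrib_left[symmetric] wl)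
    finally show ?thesis by simp
  qed
  have moment: "(LBINT y. indicator ucube y * (\<Phi> y * (norm y)\<^sup>2)) \<le> real DIM('a) * 3 ^ DIM('a) / (real M)\<^sup>2"
  proof -
    have i1: "integrable lborel (\<lambda>y. indicator ucube y * (\<Phi> y * (1 - c b y)))" for b
      by (intro integrable_ucube continuous_intros cont cont_c)
    have "(LBINT y. indicator ucube y * (\<Phi> y * (norm y)\<^sup>2))
       \<le> (LBINT y. (\<Sum>b\<in>Basis. indicator ucube y * (\<Phi> y * (1 - c b y))))"
    proof (rule integral_mono)
      show "integrable lborel (\<lambda>y. indicator ucube y * (\<Phi> y * (norm y)\<^sup>2))"
        by (intro integrable_ucube continuous_intros cont)
      show "integrable lborel (\<lambda>y. \<Sum>b\<in>Basis. indicator ucube y * (\<Phi> y * (1 - c b y)))"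
        by (rule Bochner_Integration.integrable_sum) (rule i1)
      fix y :: 'a
      show "indicator ucube y * (\<Phi> y * (norm y)\<^sup>2) \<le> (\<Sum>b\<in>Basis. indicator ucube y * (\<Phi> y * (1 - c b y)))"
      proof (cases "y \<in> ucube")
        case True
        have "(norm y)\<^sup>2 = (\<Sum>b\<in>Basis. (y \<bullet> b)\<^sup>2)"
          unfolding power2_norm_eq_inner by (subst euclidean_inner) (simp add: power2_eq_square)
        also have "\<dots> \<le> (\<Sum>b\<in>Basis. 1 - c b y)"
        proof (rule sum_mono)
          fix b :: 'a assume "b \<in> Basis"
          then have "\<bar>y \<bullet> b\<bar> \<le> 1 / 2" using ucube_infnorm[OF True] infnorm_le_iff by blast
          from square_le_one_minus_cos[OF this] show "(y \<bullet> b)\<^sup>2 \<le> 1 - c b y"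
            by (simp add: c_def inner_commute)
        qed
        finally have "\<Phi> y * (norm y)\<^sup>2 \<le> \<Phi> y * (\<Sum>b\<in>Basis. 1 - c b y)"
          using nonneg by (intro mult_left_mono)
        then show ?thesis using True by (simp add: sum_distrib_left)
      qed simp
    qed
    also have "\<dots> = (\<Sum>b\<in>Basis. LBINT y. indicator ucube y * (\<Phi> y * (1 - c b y)))"
      by (rule Bochner_Integration.integral_sum) (rule i1)
    also have "\<dots> \<le> (\<Sum>b\<in>(Basis :: 'a set). 3 ^ DIM('a) / (real M)\<^sup>2)"
    proof (rule sum_mono)
      fix b :: 'a assume b: "b \<in> Basis"
      have "(LBINT y. indicator ucube y * (\<Phi> y * (1 - c b y)))
         = (LBINT y. indicator ucube y * \<Phi> y - indicator ucube y * (\<Phi> y * c b y))"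
        by (simp add: algebra_simps)
      also have "\<dots> = 1 - (\<Sum>j\<in>J. w j * w (j + b))"
        unfolding cos_moment[OF b, symmetric] one[symmetric]
        by (intro Bochner_Integration.integral_diff integrable_ucube continuous_intros cont cont_c)
      finally show "(LBINT y. indicator ucube y * (\<Phi> y * (1 - c b y))) \<le> 3 ^ DIM('a) / (real M)\<^sup>2"
        using wb[OF b] by simp
    qed
    finally show ?thesis by simp
  qed
  have fourier: "\<bar>(LBINT x. f x * \<Phi> x) - (LBINT x. f x)\<bar>
       \<le> (\<Sum>k\<in>zbox (6 * M) - {0}. \<bar>LBINT x. f x * cos (2 * pi * (k \<bullet> x))\<bar>)"
    if f: "integrable lborel f" for f
  proof -
    define F where "F = (\<lambda>k. LBINT x. f x * c k x)"
    \<comment> \<open>The diagonal pairs \<open>j = l\<close> reproduce the integral of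
      \<open>f\<close> and are removed. The rest is estimated as a quadratic form in
      \<open>w\<close> by Schur's test: every row and every column of \<open>G\<close> sums to at
      most \<open>T\<close>, since \<open>j - l\<close> runs through distinct nonzero
      frequencies.\<close>
    define G where "G = (\<lambda>j l. if j = l then 0 else \<bar>F (j - l)\<bar>)"
    define T where "T = (\<Sum>k\<in>zbox (6 * M) - {0}. \<bar>F k\<bar>)"
    have fm: "f \<in> borel_measurable borel" using f by auto
    have i: "integrable lborel (\<lambda>x. f x * c k x)" for k
    proof (rule Bochner_Integration.integrable_bound[OF f])
      show "(\<lambda>x. f x * c k x) \<in> borel_measurable lborel"
        using fm borel_measurable_continuous_onI[OF cont_c] by auto
      show "AE x in lborel. norm (f x * c k x) \<le> norm (f x)"
        by (rule AE_I2) (auto simp: c_def abs_mult intro!: mult_left_le)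
    qed
    have F0: "F 0 = (LBINT x. f x)" by (simp add: F_def c_def)
    have T1: "(\<Sum>l\<in>J. G j l) \<le> T" "(\<Sum>l\<in>J. G l j) \<le> T" if j: "j \<in> J" for j
    proof -
      have mem: "j - l \<in> zbox (6 * M)" "l - j \<in> zbox (6 * M)" if "l \<in> J" for l
      proof -
        have "infnorm (j - l) \<le> infnorm j + infnorm l"
          using infnorm_triangle[of j "- l"] by (simp add: infnorm_neg)
        \<comment> \<open>Differences of points of \<open>J\<close> have infinity norm at most
          \<open>4 * M + 2\<close>, and \<open>M \<ge> 1\<close> brings this below
          \<open>6 * M\<close>.\<close>
        moreover have "2 * real (2 * M + 1) \<le> real (6 * M)" using M by simp
        ultimately have "infnorm (j - l) \<le> real (6 * M)"
          using j \<open>l \<in> J\<close> unfolding J_def zbox_def by fastforce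
        then show "j - l \<in> zbox (6 * M)" "l - j \<in> zbox (6 * M)"
          using j \<open>l \<in> J\<close> JZ zlat_diff by (auto simp: zbox_def infnorm_sub subset_iff)
      qed
      have fin': "finite (zbox (6 * M) - {0::'a})" by (simp add: finite_zbox)
      have "(\<Sum>l\<in>J. G j l) = (\<Sum>l\<in>J - {j}. \<bar>F (j - l)\<bar>)"
        using fin by (intro sum.mono_neutral_cong_right) (auto simp: G_def)
      also have "\<dots> = (\<Sum>k\<in>(\<lambda>l. j - l) ` (J - {j}). \<bar>F k\<bar>)"
        by (subst sum.reindex) (auto simp: inj_on_def)
      also have "\<dots> \<le> T" unfolding T_def
        by (intro sum_mono2 fin') (use mem in auto)
      finally show "(\<Sum>l\<in>J. G j l) \<le> T" .
      have "(\<Sum>l\<in>J. G l j) = (\<Sum>l\<in>J - {j}. \<bar>F (l - j)\<bar>)"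
        using fin by (intro sum.mono_neutral_cong_right) (auto simp: G_def)
      also have "\<dots> = (\<Sum>k\<in>(\<lambda>l. l - j) ` (J - {j}). \<bar>F k\<bar>)"
        by (subst sum.reindex) (auto simp: inj_on_def)
      also have "\<dots> \<le> T" unfolding T_def
        by (intro sum_mono2 fin') (use mem in auto)
      finally show "(\<Sum>l\<in>J. G l j) \<le> T" .
    qed
    have "(LBINT x. f x * \<Phi> x) = (LBINT x. (\<Sum>j\<in>J. \<Sum>l\<in>J. w j * w l * (f x * c (j - l) x)))"
      unfolding \<Phi>_def by (simp add: sum_distrib_left mult_ac)
    also have "\<dots> = (\<Sum>j\<in>J. \<Sum>l\<in>J. w j * w l * F (j - l))"
      unfolding F_def
      by (subst Bochner_Integration.integral_sum,
          (intro Bochner_Integration.integrable_sum integrable_mult_right i),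
          intro sum.cong refl, subst Bochner_Integration.integral_sum,
          (intro integrable_mult_right i), simp)
    finally have 1: "(LBINT x. f x * \<Phi> x) = (\<Sum>j\<in>J. \<Sum>l\<in>J. w j * w l * F (j - l))" .
    have 2: "(LBINT x. f x) = (\<Sum>j\<in>J. \<Sum>l\<in>J. if j = l then w j * w l * F (j - l) else 0)"
    proof -
      have "(\<Sum>j\<in>J. \<Sum>l\<in>J. if j = l then w j * w l * F (j - l) else 0) = (\<Sum>j\<in>J. (w j)\<^sup>2 * F 0)"
        using fin by (intro sum.cong refl) (simp add: power2_eq_square)
      then show ?thesis by (simp add: sum_distrib_right[symmetric] w1 F0)
    qed
    have "\<bar>(LBINT x. f x * \<Phi> x) - (LBINT x. f x)\<bar>
       \<le> (\<Sum>j\<in>J. \<Sum>l\<in>J. \<bar>w j * w l * F (j - l) - (if j = l then w j * w l * F (j - l) else 0)\<bar>)"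
      unfolding 1 2 sum_subtractf[symmetric]
      by (rule order_trans[OF sum_abs]) (intro sum_mono order_trans[OF sum_abs] order_refl)
    also have "\<dots> \<le> (\<Sum>j\<in>J. \<Sum>l\<in>J. (w j)\<^sup>2 / 2 * G j l + (w l)\<^sup>2 / 2 * G j l)"
    proof (intro sum_mono)
      fix j l
      have "w j * w l \<le> ((w j)\<^sup>2 + (w l)\<^sup>2) / 2"
        using sum_squares_bound[of "w j" "w l"] by simp
      then have "w j * w l * \<bar>F (j - l)\<bar> \<le> ((w j)\<^sup>2 + (w l)\<^sup>2) / 2 * \<bar>F (j - l)\<bar>"
        by (intro mult_right_mono) auto
      then show "\<bar>w j * w l * F (j - l) - (if j = l then w j * w l * F (j - l) else 0)\<bar>
        \<le> (w j)\<^sup>2 / 2 * G j l + (w l)\<^sup>2 / 2 * G j l"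
        using w0[of j] w0[of l] by (auto simp: G_def abs_mult field_simps)
    qed
    also have "\<dots> = (\<Sum>j\<in>J. (w j)\<^sup>2 / 2 * (\<Sum>l\<in>J. G j l)) + (\<Sum>l\<in>J. (w l)\<^sup>2 / 2 * (\<Sum>j\<in>J. G j l))"
      unfolding sum.distrib sum_distrib_left
      by (rule arg_cong2[where f = "(+)", OF refl]) (rule sum.swap)
    also have "\<dots> \<le> (\<Sum>j\<in>J. (w j)\<^sup>2 / 2 * T) + (\<Sum>l\<in>J. (w l)\<^sup>2 / 2 * T)"
      by (intro add_mono sum_mono mult_left_mono T1) auto
    also have "\<dots> = T"
      by (simp add: sum_distrib_right[symmetric] sum_divide_distrib[symmetric] w1)
    finally show ?thesis by (simp add: T_def F_def c_def)
  qed
  show ?thesis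
    by (rule that[OF cont nonneg periodic one moment fourier])
qed

section \<open>Smoothing the lattice sum\<close>

text \<open>Convexity: increments of \<open>x powr \<alpha>\<close> over a fixed step grow with
  \<open>x\<close>. The start \<open>s = 0\<close> is treated apart, where the claim is
  superadditivity, because the derivative argument uses positive arguments.\<close>

lemma powr_superadd_mono:
  fixes \<alpha> e s t :: real
  assumes \<alpha>: "\<alpha> \<ge> 1" and s: "0 \<le> s" "s \<le> t" and e: "0 \<le> e"
  shows "(s + e) powr \<alpha> - s powr \<alpha> \<le> (t + e) powr \<alpha> - t powr \<alpha>"
proof (cases "s = 0")
  case True
  show ?thesis
  proof (cases "t + e = 0")
    case True
    then have "t = 0" "e = 0" using s e by auto
    then show ?thesis using \<open>s = 0\<close> by simp
  next
    case False
    have split: "x powr \<alpha> \<le> x * (t + e) powr (\<alpha> - 1)" if "0 \<le> x" "x \<le> t + e" for x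
    proof (cases "x = 0")
      case False
      then have "x powr \<alpha> = x * x powr (\<alpha> - 1)" using that by (simp add: powr_diff)
      also have "\<dots> \<le> x * (t + e) powr (\<alpha> - 1)"
        using that \<alpha> by (intro mult_left_mono powr_mono2) auto
      finally show ?thesis .
    qed simp
    have "e powr \<alpha> + t powr \<alpha> \<le> e * (t + e) powr (\<alpha> - 1) + t * (t + e) powr (\<alpha> - 1)"
      using s e by (intro add_mono split) auto
    also have "\<dots> = (t + e) * (t + e) powr (\<alpha> - 1)" by (simp add: algebra_simps)
    also have "\<dots> = (t + e) powr \<alpha>"
      using False s e by (simp add: powr_diff)
    finally show ?thesis using True by simp
  qed
next
  case False
  show ?thesis
  proof (rule DERIV_nonneg_imp_nondecreasing[where f = "\<lambda>x. (x + e) powr \<alpha> - x powr \<alpha>", OF s(2)])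
    fix x assume x: "s \<le> x" "x \<le> t"
    then have "x > 0" using s False by linarith
    then have "((\<lambda>x. (x + e) powr \<alpha> - x powr \<alpha>) has_real_derivative
        \<alpha> * (x + e) powr (\<alpha> - 1) * 1 - \<alpha> * x powr (\<alpha> - 1)) (at x)"
      using e by (intro DERIV_diff DERIV_chain2[OF has_real_derivative_powr] has_real_derivative_powr)
         (auto intro!: derivative_eq_intros)
    moreover have "x powr (\<alpha> - 1) \<le> (x + e) powr (\<alpha> - 1)"
      using \<open>x > 0\<close> e \<alpha> by (intro powr_mono2) auto
    then have "0 \<le> \<alpha> * (x + e) powr (\<alpha> - 1) * 1 - \<alpha> * x powr (\<alpha> - 1)"
      using \<alpha> by (simp add: mult_left_mono)
    ultimately show "\<exists>y. ((\<lambda>x. (x + e) powr \<alpha> - x powr \<alpha>) has_real_derivative y) (at x) \<and> 0 \<le> y"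
      by blast
  qed
qed

text \<open>Trades a displacement of the lattice point for a change of radius. The increase from
  \<open>s powr \<alpha>\<close> to \<open>(s + e) powr \<alpha>\<close> is at most that from
  \<open>R powr \<alpha>\<close> to \<open>(R + e) powr \<alpha>\<close>, so enlarging the radius by
  \<open>e\<close> compensates for it.\<close>

lemma profile_shift:
  assumes \<alpha>: "\<alpha> \<ge> 1" and "0 \<le> R" "0 \<le> e" "0 \<le> s" "0 \<le> s'" "s' \<le> s + e"
  shows "profile \<alpha> R s \<le> profile \<alpha> (R + e) s'"
proof (cases "s \<le> R")
  case True
  have "s' powr \<alpha> \<le> (s + e) powr \<alpha>" using assms by (intro powr_mono2) auto
  moreover have "(s + e) powr \<alpha> - s powr \<alpha> \<le> (R + e) powr \<alpha> - R powr \<alpha>"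
    using assms True by (intro powr_superadd_mono) auto
  ultimately show ?thesis
    unfolding profile_def using \<alpha> by (intro powr_mono2) auto
next
  case False
  then show ?thesis using assms by (simp add: profile_eq_0)
qed

text \<open>The first argument only fixes the space. The box of radius
  \<open>\<lceil>R\<rceil>\<close> contains every lattice point at which the profile is nonzero, so
  larger boxes give the same sum.\<close>

definition lattice_sum :: "'a::euclidean_space itself \<Rightarrow> real \<Rightarrow> real \<Rightarrow> real" where
  "lattice_sum _ \<alpha> R = (\<Sum>z\<in>(zbox (nat \<lceil>R\<rceil>) :: 'a set). profile \<alpha> R (norm z))"

definition profile_volume :: "'a::euclidean_space itself \<Rightarrow> real \<Rightarrow> real \<Rightarrow> real" where
  "profile_volume _ \<alpha> R = (LBINT x. profile \<alpha> R (norm (x :: 'a)))"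

abbreviation lattice_error :: "'a::euclidean_space itself \<Rightarrow> real \<Rightarrow> real \<Rightarrow> real" where
  "lattice_error T \<alpha> R \<equiv> lattice_sum T \<alpha> R - profile_volume T \<alpha> R"

lemma lattice_sum_eq:
  assumes "\<alpha> > 0" "0 \<le> R" "R \<le> real m"
  shows "lattice_sum TYPE('a::euclidean_space) \<alpha> R = (\<Sum>z\<in>(zbox m :: 'a set). profile \<alpha> R (norm z))"
  unfolding lattice_sum_def
proof (rule sum.mono_neutral_left)
  have "nat \<lceil>R\<rceil> \<le> m" using assms by linarith
  then have "real (nat \<lceil>R\<rceil>) \<le> real m" by simp
  then show "(zbox (nat \<lceil>R\<rceil>) :: 'a set) \<subseteq> zbox m" unfolding zbox_def using order_trans by blast
  show "\<forall>z\<in>zbox m - zbox (nat \<lceil>R\<rceil>). profile \<alpha> R (norm (z :: 'a)) = 0"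
  proof
    fix z :: 'a assume "z \<in> zbox m - zbox (nat \<lceil>R\<rceil>)"
    then have "infnorm z > real (nat \<lceil>R\<rceil>)" by (auto simp: zbox_def)
    moreover have "infnorm z \<le> norm z" by (rule infnorm_le_norm)
    ultimately have "R \<le> norm z" by linarith
    then show "profile \<alpha> R (norm z) = 0" using assms by (simp add: profile_eq_0)
  qed
qed (simp add: finite_zbox)

lemma lattice_sum_mono:
  assumes "\<alpha> > 0" "0 \<le> r" "r \<le> R"
  shows "lattice_sum TYPE('a::euclidean_space) \<alpha> r \<le> lattice_sum TYPE('a) \<alpha> R"
proof -
  have "R \<le> real (nat \<lceil>R\<rceil>)" by linarith
  then have "lattice_sum TYPE('a) \<alpha> r = (\<Sum>z\<in>(zbox (nat \<lceil>R\<rceil>) :: 'a set). profile \<alpha> r (norm z))"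
    using assms order_trans by (intro lattice_sum_eq) blast+
  also have "\<dots> \<le> lattice_sum TYPE('a) \<alpha> R"
    unfolding lattice_sum_def using assms by (intro sum_mono profile_mono) auto
  finally show ?thesis .
qed

lemma integrable_profile:
  fixes g :: "'a::euclidean_space \<Rightarrow> real"
  assumes "\<alpha> > 0" "0 \<le> R" and g: "continuous_on UNIV g"
  shows "integrable lborel (\<lambda>x::'a. profile \<alpha> R (norm x) * g x)"
proof -
  have "bounded (g ` cball 0 R)"
    by (intro compact_imp_bounded compact_continuous_image continuous_on_subset[OF g]) auto
  then obtain B where B: "\<And>x. x \<in> cball 0 R \<Longrightarrow> \<bar>g x\<bar> \<le> B" unfolding bounded_iff by fastforce
  show ?thesis
  proof (rule integrable_bounded_support[where B = "R\<^sup>2 * \<bar>B\<bar>" and r = R])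
    have "(\<lambda>x::'a. profile \<alpha> R (norm x)) \<in> borel_measurable borel" by measurable
    then show "(\<lambda>x::'a. profile \<alpha> R (norm x) * g x) \<in> borel_measurable borel"
      by (rule borel_measurable_times[OF _ borel_measurable_continuous_onI[OF g]])
    show "\<bar>profile \<alpha> R (norm x) * g x\<bar> \<le> R\<^sup>2 * \<bar>B\<bar>" for x :: 'a
    proof (cases "norm x \<le> R")
      case True
      then have "\<bar>g x\<bar> \<le> \<bar>B\<bar>" using B[of x] by simp
      then show ?thesis
        using profile_le[of \<alpha> R "norm x"] assms by (simp add: abs_mult mult_mono)
    qed (use assms in \<open>simp add: profile_eq_0\<close>)
  qed (use assms in \<open>simp add: profile_eq_0\<close>)
qed

section \<open>Homogeneity of the volume term\<close>

lemma lborel_integral_scale: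
  fixes f :: "'a::euclidean_space \<Rightarrow> real"
  assumes f: "f \<in> borel_measurable borel" and c: "c > 0"
  shows "(LBINT x. f x) = c ^ DIM('a) * (LBINT x. f (c *\<^sub>R x))"
proof -
  have "(LBINT x. f x) = (\<integral>x. f x \<partial>(density (distr lborel borel (\<lambda>x. 0 + c *\<^sub>R x)) (\<lambda>_. \<bar>c\<bar> ^ DIM('a))))"
    by (subst lborel_affine[of c 0, symmetric]) (use c in auto)
  also have "\<dots> = (\<integral>x. \<bar>c\<bar> ^ DIM('a) *\<^sub>R f x \<partial>(distr lborel borel (\<lambda>x. 0 + c *\<^sub>R x)))"
    by (rule integral_density) (use f in auto)
  also have "\<dots> = (LBINT x. \<bar>c\<bar> ^ DIM('a) *\<^sub>R f (0 + c *\<^sub>R x))"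
    by (rule integral_distr) (use f in auto)
  finally show ?thesis using c by simp
qed

lemma profile_volume_eq:
  assumes \<alpha>: "\<alpha> > 0" and R: "0 \<le> R"
  shows "profile_volume TYPE('a::euclidean_space) \<alpha> R = profile_volume TYPE('a) \<alpha> 1 * R ^ (DIM('a) + 2)"
proof (cases "R = 0")
  case True
  then show ?thesis by (simp add: profile_volume_def profile_def)
next
  case False
  then have R: "R > 0" using R by simp
  have "profile \<alpha> R (norm (R *\<^sub>R x)) = R\<^sup>2 * profile \<alpha> 1 (norm x)" for x :: 'a
  proof -
    have "max 0 (R powr \<alpha> - (R * norm x) powr \<alpha>) = R powr \<alpha> * max 0 (1 - norm x powr \<alpha>)"
      using R by (simp add: powr_mult max_mult_distrib_left right_diff_distrib)
    then show ?thesis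
      using R \<alpha> by (simp add: profile_def powr_mult powr_powr)
  qed
  moreover have "(\<lambda>x::'a. profile \<alpha> R (norm x)) \<in> borel_measurable borel" by measurable
  ultimately show ?thesis
    unfolding profile_volume_def using R by (subst lborel_integral_scale[of _ R]) (auto simp: power_add power2_eq_square)
qed

lemma profile_volume_nonneg: "0 \<le> profile_volume TYPE('a::euclidean_space) \<alpha> R"
  unfolding profile_volume_def by (intro integral_nonneg_AE) auto

lemma profile_volume_lipschitz:
  assumes "\<alpha> > 0" "0 \<le> r" "r \<le> B" "0 \<le> s" "s \<le> B"
  shows "\<bar>profile_volume TYPE('a::euclidean_space) \<alpha> r - profile_volume TYPE('a) \<alpha> s\<bar>
    \<le> profile_volume TYPE('a) \<alpha> 1 * (real (DIM('a) + 2) * B ^ (DIM('a) + 1)) * \<bar>r - s\<bar>"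
proof -
  have "\<bar>profile_volume TYPE('a::euclidean_space) \<alpha> r - profile_volume TYPE('a) \<alpha> s\<bar>
    = profile_volume TYPE('a) \<alpha> 1 * \<bar>r ^ Suc (DIM('a) + 1) - s ^ Suc (DIM('a) + 1)\<bar>"
    using assms profile_volume_nonneg[of \<alpha> 1, where 'a = 'a]
    by (simp add: profile_volume_eq[of \<alpha> r] profile_volume_eq[of \<alpha> s] right_diff_distrib[symmetric] abs_mult
         del: power_Suc)
  also have "\<dots> \<le> profile_volume TYPE('a) \<alpha> 1 * (real (Suc (DIM('a) + 1)) * B ^ (DIM('a) + 1) * \<bar>r - s\<bar>)"
    using assms by (intro mult_left_mono abs_power_Suc_diff_le profile_volume_nonneg) auto
  finally show ?thesis by (simp add: mult_ac)
qed

text \<open>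
  The mass of the kernel outside a ball of radius comparable to \<open>1 / M\<close> costs a quarter of the a
  priori bound \<open>D\<close>.
\<close>

lemma smoothing_inequality:
  fixes \<alpha> :: real
  assumes \<alpha>: "\<alpha> \<ge> 2"
  obtains C \<kappa> where "C > 0" "\<kappa> \<ge> 1"
    "\<And>R M T D. R \<ge> \<kappa> + sqrt (real DIM('a::euclidean_space)) \<Longrightarrow> M \<ge> (1::nat) \<Longrightarrow>
      (\<And>R'. \<bar>R' - R\<bar> \<le> \<kappa> \<Longrightarrow>
         (\<Sum>k\<in>zbox (6 * M) - {0::'a}. \<bar>LBINT x. profile \<alpha> R' (norm x) * cos (2 * pi * (k \<bullet> x))\<bar>) \<le> T) \<Longrightarrow>
      (\<And>r. 0 \<le> r \<Longrightarrow> r \<le> R + (\<kappa> + sqrt (real DIM('a))) \<Longrightarrow>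
         \<bar>lattice_error TYPE('a) \<alpha> r\<bar> \<le> D) \<Longrightarrow>
      \<bar>lattice_error TYPE('a) \<alpha> R\<bar>
        \<le> T + C * R ^ (DIM('a) + 1) / real M + D / 4"
proof -
  define n where "n = DIM('a)"
  \<comment> \<open>With \<open>\<epsilon> = \<kappa> / M\<close>, this makes
    \<open>2 * D / \<epsilon>^2\<close> times the second moment bound \<open>n * 3 ^ n / M^2\<close>
    equal to \<open>D / 4\<close>.\<close>
  define \<kappa> where "\<kappa> = sqrt (8 * real n * 3 ^ n)"
  define c where "c = sqrt (real n)"
  define S where "S = lattice_sum TYPE('a) \<alpha>"
  define V where "V = profile_volume TYPE('a) \<alpha>"
  define C where "C = (V 1 + 1) * (real (n + 2) * 2 ^ (n + 1)) * (1 + \<kappa> + \<kappa>\<^sup>2 / 8)"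
  have n1: "n \<ge> 1" by (simp add: n_def Suc_leI)
  have \<kappa>2: "\<kappa>\<^sup>2 = 8 * real n * 3 ^ n" by (simp add: \<kappa>_def)
  have \<kappa>1: "\<kappa> \<ge> 1"
  proof -
    have "1 * 1 * 1 \<le> 8 * real n * 3 ^ n" using n1 by (intro mult_mono) auto
    then show ?thesis by (simp add: \<kappa>_def)
  qed
  have c1: "c \<ge> 1" using n1 by (simp add: c_def)
  have \<alpha>0: "\<alpha> > 0" "\<alpha> \<ge> 1" using \<alpha> by auto
  have V1: "0 \<le> V 1" by (simp add: V_def profile_volume_nonneg)
  have C0: "C > 0" unfolding C_def using V1 \<kappa>1 by (intro mult_pos_pos) (auto intro!: add_pos_nonneg)
  have main: "\<bar>S R - V R\<bar> \<le> T + C * R ^ (n + 1) / real M + D / 4"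
    if R: "R \<ge> \<kappa> + c" and M: "M \<ge> (1::nat)"
      and T: "\<And>R'. \<bar>R' - R\<bar> \<le> \<kappa> \<Longrightarrow>
         (\<Sum>k\<in>zbox (6 * M) - {0::'a}. \<bar>LBINT x. profile \<alpha> R' (norm x) * cos (2 * pi * (k \<bullet> x))\<bar>) \<le> T"
      and D: "\<And>r. 0 \<le> r \<Longrightarrow> r \<le> R + (\<kappa> + c) \<Longrightarrow> \<bar>S r - V r\<bar> \<le> D"
    for R M T D
  proof -
    define \<epsilon> where "\<epsilon> = \<kappa> / real M"
    define \<Delta> where "\<Delta> = S R - V R"
    define A where "A = V 1 * (real (n + 2) * (2 * R) ^ (n + 1))"
    define m2 where "m2 = real n * 3 ^ n / (real M)\<^sup>2"
    \<comment> \<open>Coefficient of the quadratic comparison function. Its first part pays for a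
      deviation of \<open>2 * D\<close> at displacements beyond \<epsilon>, its second part for the
      variation of the volume, \<open>A\<close> being a Lipschitz constant of \<open>V\<close> up to
      \<open>2 * R\<close>.\<close>
    define a1 where "a1 = 2 * D / \<epsilon>\<^sup>2 + A * real M"
    have R0: "R > 0" using R \<kappa>1 c1 by linarith
    have \<epsilon>: "0 < \<epsilon>" "\<epsilon> \<le> \<kappa>"
      using M \<kappa>1 by (auto simp: \<epsilon>_def divide_le_eq mult_le_cancel_left1)
    have A0: "0 \<le> A" unfolding A_def using V1 R0 by (intro mult_nonneg_nonneg) auto
    have \<Delta>D: "\<bar>\<Delta>\<bar> \<le> D" unfolding \<Delta>_def using R0 \<kappa>1 c1 by (intro D) auto
    then have D0: "D \<ge> 0" by linarith
    have a10: "a1 \<ge> 0" using D0 A0 by (simp add: a1_def)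
    have lip: "\<bar>V r - V s\<bar> \<le> A * \<bar>r - s\<bar>" if "0 \<le> r" "r \<le> 2 * R" "0 \<le> s" "s \<le> 2 * R" for r s
      using profile_volume_lipschitz[OF \<alpha>0(1) that, where 'a = 'a] by (simp add: V_def A_def n_def)
    have a1m2: "a1 * m2 = D / 4 + A * (\<kappa>\<^sup>2 / 8) / real M"
      using M \<epsilon> \<kappa>1 n1 unfolding a1_def m2_def \<epsilon>_def \<kappa>2 power_divide
      by (simp add: field_simps power2_eq_square)
    obtain \<Phi> :: "'a \<Rightarrow> real" where cont: "continuous_on UNIV \<Phi>" and nonneg: "\<And>x. 0 \<le> \<Phi> x"
      and per: "\<And>z x. z \<in> zlat \<Longrightarrow> \<Phi> (z + x) = \<Phi> x"
      and one: "(LBINT y. indicator ucube y * \<Phi> y) = 1"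
      and mom: "(LBINT y. indicator ucube y * (\<Phi> y * (norm y)\<^sup>2)) \<le> m2"
      and four: "\<And>f. integrable lborel f \<Longrightarrow> \<bar>(LBINT x. f x * \<Phi> x) - (LBINT x. f x)\<bar>
         \<le> (\<Sum>k\<in>zbox (6 * M) - {0}. \<bar>LBINT x. f x * cos (2 * pi * (k \<bullet> x))\<bar>)"
      using smoothing_kernel[OF M, where 'a = 'a] unfolding m2_def n_def by blast
    define m where "m = nat \<lceil>2 * R\<rceil>"
    have m: "2 * R \<le> real m" unfolding m_def by linarith
    define \<Sigma> where "\<Sigma> = (\<lambda>R1 (y::'a). \<Sum>z\<in>zbox (m + 1). profile \<alpha> R1 (norm (z + y)))"
    have tile: "(LBINT x. profile \<alpha> R1 (norm x) * \<Phi> x) = (LBINT y. indicator ucube y * (\<Phi> y * \<Sigma> R1 y))"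
      "integrable lborel (\<lambda>y. indicator ucube y * (\<Phi> y * \<Sigma> R1 y))"
      if R1: "0 \<le> R1" "R1 \<le> 2 * R" for R1
    proof -
      have eq: "indicator ucube y * (\<Sum>z\<in>zbox (m + 1). profile \<alpha> R1 (norm (z + y)) * \<Phi> (z + y))
         = indicator ucube y * (\<Phi> y * \<Sigma> R1 y)" for y
      proof -
        have "(\<Sum>z\<in>zbox (m + 1). profile \<alpha> R1 (norm (z + y)) * \<Phi> (z + y)) = \<Phi> y * \<Sigma> R1 y"
          unfolding \<Sigma>_def sum_distrib_left by (intro sum.cong refl) (auto simp: zbox_def per mult.commute)
        then show ?thesis by simp
      qed
      have supp: "profile \<alpha> R1 (norm x) * \<Phi> x = 0" if "infnorm x > real m" for x
        using that infnorm_le_norm[of x] R1 m \<alpha>0 by (simp add: profile_eq_0)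
      have t: "(LBINT x. profile \<alpha> R1 (norm x) * \<Phi> x) = (LBINT y. indicator ucube y *
          (\<Sum>z\<in>zbox (m + 1). profile \<alpha> R1 (norm (z + y)) * \<Phi> (z + y)))"
        "integrable lborel (\<lambda>y. indicator ucube y * (\<Sum>z\<in>zbox (m + 1). profile \<alpha> R1 (norm (z + y)) * \<Phi> (z + y)))"
        by (rule integral_tiling[OF integrable_profile[OF \<alpha>0(1) R1(1) cont]], rule supp, assumption)+
      show "(LBINT x. profile \<alpha> R1 (norm x) * \<Phi> x) = (LBINT y. indicator ucube y * (\<Phi> y * \<Sigma> R1 y))"
        using t(1) unfolding eq .
      show "integrable lborel (\<lambda>y. indicator ucube y * (\<Phi> y * \<Sigma> R1 y))"
        using t(2) unfolding eq .
    qed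
    have smoothed: "\<bar>(LBINT y. indicator ucube y * (\<Phi> y * \<Sigma> R1 y)) - V R1\<bar> \<le> T"
      if R1: "\<bar>R1 - R\<bar> \<le> \<kappa>" for R1
    proof -
      have R1': "0 \<le> R1" "R1 \<le> 2 * R" using R1 R c1 by auto
      have "integrable lborel (\<lambda>x::'a. profile \<alpha> R1 (norm x))"
        using integrable_profile[OF \<alpha>0(1) R1'(1), of "\<lambda>_. 1"] by simp
      from order_trans[OF four[OF this] T[OF R1]] show ?thesis
        unfolding tile(1)[OF R1', symmetric] V_def profile_volume_def .
    qed
    have quad_int: "integrable lborel (\<lambda>y. indicator ucube y * (\<Phi> y * (a + b * (norm y)\<^sup>2)))"
       "(LBINT y. indicator ucube y * (\<Phi> y * (a + b * (norm y)\<^sup>2)))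
        = a + b * (LBINT y. indicator ucube y * (\<Phi> y * (norm y)\<^sup>2))" for a b
    proof -
      show "integrable lborel (\<lambda>y. indicator ucube y * (\<Phi> y * (a + b * (norm y)\<^sup>2)))"
        by (intro integrable_ucube continuous_intros cont)
      have i: "integrable lborel (\<lambda>y. indicator ucube y * \<Phi> y)"
        "integrable lborel (\<lambda>y. indicator ucube y * (\<Phi> y * (norm y)\<^sup>2))"
        by (intro integrable_ucube continuous_intros cont)+
      have "(LBINT y. indicator ucube y * (\<Phi> y * (a + b * (norm y)\<^sup>2)))
        = (LBINT y. a * (indicator ucube y * \<Phi> y) + b * (indicator ucube y * (\<Phi> y * (norm y)\<^sup>2)))"
        by (intro Bochner_Integration.integral_cong refl) (simp add: algebra_simps)
      then show "(LBINT y. indicator ucube y * (\<Phi> y * (a + b * (norm y)\<^sup>2)))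
        = a + b * (LBINT y. indicator ucube y * (\<Phi> y * (norm y)\<^sup>2))"
        using i one by simp
    qed
    have yc: "norm y \<le> c" if "y \<in> ucube" for y :: 'a
    proof -
      have "norm y \<le> sqrt (real DIM('a)) * infnorm y" by (rule norm_le_infnorm)
      also have "\<dots> \<le> sqrt (real DIM('a)) * 1" using ucube_infnorm[OF that] by (intro mult_left_mono) auto
      finally show ?thesis by (simp add: c_def n_def)
    qed
    \<comment> \<open>This is \<open>x \<le> 1 + x^2\<close> at \<open>x = M * norm y\<close>. It
      turns the linear volume error into a constant and a quadratic term, and both average to
      \<open>O(A / M)\<close> against the kernel.\<close>
    have lin_quad: "A * norm y \<le> A / real M + A * real M * (norm y)\<^sup>2" for y :: 'a
    proof -
      have "x \<le> 1 + x\<^sup>2" for x :: real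
        using sum_squares_bound[of x 1] zero_le_power2[of x] by (smt (verit) mult.right_neutral one_power2)
      from this[of "real M * norm y"]
      have "norm y \<le> 1 / real M + real M * (norm y)\<^sup>2"
        using M by (simp add: field_simps power2_eq_square)
      from mult_left_mono[OF this A0] show ?thesis by (simp add: distrib_left mult_ac)
    qed
    have dev: "2 * D \<le> 2 * D / \<epsilon>\<^sup>2 * (norm y)\<^sup>2" if "norm y > \<epsilon>" for y :: 'a
    proof -
      have "\<epsilon>\<^sup>2 \<le> (norm y)\<^sup>2" using that \<epsilon> by (intro power_mono) auto
      then have "1 \<le> (norm y)\<^sup>2 / \<epsilon>\<^sup>2" using \<epsilon> by simp
      from mult_left_mono[OF this, of "2 * D"] D0 show ?thesis by simp
    qed
    have "\<Delta> \<le> T + A * \<epsilon> + A / real M + a1 * m2"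
    proof -
      \<comment> \<open>A lower bound valid on the whole cube. For
        \<open>norm y \<le> \<epsilon>\<close> the radius \<open>R + \<epsilon> - norm y\<close> is
        at least \<open>R\<close>, and monotonicity of the lattice sum suffices. Farther out only
        the a priori bound is left; it loses at most \<open>2 * D\<close> besides the change of
        volume, and \<open>dev\<close> absorbs that loss in the quadratic term.\<close>
      have pt: "V R + \<Delta> - A / real M - a1 * (norm y)\<^sup>2 \<le> \<Sigma> (R + \<epsilon>) y" if y: "y \<in> ucube" for y
      proof -
        have r: "0 \<le> R + \<epsilon> - norm y" "R + \<epsilon> - norm y \<le> 2 * R" "R + \<epsilon> - norm y \<le> R + (\<kappa> + c)"
          using yc[OF y] \<epsilon> R \<kappa>1 norm_ge_zero[of y] c1 by linarith+
        have "S (R + \<epsilon> - norm y) \<le> \<Sigma> (R + \<epsilon>) y"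
        proof -
          have "S (R + \<epsilon> - norm y) = (\<Sum>z\<in>(zbox (m + 1) :: 'a set). profile \<alpha> (R + \<epsilon> - norm y) (norm z))"
            unfolding S_def using r m \<alpha>0 by (intro lattice_sum_eq) auto
          also have "\<dots> \<le> \<Sigma> (R + \<epsilon>) y"
            unfolding \<Sigma>_def
          proof (intro sum_mono)
            fix z :: 'a
            show "profile \<alpha> (R + \<epsilon> - norm y) (norm z) \<le> profile \<alpha> (R + \<epsilon>) (norm (z + y))"
              using profile_shift[OF \<alpha>0(2) r(1), of "norm y" "norm z" "norm (z + y)"] norm_triangle_ineq[of z y] by simp
          qed
          finally show ?thesis .
        qed
        moreover have "V R + \<Delta> - A * norm y - 2 * D / \<epsilon>\<^sup>2 * (norm y)\<^sup>2 \<le> S (R + \<epsilon> - norm y)"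
        proof (cases "norm y \<le> \<epsilon>")
          case True
          have "S R \<le> S (R + \<epsilon> - norm y)"
            unfolding S_def using True R0 \<alpha>0 by (intro lattice_sum_mono) auto
          moreover have "0 \<le> A * norm y" "0 \<le> 2 * D / \<epsilon>\<^sup>2 * (norm y)\<^sup>2" using A0 D0 by auto
          ultimately show ?thesis unfolding \<Delta>_def by linarith
        next
          case False
          have "A * \<bar>R - (R + \<epsilon> - norm y)\<bar> \<le> A * norm y"
            using False \<epsilon> A0 by (intro mult_left_mono) auto
          then have "V R - V (R + \<epsilon> - norm y) \<le> A * norm y"
            using lip[of R "R + \<epsilon> - norm y"] r R0 by linarith
          moreover have "V (R + \<epsilon> - norm y) - D \<le> S (R + \<epsilon> - norm y)"
            using D[OF r(1,3)] by linarith
          ultimately show ?thesis using dev[of y] False \<Delta>D by linarith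
        qed
        ultimately show ?thesis using lin_quad[of y] unfolding a1_def distrib_right by linarith
      qed
      have "V R + \<Delta> - A / real M - a1 * m2
         \<le> (V R + \<Delta> - A / real M) + (- a1) * (LBINT y. indicator ucube y * (\<Phi> y * (norm y)\<^sup>2))"
        using mult_left_mono[OF mom a10] by simp
      also have "\<dots> = (LBINT y. indicator ucube y * (\<Phi> y * ((V R + \<Delta> - A / real M) + (- a1) * (norm y)\<^sup>2)))"
        by (rule quad_int(2)[symmetric])
      also have "\<dots> \<le> (LBINT y. indicator ucube y * (\<Phi> y * \<Sigma> (R + \<epsilon>) y))"
      proof (rule integral_mono[OF quad_int(1) tile(2)])
        show "0 \<le> R + \<epsilon>" "R + \<epsilon> \<le> 2 * R" using R0 \<epsilon> R c1 by auto
        show "indicator ucube y * (\<Phi> y * ((V R + \<Delta> - A / real M) + (- a1) * (norm y)\<^sup>2))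
          \<le> indicator ucube y * (\<Phi> y * \<Sigma> (R + \<epsilon>) y)" for y
          using mult_left_mono[OF pt[of y] nonneg[of y]] by (cases "y \<in> ucube") auto
      qed
      also have "\<dots> \<le> V (R + \<epsilon>) + T"
        using smoothed[of "R + \<epsilon>"] \<epsilon> by linarith
      also have "V (R + \<epsilon>) \<le> V R + A * \<epsilon>"
        using lip[of "R + \<epsilon>" R] R0 \<epsilon> R c1 by simp
      finally show ?thesis by linarith
    qed
    \<comment> \<open>The mirror image: the radius \<open>R - \<epsilon>\<close> and a quadratic
      function above instead of below.\<close>
    moreover have "- \<Delta> \<le> T + A * \<epsilon> + A / real M + a1 * m2"
    proof -
      have R\<epsilon>: "0 \<le> R - \<epsilon>" "R - \<epsilon> \<le> 2 * R" using R0 \<epsilon> R c1 by auto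
      have pt: "\<Sigma> (R - \<epsilon>) y \<le> V R + \<Delta> + A / real M + a1 * (norm y)\<^sup>2" if y: "y \<in> ucube" for y
      proof -
        have r: "0 \<le> R - \<epsilon> + norm y" "R - \<epsilon> + norm y \<le> 2 * R" "R - \<epsilon> + norm y \<le> R + (\<kappa> + c)"
          using yc[OF y] \<epsilon> R \<kappa>1 norm_ge_zero[of y] c1 by linarith+
        have "\<Sigma> (R - \<epsilon>) y \<le> S (R - \<epsilon> + norm y)"
        proof -
          have "\<Sigma> (R - \<epsilon>) y \<le> (\<Sum>z\<in>(zbox (m + 1) :: 'a set). profile \<alpha> (R - \<epsilon> + norm y) (norm z))"
            unfolding \<Sigma>_def
          proof (intro sum_mono)
            fix z :: 'a
            have "norm z \<le> norm (z + y) + norm y"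
              using norm_triangle_ineq[of "z + y" "- y"] by simp
            then show "profile \<alpha> (R - \<epsilon>) (norm (z + y)) \<le> profile \<alpha> (R - \<epsilon> + norm y) (norm z)"
              using profile_shift[OF \<alpha>0(2) R\<epsilon>(1), of "norm y" "norm (z + y)" "norm z"] by simp
          qed
          also have "\<dots> = S (R - \<epsilon> + norm y)"
            unfolding S_def using r m \<alpha>0 by (intro lattice_sum_eq[symmetric]) auto
          finally show ?thesis .
        qed
        moreover have "S (R - \<epsilon> + norm y) \<le> V R + \<Delta> + A * norm y + 2 * D / \<epsilon>\<^sup>2 * (norm y)\<^sup>2"
        proof (cases "norm y \<le> \<epsilon>")
          case True
          have "S (R - \<epsilon> + norm y) \<le> S R"
            unfolding S_def using True r R0 \<alpha>0 by (intro lattice_sum_mono) auto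
          moreover have "0 \<le> A * norm y" "0 \<le> 2 * D / \<epsilon>\<^sup>2 * (norm y)\<^sup>2" using A0 D0 by auto
          ultimately show ?thesis unfolding \<Delta>_def by linarith
        next
          case False
          have "A * \<bar>(R - \<epsilon> + norm y) - R\<bar> \<le> A * norm y"
            using False \<epsilon> A0 by (intro mult_left_mono) auto
          then have "V (R - \<epsilon> + norm y) - V R \<le> A * norm y"
            using lip[of "R - \<epsilon> + norm y" R] r R0 by linarith
          moreover have "S (R - \<epsilon> + norm y) \<le> V (R - \<epsilon> + norm y) + D"
            using D[OF r(1,3)] by linarith
          ultimately show ?thesis using dev[of y] False \<Delta>D by linarith
        qed
        ultimately show ?thesis using lin_quad[of y] unfolding a1_def distrib_right by linarith
      qed
      have "V R - A * \<epsilon> \<le> V (R - \<epsilon>)"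
        using lip[of R "R - \<epsilon>"] R0 \<epsilon> R\<epsilon> by simp
      also have "V (R - \<epsilon>) \<le> (LBINT y. indicator ucube y * (\<Phi> y * \<Sigma> (R - \<epsilon>) y)) + T"
        using smoothed[of "R - \<epsilon>"] \<epsilon> by linarith
      also have "(LBINT y. indicator ucube y * (\<Phi> y * \<Sigma> (R - \<epsilon>) y))
        \<le> (LBINT y. indicator ucube y * (\<Phi> y * ((V R + \<Delta> + A / real M) + a1 * (norm y)\<^sup>2)))"
      proof (rule integral_mono[OF tile(2)[OF R\<epsilon>] quad_int(1)])
        show "indicator ucube y * (\<Phi> y * \<Sigma> (R - \<epsilon>) y)
          \<le> indicator ucube y * (\<Phi> y * ((V R + \<Delta> + A / real M) + a1 * (norm y)\<^sup>2))" for y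
          using mult_left_mono[OF pt[of y] nonneg[of y]] by (cases "y \<in> ucube") auto
      qed
      also have "\<dots> = (V R + \<Delta> + A / real M) + a1 * (LBINT y. indicator ucube y * (\<Phi> y * (norm y)\<^sup>2))"
        by (rule quad_int(2))
      also have "\<dots> \<le> (V R + \<Delta> + A / real M) + a1 * m2"
        using mult_left_mono[OF mom a10] by simp
      finally show ?thesis by linarith
    qed
    ultimately have "\<bar>\<Delta>\<bar> \<le> T + (A * \<epsilon> + A / real M + a1 * m2)" by linarith
    also have "A * \<epsilon> + A / real M + a1 * m2 = A * (1 + \<kappa> + \<kappa>\<^sup>2 / 8) / real M + D / 4"
      unfolding a1m2 \<epsilon>_def using M by (simp add: field_simps)
    also have "A * (1 + \<kappa> + \<kappa>\<^sup>2 / 8) / real M \<le> C * R ^ (n + 1) / real M"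
    proof (rule divide_right_mono)
      have "V 1 * (real (n + 2) * 2 ^ (n + 1)) * (1 + \<kappa> + \<kappa>\<^sup>2 / 8) * R ^ (n + 1) \<le> C * R ^ (n + 1)"
        unfolding C_def using V1 \<kappa>1 R0 by (intro mult_right_mono) auto
      moreover have "A * (1 + \<kappa> + \<kappa>\<^sup>2 / 8) = V 1 * (real (n + 2) * 2 ^ (n + 1)) * (1 + \<kappa> + \<kappa>\<^sup>2 / 8) * R ^ (n + 1)"
        unfolding A_def power_mult_distrib by (simp only: mult_ac)
      ultimately show "A * (1 + \<kappa> + \<kappa>\<^sup>2 / 8) \<le> C * R ^ (n + 1)" by (simp only:)
    qed simp
    finally show ?thesis by (simp add: \<Delta>_def)
  qed
  show ?thesis
    by (rule that[OF C0 \<kappa>1]) (use main in \<open>auto simp: S_def V_def n_def c_def\<close>)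
qed

section \<open>Summation over frequencies and the bootstrap\<close>

lemma infnorm_zlat_Ints:
  fixes x :: "'a::euclidean_space"
  assumes "x \<in> zlat"
  shows "infnorm x \<in> \<int>"
proof -
  have "infnorm x \<in> (\<lambda>i. \<bar>x \<bullet> i\<bar>) ` Basis"
    unfolding infnorm_Max by (rule Max_in) auto
  then show ?thesis using assms by (auto simp: zlat_def)
qed

text \<open>Summation by shells. The shell at infinity norm \<open>N + 1\<close> has
  \<open>(2 * N + 3) ^ n - (2 * N + 1) ^ n\<close> points, with \<open>n = DIM('a)\<close>. This is
  at most \<open>2 * n * (2 * N + 3) ^ (n - 1)\<close>, and
  \<open>2 * N + 3 \<le> 3 * (N + 1)\<close>.\<close>

lemma sum_zbox_le:
  fixes \<phi> :: "real \<Rightarrow> real"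
  assumes \<phi>: "\<And>j. 0 \<le> \<phi> j"
  shows "(\<Sum>k\<in>(zbox N - {0} :: 'a::euclidean_space set). \<phi> (infnorm k))
    \<le> 2 * real DIM('a) * 3 ^ (DIM('a) - 1) * (\<Sum>j=1..N. real j ^ (DIM('a) - 1) * \<phi> (real j))"
proof (induction N)
  case 0
  have eq: "zbox 0 - {0} = ({} :: 'a set)"
    by (auto simp: zbox_def) (metis infnorm_eq_0 infnorm_pos_le order_antisym)
  show ?case unfolding eq by simp
next
  case (Suc N)
  let ?C = "2 * real DIM('a) * 3 ^ (DIM('a) - 1)"
  have sub: "zbox N \<subseteq> (zbox (Suc N) :: 'a set)" by (auto simp: zbox_def)
  have zero: "0 \<in> (zbox N :: 'a set)" by (simp add: zbox_def infnorm_0)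
  have shell: "infnorm k = real (Suc N)" if "k \<in> zbox (Suc N) - zbox N" for k :: 'a
  proof -
    have "infnorm k \<in> \<int>" using that by (intro infnorm_zlat_Ints) (auto simp: zbox_def)
    then obtain i :: int where i: "infnorm k = of_int i" by (auto elim: Ints_cases)
    have "infnorm k \<le> real (Suc N)" "\<not> infnorm k \<le> real N"
      using that unfolding zbox_def by blast+
    then have "i = int (Suc N)" unfolding i by linarith
    then show ?thesis using i by (simp only: of_int_of_nat_eq)
  qed
  have "zbox (Suc N) - {0} = (zbox N - {0 :: 'a}) \<union> (zbox (Suc N) - zbox N)"
    using sub zero by auto
  then have "(\<Sum>k\<in>(zbox (Suc N) - {0} :: 'a set). \<phi> (infnorm k))
    = (\<Sum>k\<in>(zbox N - {0} :: 'a set). \<phi> (infnorm k)) + (\<Sum>k\<in>(zbox (Suc N) - zbox N :: 'a set). \<phi> (infnorm k))"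
    using finite_zbox[where 'a = 'a] by (simp only:) (subst sum.union_disjoint, auto)
  also have "(\<Sum>k\<in>(zbox (Suc N) - zbox N :: 'a set). \<phi> (infnorm k)) = (\<Sum>k\<in>(zbox (Suc N) - zbox N :: 'a set). \<phi> (real (Suc N)))"
    by (rule sum.cong[OF refl]) (simp add: shell del: of_nat_Suc)
  also have "\<dots> = real (card (zbox (Suc N) - zbox N :: 'a set)) * \<phi> (real (Suc N))" by simp
  also have "real (card (zbox (Suc N) - zbox N :: 'a set)) \<le> ?C * real (Suc N) ^ (DIM('a) - 1)"
  proof -
    have n: "Suc (DIM('a) - 1) = DIM('a)" by simp
    have "real (card (zbox (Suc N) - zbox N :: 'a set)) = real (card (zbox (Suc N) :: 'a set)) - real (card (zbox N :: 'a set))"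
      using sub finite_zbox[where 'a = 'a] card_mono[OF _ sub] by (simp add: card_Diff_subset of_nat_diff)
    also have "\<dots> = real (2 * N + 3) ^ Suc (DIM('a) - 1) - real (2 * N + 1) ^ Suc (DIM('a) - 1)"
      unfolding n by (simp add: card_zbox algebra_simps)
    also have "\<dots> \<le> real (Suc (DIM('a) - 1)) * real (2 * N + 3) ^ (DIM('a) - 1) * \<bar>real (2 * N + 3) - real (2 * N + 1)\<bar>"
      by (rule order_trans[OF abs_ge_self], rule abs_power_Suc_diff_le) auto
    also have "\<dots> = 2 * real DIM('a) * real (2 * N + 3) ^ (DIM('a) - 1)"
      unfolding n by simp
    also have "\<dots> \<le> 2 * real DIM('a) * (3 * real (Suc N)) ^ (DIM('a) - 1)"
      by (intro mult_left_mono power_mono) auto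
    finally show ?thesis by (simp only: power_mult_distrib mult.assoc)
  qed
  then have "real (card (zbox (Suc N) - zbox N :: 'a set)) * \<phi> (real (Suc N)) \<le> ?C * real (Suc N) ^ (DIM('a) - 1) * \<phi> (real (Suc N))"
    by (intro mult_right_mono \<phi>)
  finally have "(\<Sum>k\<in>(zbox (Suc N) - {0} :: 'a set). \<phi> (infnorm k))
     \<le> ?C * (\<Sum>j=1..N. real j ^ (DIM('a) - 1) * \<phi> (real j)) + ?C * real (Suc N) ^ (DIM('a) - 1) * \<phi> (real (Suc N))"
    using Suc.IH by simp
  then show ?case by (simp only: sum.nat_ivl_Suc' distrib_left mult.assoc add.commute)
qed

text \<open>The exponent adds \<open>n - 1\<close> from the number of lattice points in a shell to
  \<open>- (n + 1) / 2 - \<beta>\<close> from the Fourier bound.\<close>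

abbreviation frequency_sum :: "real \<Rightarrow> real \<Rightarrow> nat \<Rightarrow> real" where
  "frequency_sum n \<beta> M \<equiv> (\<Sum>j=1..6 * M. real j powr ((n - 3) / 2 - \<beta>))"

lemma profile_lattice_inequality:
  fixes \<alpha> :: real
  assumes \<alpha>: "\<alpha> \<ge> 2"
  obtains C c where "C > 0" "c > 0"
    "\<And>R M D. R \<ge> c \<Longrightarrow> M \<ge> (1::nat) \<Longrightarrow>
      (\<And>r. 0 \<le> r \<Longrightarrow> r \<le> R + c \<Longrightarrow>
         \<bar>lattice_error TYPE('a::euclidean_space) \<alpha> r\<bar> \<le> D) \<Longrightarrow>
      \<bar>lattice_error TYPE('a) \<alpha> R\<bar>
        \<le> C * (R powr ((real DIM('a) + 3) / 2 - 2 / \<alpha>) * frequency_sum (real DIM('a)) (2 / \<alpha>) M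
            + R ^ (DIM('a) + 1) / real M) + D / 4"
proof -
  define n where "n = real DIM('a)"
  define \<beta> where "\<beta> = 2 / \<alpha>"
  obtain C \<kappa> where C: "C > 0" and \<kappa>: "\<kappa> \<ge> 1" and main:
    "\<And>R M T D. R \<ge> \<kappa> + sqrt n \<Longrightarrow> M \<ge> (1::nat) \<Longrightarrow>
      (\<And>R'. \<bar>R' - R\<bar> \<le> \<kappa> \<Longrightarrow>
         (\<Sum>k\<in>zbox (6 * M) - {0::'a}. \<bar>LBINT x. profile \<alpha> R' (norm x) * cos (2 * pi * (k \<bullet> x))\<bar>) \<le> T) \<Longrightarrow>
      (\<And>r. 0 \<le> r \<Longrightarrow> r \<le> R + (\<kappa> + sqrt n) \<Longrightarrow>
         \<bar>lattice_error TYPE('a) \<alpha> r\<bar> \<le> D) \<Longrightarrow>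
      \<bar>lattice_error TYPE('a) \<alpha> R\<bar>
        \<le> T + C * R ^ (DIM('a) + 1) / real M + D / 4"
    by (rule smoothing_inequality[OF \<alpha>, where 'a = 'a, folded n_def]) blast
  obtain C1 where C1: "C1 > 0"
    and ft: "\<And>(\<xi>::'a) R. R > 0 \<Longrightarrow> R * norm \<xi> \<ge> 2 \<Longrightarrow>
      \<bar>LBINT x. profile \<alpha> R (norm x) * cos (\<xi> \<bullet> x)\<bar>
      \<le> C1 * R powr ((n + 3) / 2 - \<beta>) * norm \<xi> powr (- (n + 1) / 2 - \<beta>)"
    by (rule profile_ft_bound[OF \<alpha>, where 'a = 'a, folded n_def \<beta>_def]) blast
  have n1: "n \<ge> 1" by (simp add: n_def Suc_leI)
  have \<beta>: "0 < \<beta>" "\<beta> \<le> 1" using \<alpha> by (simp_all add: \<beta>_def)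
  define e where "e = (n + 3) / 2 - \<beta>"
  define s where "s = - (n + 1) / 2 - \<beta>"
  have e0: "e \<ge> 0" using n1 \<beta> by (simp add: e_def)
  have s0: "s \<le> 0" using n1 \<beta> by (simp add: s_def)
  define K where "K = 2 * real DIM('a) * 3 ^ (DIM('a) - 1)"
  have K0: "K \<ge> 0" by (simp add: K_def)
  define c where "c = \<kappa> + sqrt n"
  have c: "c > 0" "c \<ge> \<kappa> + 1" using \<kappa> n1 by (auto simp: c_def intro: add_pos_nonneg)
  define C2 where "C2 = C1 * 2 powr e * K"
  have C20: "C2 \<ge> 0" using C1 K0 by (simp add: C2_def)
  have "\<bar>lattice_error TYPE('a) \<alpha> R\<bar>
     \<le> (C2 + C) * (R powr e * frequency_sum n \<beta> M + R ^ (DIM('a) + 1) / real M) + D / 4"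
    if R: "R \<ge> c" and M: "M \<ge> (1::nat)"
      and D: "\<And>r. 0 \<le> r \<Longrightarrow> r \<le> R + c \<Longrightarrow>
         \<bar>lattice_error TYPE('a) \<alpha> r\<bar> \<le> D" for R M D
  proof -
    define \<Sigma> where "\<Sigma> = frequency_sum n \<beta> M"
    have \<Sigma>0: "\<Sigma> \<ge> 0" unfolding \<Sigma>_def by (intro sum_nonneg) auto
    have T: "(\<Sum>k\<in>zbox (6 * M) - {0::'a}. \<bar>LBINT x. profile \<alpha> R' (norm x) * cos (2 * pi * (k \<bullet> x))\<bar>) \<le> C2 * (R powr e * \<Sigma>)"
      if R': "\<bar>R' - R\<bar> \<le> \<kappa>" for R'
    proof -
      have R'b: "1 \<le> R'" "R' \<le> 2 * R" using R' R c \<kappa> by auto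
      have "(\<Sum>k\<in>zbox (6 * M) - {0::'a}. \<bar>LBINT x. profile \<alpha> R' (norm x) * cos (2 * pi * (k \<bullet> x))\<bar>)
         \<le> (\<Sum>k\<in>zbox (6 * M) - {0::'a}. C1 * (2 powr e * R powr e) * infnorm k powr s)"
      proof (rule sum_mono)
        fix k :: 'a assume k: "k \<in> zbox (6 * M) - {0}"
        have "infnorm k \<in> \<int>" using k by (intro infnorm_zlat_Ints) (auto simp: zbox_def)
        moreover have "infnorm k > 0" using k by (simp add: infnorm_pos_lt)
        ultimately have inf1: "infnorm k \<ge> 1" by (auto elim!: Ints_cases)
        have nk: "infnorm k \<le> norm k" by (rule infnorm_le_norm)
        \<comment> \<open>The frequencies \<open>2 * pi * k\<close> have norm at least 2, so
          \<open>R' \<ge> 1\<close> meets the hypothesis of the Fourier bound. As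
          \<open>s \<le> 0\<close>, their norm may then be replaced by the smaller
          \<open>infnorm k\<close>.\<close>
        have big: "norm k * 2 \<le> norm ((2 * pi) *\<^sub>R k)"
          using pi_ge_two mult_left_mono[of 2 "2 * pi" "norm k"] by (simp add: mult.commute)
        have "norm ((2 * pi) *\<^sub>R k) \<ge> 2" using big inf1 nk by linarith
        then have "1 * 2 \<le> R' * norm ((2 * pi) *\<^sub>R k)" using R'b by (intro mult_mono) auto
        then have "\<bar>LBINT x. profile \<alpha> R' (norm x) * cos (((2 * pi) *\<^sub>R k) \<bullet> x)\<bar>
          \<le> C1 * R' powr e * norm ((2 * pi) *\<^sub>R k) powr s"
          unfolding e_def s_def using R'b by (intro ft) auto
        also have "\<dots> \<le> C1 * (2 * R) powr e * infnorm k powr s"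
          using C1 R'b e0 s0 inf1 nk big
          by (intro mult_mono powr_mono2 powr_mono2' mult_left_mono) auto
        also have "(2 * R) powr e = 2 powr e * R powr e"
          using R c \<kappa> by (simp add: powr_mult)
        finally show "\<bar>LBINT x. profile \<alpha> R' (norm x) * cos (2 * pi * (k \<bullet> x))\<bar>
          \<le> C1 * (2 powr e * R powr e) * infnorm k powr s" by (simp add: mult.assoc)
      qed
      also have "\<dots> = C1 * (2 powr e * R powr e) * (\<Sum>k\<in>zbox (6 * M) - {0::'a}. infnorm k powr s)"
        by (simp add: sum_distrib_left)
      also have "\<dots> \<le> C1 * (2 powr e * R powr e) * (K * (\<Sum>j=1..6 * M. real j ^ (DIM('a) - 1) * real j powr s))"
        unfolding K_def using C1 by (intro mult_left_mono sum_zbox_le[where \<phi> = "\<lambda>j. j powr s"]) auto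
      also have "(\<Sum>j=1..6 * M. real j ^ (DIM('a) - 1) * real j powr s) = \<Sigma>"
        unfolding \<Sigma>_def
      proof (intro sum.cong refl)
        fix j assume "j \<in> {1..6 * M}"
        then have j: "real j > 0" by simp
        have "real (DIM('a) - 1) = n - 1" by (simp add: n_def of_nat_diff Suc_leI)
        then have "real j ^ (DIM('a) - 1) = real j powr (n - 1)"
          using powr_realpow[OF j, of "DIM('a) - 1"] by simp
        moreover have "n - 1 + s = (n - 3) / 2 - \<beta>" by (simp add: s_def field_simps)
        ultimately show "real j ^ (DIM('a) - 1) * real j powr s = real j powr ((n - 3) / 2 - \<beta>)"
          by (simp add: powr_add[symmetric])
      qed
      finally show ?thesis by (simp add: C2_def mult_ac)
    qed
    have "\<bar>lattice_error TYPE('a) \<alpha> R\<bar>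
      \<le> C2 * (R powr e * \<Sigma>) + C * R ^ (DIM('a) + 1) / real M + D / 4"
      using R M T D unfolding c_def by (intro main) auto
    also have "C2 * (R powr e * \<Sigma>) + C * R ^ (DIM('a) + 1) / real M
      \<le> (C2 + C) * (R powr e * \<Sigma> + R ^ (DIM('a) + 1) / real M)"
    proof -
      have "0 \<le> C2 * (R ^ (DIM('a) + 1) / real M)" "0 \<le> C * (R powr e * \<Sigma>)"
        using C C20 \<Sigma>0 R c by auto
      moreover have "C * R ^ (DIM('a) + 1) / real M = C * (R ^ (DIM('a) + 1) / real M)" by simp
      ultimately show ?thesis unfolding distrib_left distrib_right by linarith
    qed
    finally show ?thesis by (simp add: \<Sigma>_def)
  qed
  then show ?thesis
    using C C20 c by (intro that[of "C2 + C" c]) (auto simp: e_def n_def \<beta>_def)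
qed

text \<open>Suppose \<open>|\<Delta>|\<close> is at most \<open>2 * B' * E + P / 2 ^ m\<close> for
  large radii. Passing from \<open>R\<close> to \<open>R + c\<close> at most doubles both terms, and
  a quarter of the result is \<open>B' * E R + P R / 2 ^ (m + 1)\<close>. Adding
  \<open>B * E R\<close> restores the same form with \<open>m + 1\<close>. For fixed
  \<open>R\<close> the crude term disappears as \<open>m\<close> tends to infinity.\<close>

lemma bootstrap_bound:
  fixes \<Delta> E P :: "real \<Rightarrow> real"
  assumes c: "c > 0"
    and crude: "\<And>r. 0 \<le> r \<Longrightarrow> \<bar>\<Delta> r\<bar> \<le> P r"
    and P_mono: "\<And>r s. 0 \<le> r \<Longrightarrow> r \<le> s \<Longrightarrow> P r \<le> P s"
    and P_double: "eventually (\<lambda>R. P (R + c) \<le> 2 * P R) at_top"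
    and E_double: "eventually (\<lambda>R. E (R + c) \<le> 2 * E R) at_top"
    and E_mono: "\<And>r s. 1 \<le> r \<Longrightarrow> r \<le> s \<Longrightarrow> E r \<le> E s"
    and E_ge1: "eventually (\<lambda>R. 1 \<le> E R) at_top"
    and step: "eventually (\<lambda>R. \<forall>D. (\<forall>r. 0 \<le> r \<and> r \<le> R + c \<longrightarrow> \<bar>\<Delta> r\<bar> \<le> D) \<longrightarrow> \<bar>\<Delta> R\<bar> \<le> B * E R + D / 4) at_top"
  shows "\<exists>C>0. eventually (\<lambda>R. \<bar>\<Delta> R\<bar> \<le> C * E R) at_top"
proof -
  obtain R1 where R1: "R1 \<ge> 1"
    and Pd: "\<And>R. R \<ge> R1 \<Longrightarrow> P (R + c) \<le> 2 * P R"
    and Ed: "\<And>R. R \<ge> R1 \<Longrightarrow> E (R + c) \<le> 2 * E R"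
    and E1: "\<And>R. R \<ge> R1 \<Longrightarrow> 1 \<le> E R"
    and st: "\<And>R D. R \<ge> R1 \<Longrightarrow> (\<And>r. 0 \<le> r \<Longrightarrow> r \<le> R + c \<Longrightarrow> \<bar>\<Delta> r\<bar> \<le> D) \<Longrightarrow> \<bar>\<Delta> R\<bar> \<le> B * E R + D / 4"
  proof -
    have "eventually (\<lambda>R. R \<ge> 1 \<and> P (R + c) \<le> 2 * P R \<and> E (R + c) \<le> 2 * E R \<and> 1 \<le> E R \<and>
       (\<forall>D. (\<forall>r. 0 \<le> r \<and> r \<le> R + c \<longrightarrow> \<bar>\<Delta> r\<bar> \<le> D) \<longrightarrow> \<bar>\<Delta> R\<bar> \<le> B * E R + D / 4)) at_top"
      using P_double E_double E_ge1 step eventually_ge_at_top[of 1] by eventually_elim blast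
    then obtain R0 where "\<And>R. R \<ge> R0 \<Longrightarrow> R \<ge> 1 \<and> P (R + c) \<le> 2 * P R \<and> E (R + c) \<le> 2 * E R \<and> 1 \<le> E R \<and>
       (\<forall>D. (\<forall>r. 0 \<le> r \<and> r \<le> R + c \<longrightarrow> \<bar>\<Delta> r\<bar> \<le> D) \<longrightarrow> \<bar>\<Delta> R\<bar> \<le> B * E R + D / 4)"
      unfolding eventually_at_top_linorder by blast
    then show ?thesis by (intro that[of R0]) auto
  qed
  \<comment> \<open>The hypothesis of a step ranges over all radii from 0 on; including
    \<open>P R1\<close> covers those below \<open>R1\<close>, to which the induction does not
    apply.\<close>
  define B' where "B' = max \<bar>B\<bar> (max 1 (P R1))"
  have B': "B \<le> B'" "1 \<le> B'" "P R1 \<le> B'" by (auto simp: B'_def)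
  have P0: "0 \<le> P r" if "0 \<le> r" for r using crude[OF that] abs_ge_zero[of "\<Delta> r"] by linarith
  have claim: "\<bar>\<Delta> R\<bar> \<le> 2 * B' * E R + P R / 2 ^ m" if R: "R \<ge> R1" for R m
    using R
  proof (induction m arbitrary: R)
    case 0
    have "0 \<le> 2 * B' * E R" using B' E1[OF 0] by auto
    then show ?case using crude[of R] R1 0 by simp
  next
    case (Suc m)
    have "\<bar>\<Delta> R\<bar> \<le> B * E R + (4 * B' * E R + 2 * P R / 2 ^ m) / 4"
    proof (rule st[OF Suc.prems])
      fix r assume r: "0 \<le> r" "r \<le> R + c"
      show "\<bar>\<Delta> r\<bar> \<le> 4 * B' * E R + 2 * P R / 2 ^ m"
      proof (cases "r < R1")
        case True
        have "\<bar>\<Delta> r\<bar> \<le> P R1" using crude[OF r(1)] P_mono[of r R1] r True by linarith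
        also have "\<dots> \<le> B' * 1" using B' by simp
        also have "\<dots> \<le> B' * (4 * E R)" using B' E1[OF Suc.prems] by (intro mult_left_mono) auto
        finally have "\<bar>\<Delta> r\<bar> \<le> 4 * B' * E R" by simp
        moreover have "0 \<le> 2 * P R / 2 ^ m" using P0[of R] Suc.prems R1 by simp
        ultimately show ?thesis by linarith
      next
        case False
        then have "\<bar>\<Delta> r\<bar> \<le> 2 * B' * E r + P r / 2 ^ m" by (intro Suc.IH) simp
        also have "E r \<le> E (R + c)" using False r R1 by (intro E_mono) auto
        also have "E (R + c) \<le> 2 * E R" by (rule Ed[OF Suc.prems])
        also have "P r \<le> P (R + c)" using r by (intro P_mono) auto
        also have "P (R + c) \<le> 2 * P R" by (rule Pd[OF Suc.prems])
        finally show ?thesis using B' by (simp add: mult_left_mono divide_right_mono)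
      qed
    qed
    also have "B * E R \<le> B' * E R" using B' E1[OF Suc.prems] by (intro mult_right_mono) auto
    finally show ?case by (simp add: field_simps)
  qed
  have "\<bar>\<Delta> R\<bar> \<le> 2 * B' * E R" if R: "R \<ge> R1" for R
  proof (rule LIMSEQ_le_const)
    have "(\<lambda>m. P R * (1 / 2) ^ m) \<longlonglongrightarrow> P R * 0"
      by (intro tendsto_mult tendsto_const LIMSEQ_power_zero) auto
    then show "(\<lambda>m. 2 * B' * E R + P R / 2 ^ m) \<longlonglongrightarrow> 2 * B' * E R"
      using tendsto_add[OF tendsto_const[of "2 * B' * E R"]] by (fastforce simp: power_divide)
  qed (use claim[OF R] in auto)
  then have "eventually (\<lambda>R. \<bar>\<Delta> R\<bar> \<le> 2 * B' * E R) at_top"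
    unfolding eventually_at_top_linorder by blast
  then show ?thesis using B' by (intro exI[of _ "2 * B'"]) auto
qed

section \<open>Harmonic sums and sums of powers\<close>

lemma sum_inverse_le_ln:
  assumes "N \<ge> 1"
  shows "(\<Sum>j=1..N. 1 / real j) \<le> 1 + ln (real N)"
proof -
  have "harm (Suc (N - 1)) - ln (real (Suc (N - 1))) \<le> harm (Suc 0) - ln (real (Suc 0))"
    using decseq_harm_diff_ln unfolding decseq_def by blast
  then show ?thesis
    using assms by (simp add: harm_def inverse_eq_divide)
qed

text \<open>For \<open>\<gamma> \<ge> 1\<close> every term is at most the last one. For smaller
  \<gamma> the terms decrease and each is at most the increment of
  \<open>s powr \<gamma> / \<gamma>\<close> over the preceding unit interval, so the sum
  telescopes.\<close>

lemma sum_powr_le: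
  assumes \<gamma>: "\<gamma> > 0" 
  shows "(\<Sum>j=1..N. real j powr (\<gamma> - 1)) \<le> (1 + 1 / \<gamma>) * real N powr \<gamma>"
proof (cases "\<gamma> \<ge> 1")
  case True
  have "(\<Sum>j=1..N. real j powr (\<gamma> - 1)) \<le> (\<Sum>j=1..N. real N powr (\<gamma> - 1))"
    using True by (intro sum_mono powr_mono2) auto
  also have "\<dots> = real N powr \<gamma>" by (cases "N = 0") (simp_all add: powr_diff)
  also have "\<dots> \<le> (1 + 1 / \<gamma>) * real N powr \<gamma>"
    using \<gamma> by (simp add: distrib_right)
  finally show ?thesis .
next
  case False
  have "(\<Sum>j=1..N. real j powr (\<gamma> - 1)) \<le> real N powr \<gamma> / \<gamma>"
  proof (induction N)
    case (Suc N)
    have "\<gamma> * real (Suc N) powr (\<gamma> - 1) \<le> real (Suc N) powr \<gamma> - real N powr \<gamma>"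
    proof (cases "N = 0")
      case True
      then show ?thesis using False by simp
    next
      case N: False
      have "\<bar>(\<gamma> * real (Suc N) powr (\<gamma> - 1) * real (Suc N)) - (\<gamma> * real (Suc N) powr (\<gamma> - 1) * real N)\<bar>
         \<le> real (Suc N) powr \<gamma> - real N powr \<gamma>"
      proof (rule abs_diff_le_of_derivative_le[where f' = "\<lambda>s. \<gamma> * real (Suc N) powr (\<gamma> - 1)" and k' = "\<lambda>s. \<gamma> * s powr (\<gamma> - 1)"])
        fix s assume s: "real N \<le> s" "s \<le> real (Suc N)"
        show "((\<lambda>s. \<gamma> * real (Suc N) powr (\<gamma> - 1) * s) has_real_derivative \<gamma> * real (Suc N) powr (\<gamma> - 1)) (at s)"
          by (auto intro!: derivative_eq_intros)
        show "((\<lambda>s. s powr \<gamma>) has_real_derivative \<gamma> * s powr (\<gamma> - 1)) (at s)"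
          using s N by (intro has_real_derivative_powr) auto
        show "\<bar>\<gamma> * real (Suc N) powr (\<gamma> - 1)\<bar> \<le> \<gamma> * s powr (\<gamma> - 1)"
          using s N \<gamma> False by (auto simp: abs_mult intro!: mult_left_mono powr_mono2')
      qed simp
      then show ?thesis using \<gamma> by (simp add: right_diff_distrib[symmetric])
    qed
    then have "real (Suc N) powr (\<gamma> - 1) \<le> (real (Suc N) powr \<gamma> - real N powr \<gamma>) / \<gamma>"
      using \<gamma> by (simp add: field_simps)
    then show ?case using Suc.IH by (simp add: diff_divide_distrib)
  qed simp
  also have "\<dots> \<le> (1 + 1 / \<gamma>) * real N powr \<gamma>" by (simp add: distrib_right)
  finally show ?thesis .
qed

section \<open>The error rate\<close>

lemma delta_exp_nonneg:
  assumes "\<alpha> > 4"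
  shows "0 \<le> delta_exp d \<alpha>"
proof -
  have "2 / \<alpha> \<le> 1 / 2" using assms by (simp add: field_simps)
  moreover have "0 \<le> 2 * (1 / 2 - x) / (real d + 1 / 2 - x)" if "x \<le> 1 / 2" for x
    using that by (intro divide_nonneg_nonneg) auto
  ultimately show ?thesis unfolding delta_exp_def by blast
qed

text \<open>For \<beta> at least 1/2 every dimension is reduced to the harmonic sum. The factor
  \<open>j powr ((n - 2) / 2)\<close> is traded for a power of \<open>R\<close> through
  \<open>j \<le> 6 * R\<close>, and \<open>j powr (1 / 2 - \<beta>)\<close> is at most 1. The
  remaining \<open>R powr (1 / 2 - \<beta>)\<close> is kept because it beats the logarithm at
  \<alpha> = 2.\<close>

lemma powr_frequency_term_le:
  fixes R j n \<beta> :: real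
  assumes R: "R > 0" and j: "1 \<le> j" "j \<le> 6 * R" and n: "n \<ge> 2" and \<beta>: "\<beta> \<ge> 1 / 2"
  shows "R powr ((n + 3) / 2 - \<beta>) * j powr ((n - 3) / 2 - \<beta>)
    \<le> 6 powr ((n - 2) / 2) * (R powr n * R powr (1 / 2 - \<beta>)) * (1 / j)"
proof -
  have e: "(n + 3) / 2 - \<beta> = n + (1 / 2 - \<beta>) + - ((n - 2) / 2)"
    "(n - 3) / 2 - \<beta> = (n - 2) / 2 + (1 / 2 - \<beta>) + - 1" by (simp_all add: field_simps)
  have "j powr ((n - 2) / 2) \<le> (6 * R) powr ((n - 2) / 2)"
    using j n by (intro powr_mono2) auto
  moreover have "j powr (1 / 2 - \<beta>) \<le> j powr 0" using j \<beta> by (intro powr_mono) auto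
  ultimately have "j powr ((n - 2) / 2) * j powr (1 / 2 - \<beta>) \<le> (6 * R) powr ((n - 2) / 2) * 1"
    using j by (intro mult_mono) auto
  then have "R powr - ((n - 2) / 2) * (j powr ((n - 2) / 2) * j powr (1 / 2 - \<beta>)) \<le> R powr - ((n - 2) / 2) * (6 powr ((n - 2) / 2) * R powr ((n - 2) / 2))"
    using R by (intro mult_left_mono) (auto simp: powr_mult)
  also have "\<dots> = 6 powr ((n - 2) / 2)" using R by (simp add: powr_minus)
  finally have "(R powr n * R powr (1 / 2 - \<beta>) * j powr - 1) * (R powr - ((n - 2) / 2) * (j powr ((n - 2) / 2) * j powr (1 / 2 - \<beta>)))
    \<le> (R powr n * R powr (1 / 2 - \<beta>) * j powr - 1) * 6 powr ((n - 2) / 2)"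
    by (intro mult_left_mono) auto
  moreover have "j powr - 1 = 1 / j" using j by (simp add: powr_minus_divide)
  ultimately show ?thesis unfolding e powr_add by (simp add: mult_ac)
qed

lemma error_rate_choice:
  fixes \<alpha> :: real
  assumes d: "d \<ge> 1" and \<alpha>: "\<alpha> \<ge> 2"
  obtains B where "B > 0" "eventually (\<lambda>R. \<exists>M\<ge>1::nat. R powr ((real (2 * d) + 3) / 2 - 2 / \<alpha>) *
      frequency_sum (real (2 * d)) (2 / \<alpha>) M + R ^ (2 * d + 1) / real M
    \<le> B * error_rate d \<alpha> R) at_top"
proof -
  define n where "n = real (2 * d)"
  define \<beta> where "\<beta> = 2 / \<alpha>"
  have n: "n \<ge> 2" using d by (simp add: n_def)
  have \<beta>: "0 < \<beta>" "\<beta> \<le> 1" using \<alpha> by (simp_all add: \<beta>_def)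
  show ?thesis
  proof (cases "\<alpha> \<le> 4")
    case True
    then have \<beta>2: "\<beta> \<ge> 1 / 2" using \<alpha> by (simp add: \<beta>_def field_simps)
    \<comment> \<open>The factor of the rate beyond \<open>R ^ (2 * d)\<close>. At \<alpha> = 2 one
      has \<beta> = 1, and \<open>R powr (- 1 / 2)\<close> absorbs the logarithm of the harmonic
      sum; otherwise the logarithm stays.\<close>
    define L where "L = (if \<alpha> = 2 then (\<lambda>R::real. 1) else (\<lambda>R. ln R))"
    have err: "error_rate d \<alpha> R = R ^ (2 * d) * L R" for R
      using True by (simp add: error_rate_def L_def)
    define c where "c = 6 powr ((n - 2) / 2)"
    have c: "c > 0" by (simp add: c_def)
    have L1: "eventually (\<lambda>R. 1 \<le> L R) at_top"
    proof (cases "\<alpha> = 2")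
      case False
      have "eventually (\<lambda>R::real. 1 \<le> ln R) at_top" by real_asymp
      then show ?thesis using False by (simp add: L_def)
    qed (simp add: L_def)
    have L2: "eventually (\<lambda>R. R powr (1 / 2 - \<beta>) * (1 + ln (6 * R)) \<le> 3 * L R) at_top"
    proof (cases "\<alpha> = 2")
      case True
      have "eventually (\<lambda>R::real. R powr (- 1 / 2) * (1 + ln (6 * R)) \<le> 3) at_top" by real_asymp
      then show ?thesis using True by (simp add: L_def \<beta>_def)
    next
      case False
      have "eventually (\<lambda>R::real. 1 + ln (6 * R) \<le> 3 * ln R) at_top" by real_asymp
      then show ?thesis
        using eventually_ge_at_top[of 1]
      proof eventually_elim
        case (elim R)
        have "R powr (1 / 2 - \<beta>) \<le> R powr 0" using elim \<beta>2 by (intro powr_mono) auto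
        then have "R powr (1 / 2 - \<beta>) * (1 + ln (6 * R)) \<le> 1 * (1 + ln (6 * R))"
          using elim by (intro mult_right_mono) auto
        then show ?case using elim False by (simp add: L_def)
      qed
    qed
    show ?thesis
    proof (rule that)
      show "3 * c + 2 > 0" using c by simp
      show "eventually (\<lambda>R. \<exists>M\<ge>1::nat. R powr ((real (2 * d) + 3) / 2 - 2 / \<alpha>) *
        frequency_sum (real (2 * d)) (2 / \<alpha>) M + R ^ (2 * d + 1) / real M
        \<le> (3 * c + 2) * error_rate d \<alpha> R) at_top"
        using L1 L2 eventually_ge_at_top[of 2]
      proof eventually_elim
        case (elim R)
        define M where "M = nat \<lfloor>R\<rfloor>"
        have M: "1 \<le> M" "real M \<le> R" "R \<le> 2 * real M"
          using elim unfolding M_def by linarith+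
        have "R powr ((n + 3) / 2 - \<beta>) * frequency_sum n \<beta> M
          \<le> (\<Sum>j=1..6 * M. c * (R powr n * R powr (1 / 2 - \<beta>)) * (1 / real j))"
          unfolding sum_distrib_left c_def
        proof (rule sum_mono)
          fix j assume "j \<in> {1..6 * M}"
          then have "1 \<le> real j" "real j \<le> 6 * R" using M by auto
          then show "R powr ((n + 3) / 2 - \<beta>) * real j powr ((n - 3) / 2 - \<beta>)
             \<le> 6 powr ((n - 2) / 2) * (R powr n * R powr (1 / 2 - \<beta>)) * (1 / real j)"
            using elim n \<beta>2 by (intro powr_frequency_term_le) auto
        qed
        also have "\<dots> = c * (R powr n * R powr (1 / 2 - \<beta>)) * (\<Sum>j=1..6 * M. 1 / real j)"
          by (simp only: sum_distrib_left)
        also have "\<dots> \<le> c * (R powr n * R powr (1 / 2 - \<beta>)) * (1 + ln (6 * R))"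
        proof (rule mult_left_mono)
          have "(\<Sum>j=1..6 * M. 1 / real j) \<le> 1 + ln (real (6 * M))"
            using M by (intro sum_inverse_le_ln) auto
          also have "ln (real (6 * M)) \<le> ln (6 * R)" using M elim by simp
          finally show "(\<Sum>j=1..6 * M. 1 / real j) \<le> 1 + ln (6 * R)" by simp
        qed (use c in auto)
        also have "\<dots> = c * R powr n * (R powr (1 / 2 - \<beta>) * (1 + ln (6 * R)))" by (simp only: mult_ac)
        also have "\<dots> \<le> c * R powr n * (3 * L R)"
          using elim c by (intro mult_left_mono) auto
        also have "R powr n = R ^ (2 * d)" using elim unfolding n_def by (intro powr_realpow) auto
        finally have 1: "R powr ((n + 3) / 2 - \<beta>) * frequency_sum n \<beta> M
          \<le> 3 * c * error_rate d \<alpha> R" by (simp add: err mult_ac)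
        have "R ^ (2 * d + 1) / real M \<le> 2 * R ^ (2 * d)"
          using M mult_right_mono[OF M(3), of "R ^ (2 * d)"] elim by (simp add: divide_le_eq mult_ac)
        also have "\<dots> \<le> 2 * error_rate d \<alpha> R"
          unfolding err using elim by (simp add: mult_le_cancel_left1)
        finally have "R powr ((n + 3) / 2 - \<beta>) * frequency_sum n \<beta> M + R ^ (2 * d + 1) / real M
           \<le> (3 * c + 2) * error_rate d \<alpha> R" using 1 by (simp add: distrib_right)
        then show ?case using M(1) by (auto simp: n_def \<beta>_def)
      qed
    qed
  next
    case False
    then have \<beta>2: "\<beta> < 1 / 2" by (simp add: \<beta>_def field_simps)
    \<comment> \<open>The exponent of \<open>M\<close> at which the frequency part
      \<open>R powr ((n + 3) / 2 - \<beta> + \<theta> * \<gamma>)\<close> and the smoothing part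
      \<open>R powr (n + 1 - \<theta>)\<close> agree; \<open>exp_eq\<close> checks this. Then
      \<open>1 - \<theta>\<close> is \<open>delta_exp d \<alpha>\<close>.\<close>
    define \<theta> where "\<theta> = (n - 1 + 2 * \<beta>) / (n + 1 - 2 * \<beta>)"
    define \<gamma> where "\<gamma> = (n - 1) / 2 - \<beta>"
    \<comment> \<open>The 12 is 6 from the frequency range times 2 from
      \<open>M \<le> 2 * R powr \<theta>\<close>, the cost of rounding up.\<close>
    define c where "c = (1 + 1 / \<gamma>) * 12 powr \<gamma>"
    have den: "n + 1 - 2 * \<beta> > 0" using n \<beta>2 by simp
    have \<theta>: "\<theta> > 0" unfolding \<theta>_def using n \<beta> den by (intro divide_pos_pos) auto
    have \<gamma>: "\<gamma> > 0" using n \<beta>2 by (simp add: \<gamma>_def)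
    have c: "c > 0" unfolding c_def using \<gamma> by (intro mult_pos_pos add_pos_pos) auto
    have err: "error_rate d \<alpha> R = R powr (n + 1 - \<theta>)" for R
    proof -
      have "2 * real d + delta_exp d \<alpha> = n + 1 - \<theta>"
      proof -
        have "delta_exp d \<alpha> = 2 * (1 / 2 - \<beta>) / ((n + 1 - 2 * \<beta>) / 2)"
          unfolding delta_exp_def \<beta>_def n_def by (simp add: field_simps)
        also have "\<dots> = 1 - \<theta>" using den unfolding \<theta>_def by (simp add: field_simps)
        finally show ?thesis by (simp add: n_def)
      qed
      then show ?thesis using False \<alpha> by (simp add: error_rate_def)
    qed
    have exp_eq: "(n + 3) / 2 - \<beta> + \<theta> * \<gamma> = n + 1 - \<theta>"
    proof -
      have "\<theta> * (\<gamma> + 1) = \<theta> * ((n + 1 - 2 * \<beta>) / 2)" by (simp add: \<gamma>_def field_simps)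
      also have "\<dots> = (n - 1 + 2 * \<beta>) / 2" using den by (simp add: \<theta>_def)
      finally show ?thesis by (simp add: field_simps)
    qed
    show ?thesis
    proof (rule that)
      show "c + 1 > 0" using c by simp
      show "eventually (\<lambda>R. \<exists>M\<ge>1::nat. R powr ((real (2 * d) + 3) / 2 - 2 / \<alpha>) *
        frequency_sum (real (2 * d)) (2 / \<alpha>) M + R ^ (2 * d + 1) / real M
        \<le> (c + 1) * error_rate d \<alpha> R) at_top"
        using eventually_ge_at_top[of 1]
      proof eventually_elim
        case (elim R)
        define M where "M = nat \<lceil>R powr \<theta>\<rceil>"
        have R1: "1 \<le> R powr \<theta>" using elim \<theta> by (simp add: ge_one_powr_ge_zero)
        have M: "1 \<le> M" "R powr \<theta> \<le> real M" "real M \<le> 2 * R powr \<theta>"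
          using R1 unfolding M_def by linarith+
        have "frequency_sum n \<beta> M = (\<Sum>j=1..6 * M. real j powr (\<gamma> - 1))"
          by (simp add: \<gamma>_def field_simps)
        also have "\<dots> \<le> (1 + 1 / \<gamma>) * real (6 * M) powr \<gamma>" by (rule sum_powr_le[OF \<gamma>])
        also have "\<dots> \<le> (1 + 1 / \<gamma>) * (12 * R powr \<theta>) powr \<gamma>"
          using M \<gamma> by (intro mult_left_mono powr_mono2) auto
        also have "\<dots> = c * R powr (\<theta> * \<gamma>)" by (simp add: powr_mult powr_powr c_def)
        finally have "R powr ((n + 3) / 2 - \<beta>) * frequency_sum n \<beta> M
          \<le> R powr ((n + 3) / 2 - \<beta>) * (c * R powr (\<theta> * \<gamma>))" by (intro mult_left_mono) auto
        also have "\<dots> = c * error_rate d \<alpha> R"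
          unfolding err exp_eq[symmetric] powr_add by (simp only: mult_ac)
        finally have 1: "R powr ((n + 3) / 2 - \<beta>) * frequency_sum n \<beta> M \<le> c * error_rate d \<alpha> R" .
        have "R ^ (2 * d + 1) = R powr (n + 1)"
          using powr_realpow[of R "2 * d + 1"] elim by (simp add: n_def add.commute)
        then have "R ^ (2 * d + 1) / real M \<le> R powr (n + 1) / R powr \<theta>"
          using M R1 by (intro frac_le) auto
        also have "\<dots> = error_rate d \<alpha> R" unfolding err by (simp add: powr_diff)
        finally have "R powr ((n + 3) / 2 - \<beta>) * frequency_sum n \<beta> M + R ^ (2 * d + 1) / real M
           \<le> (c + 1) * error_rate d \<alpha> R" using 1 by (simp add: distrib_right)
        then show ?case using M(1) by (auto simp: n_def \<beta>_def)
      qed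
    qed
  qed
qed

lemma error_rate_mono:
  assumes "1 \<le> r" "r \<le> s"
  shows "error_rate d \<alpha> r \<le> error_rate d \<alpha> s"
proof -
  have "r ^ (2 * d) * ln r \<le> s ^ (2 * d) * ln s"
    using assms by (intro mult_mono power_mono) auto
  moreover have "r ^ (2 * d) \<le> s ^ (2 * d)" using assms by (intro power_mono) auto
  moreover have "r powr (2 * real d + delta_exp d \<alpha>) \<le> s powr (2 * real d + delta_exp d \<alpha>)" if "\<alpha> > 4"
    using assms delta_exp_nonneg[OF that] by (intro powr_mono2) auto
  ultimately show ?thesis by (auto simp: error_rate_def)
qed

lemma power_le_error_rate:
  "eventually (\<lambda>R. R ^ (2 * d) \<le> error_rate d \<alpha> R) at_top"
proof -
  have "eventually (\<lambda>R::real. 1 \<le> ln R) at_top" by real_asymp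
  then show ?thesis
    using eventually_ge_at_top[of 1]
  proof eventually_elim
    case (elim R)
    have "R ^ (2 * d) \<le> R ^ (2 * d) * ln R" using elim by (simp add: mult_le_cancel_left1)
    moreover have "R ^ (2 * d) \<le> R powr (2 * real d + delta_exp d \<alpha>)" if "\<alpha> > 4"
    proof -
      have "R ^ (2 * d) = R powr (2 * real d)" using powr_realpow[of R "2 * d"] elim by simp
      also have "\<dots> \<le> R powr (2 * real d + delta_exp d \<alpha>)"
        using elim delta_exp_nonneg[OF that] by (intro powr_mono) auto
      finally show ?thesis .
    qed
    ultimately show ?case by (auto simp: error_rate_def)
  qed
qed

text \<open>In each of the three cases the ratio of the rates at \<open>R + c\<close> and
  \<open>R\<close> tends to 1; the factor 2 is the one that the bootstrap tolerates against its
  quarter.\<close>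

lemma error_rate_doubling:
  "eventually (\<lambda>R. error_rate d \<alpha> (R + c) \<le> 2 * error_rate d \<alpha> R) at_top"
proof -
  have ratio: "((\<lambda>R::real. (R + c) / R) \<longlongrightarrow> 1) at_top" by real_asymp
  have ln_ratio: "((\<lambda>R::real. ln (R + c) / ln R) \<longlongrightarrow> 1) at_top" by real_asymp
  have pow: "((\<lambda>R::real. ((R + c) / R) ^ (2 * d)) \<longlongrightarrow> 1) at_top"
    using tendsto_power[OF ratio, of "2 * d"] by simp
  have pow_ln: "((\<lambda>R::real. ((R + c) / R) ^ (2 * d) * (ln (R + c) / ln R)) \<longlongrightarrow> 1) at_top"
    using tendsto_mult[OF pow ln_ratio] by simp
  have powr: "((\<lambda>R::real. ((R + c) / R) powr s) \<longlongrightarrow> 1) at_top" for s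
    using tendsto_powr[OF ratio tendsto_const, of s] by simp
  have ev: "eventually (\<lambda>R. f R \<le> 2) at_top" if "(f \<longlongrightarrow> 1) at_top" for f :: "real \<Rightarrow> real"
    using order_tendstoD(2)[OF that, of 2] by (auto elim!: eventually_mono)
  show ?thesis
    using ev[OF pow] ev[OF pow_ln] ev[OF powr[of "2 * real d + delta_exp d \<alpha>"]]
      eventually_gt_at_top[of "max 1 (- c)"]
  proof eventually_elim
    case (elim R)
    then have "R > 1" "R + c > 0" "ln R > 0" by auto
    have "(R + c) ^ (2 * d) \<le> 2 * R ^ (2 * d)"
      using elim(1) \<open>R > 1\<close> by (simp add: power_divide divide_le_eq)
    moreover have "(R + c) ^ (2 * d) * ln (R + c) \<le> 2 * (R ^ (2 * d) * ln R)"
      using elim(2) \<open>R > 1\<close> \<open>ln R > 0\<close> by (simp add: power_divide divide_le_eq)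
    moreover have "(R + c) powr (2 * real d + delta_exp d \<alpha>) \<le> 2 * R powr (2 * real d + delta_exp d \<alpha>)"
      using elim(3) \<open>R > 1\<close> \<open>R + c > 0\<close> by (simp add: powr_divide divide_le_eq)
    ultimately show ?case by (auto simp: error_rate_def)
  qed
qed

lemma profile_lattice_bound:
  fixes \<alpha> :: real
  assumes d: "d \<ge> 1" and \<alpha>: "\<alpha> \<ge> 2" and dim: "DIM('a::euclidean_space) = 2 * d"
  shows "\<exists>C>0. eventually (\<lambda>R. \<bar>lattice_error TYPE('a) \<alpha> R\<bar>
    \<le> C * error_rate d \<alpha> R) at_top"
proof -
  obtain C c where C: "C > 0" and c: "c > 0" and main:
    "\<And>R M D. R \<ge> c \<Longrightarrow> M \<ge> (1::nat) \<Longrightarrow>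
      (\<And>r. 0 \<le> r \<Longrightarrow> r \<le> R + c \<Longrightarrow>
         \<bar>lattice_error TYPE('a) \<alpha> r\<bar> \<le> D) \<Longrightarrow>
      \<bar>lattice_error TYPE('a) \<alpha> R\<bar>
        \<le> C * (R powr ((real (2 * d) + 3) / 2 - 2 / \<alpha>) * frequency_sum (real (2 * d)) (2 / \<alpha>) M
            + R ^ (2 * d + 1) / real M) + D / 4"
    by (rule profile_lattice_inequality[OF \<alpha>, where 'a = 'a, unfolded dim]) blast
  obtain B where B: "B > 0" and ev: "eventually (\<lambda>R. \<exists>M\<ge>1::nat. R powr ((real (2 * d) + 3) / 2 - 2 / \<alpha>) *
      frequency_sum (real (2 * d)) (2 / \<alpha>) M + R ^ (2 * d + 1) / real M
    \<le> B * error_rate d \<alpha> R) at_top"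
    by (rule error_rate_choice[OF d \<alpha>])
  have \<alpha>0: "\<alpha> > 0" using \<alpha> by simp
  define V1 where "V1 = profile_volume TYPE('a) \<alpha> 1"
  have V1: "V1 \<ge> 0" by (simp add: V1_def profile_volume_nonneg)
  define p where "p = 2 * d + 2"
  show ?thesis
  \<comment> \<open>The crude majorant counts at most \<open>(3 * (1 + r)) ^ (2 * d)\<close> lattice
    points, each of height at most \<open>r^2\<close>, and adds a volume homogeneous of degree
    \<open>2 * d + 2\<close>. Being polynomial, it at most doubles from \<open>R\<close> to
    \<open>R + c\<close> for large \<open>R\<close>.\<close>
  proof (rule bootstrap_bound[where P = "\<lambda>R. (3 ^ (2 * d) + V1) * (1 + R) ^ p" and B = "C * B", OF c])
    fix r :: real assume r: "0 \<le> r"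
    have "lattice_sum TYPE('a) \<alpha> r \<le> (\<Sum>z\<in>(zbox (nat \<lceil>r\<rceil>) :: 'a set). r\<^sup>2)"
      unfolding lattice_sum_def using \<alpha>0 r by (intro sum_mono profile_le) auto
    also have "\<dots> = (2 * real (nat \<lceil>r\<rceil>) + 1) ^ (2 * d) * r\<^sup>2"
      by (simp add: card_zbox dim add.commute)
    also have "\<dots> \<le> (3 * (1 + r)) ^ (2 * d) * (1 + r)\<^sup>2"
    proof (intro mult_mono power_mono)
      show "2 * real (nat \<lceil>r\<rceil>) + 1 \<le> 3 * (1 + r)"
      proof -
        have "real (nat \<lceil>r\<rceil>) = of_int \<lceil>r\<rceil>" using r by simp
        moreover have "real_of_int \<lceil>r\<rceil> \<le> r + 1" by (rule of_int_ceiling_le_add_one)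
        ultimately show ?thesis using r by argo
      qed
    qed (use r in auto)
    also have "\<dots> = 3 ^ (2 * d) * (1 + r) ^ p"
      by (simp only: p_def power_mult_distrib power_add mult.assoc)
    finally have "lattice_sum TYPE('a) \<alpha> r \<le> 3 ^ (2 * d) * (1 + r) ^ p" .
    moreover have "0 \<le> lattice_sum TYPE('a) \<alpha> r"
      unfolding lattice_sum_def by (intro sum_nonneg) auto
    moreover have "profile_volume TYPE('a) \<alpha> r \<le> V1 * (1 + r) ^ p"
      using profile_volume_eq[OF \<alpha>0 r, where 'a = 'a] V1 r
      by (auto simp: dim V1_def p_def simp del: power_Suc power_Suc2 intro!: mult_left_mono power_mono)
    moreover have "0 \<le> profile_volume TYPE('a) \<alpha> r" by (rule profile_volume_nonneg)
    moreover have "0 \<le> 3 ^ (2 * d) * (1 + r) ^ p" "0 \<le> V1 * (1 + r) ^ p" using r V1 by auto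
    ultimately show "\<bar>lattice_error TYPE('a) \<alpha> r\<bar> \<le> (3 ^ (2 * d) + V1) * (1 + r) ^ p"
      unfolding distrib_right by linarith
  next
    fix r s :: real assume "0 \<le> r" "r \<le> s"
    then show "(3 ^ (2 * d) + V1) * (1 + r) ^ p \<le> (3 ^ (2 * d) + V1) * (1 + s) ^ p"
      using V1 by (intro mult_left_mono power_mono) auto
  next
    have "((\<lambda>R::real. (1 + (R + c)) / (1 + R)) \<longlongrightarrow> 1) at_top" by real_asymp
    from tendsto_power[OF this, of p] have "((\<lambda>R::real. ((1 + (R + c)) / (1 + R)) ^ p) \<longlongrightarrow> 1) at_top" by simp
    from order_tendstoD(2)[OF this, of 2]
    have "eventually (\<lambda>R::real. ((1 + (R + c)) / (1 + R)) ^ p < 2) at_top" by simp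
    then show "eventually (\<lambda>R. (3 ^ (2 * d) + V1) * (1 + (R + c)) ^ p \<le> 2 * ((3 ^ (2 * d) + V1) * (1 + R) ^ p)) at_top"
      using eventually_ge_at_top[of 0]
    proof eventually_elim
      case (elim R)
      then have "(1 + (R + c)) ^ p \<le> 2 * (1 + R) ^ p"
        by (simp add: power_divide divide_less_eq)
      from mult_left_mono[OF this, of "3 ^ (2 * d) + V1"] V1 show ?case by (simp add: mult_ac)
    qed
  next
    show "eventually (\<lambda>R. error_rate d \<alpha> (R + c) \<le> 2 * error_rate d \<alpha> R) at_top"
      by (rule error_rate_doubling)
    show "error_rate d \<alpha> r \<le> error_rate d \<alpha> s" if "1 \<le> r" "r \<le> s" for r s
      by (rule error_rate_mono[OF that])
    show "eventually (\<lambda>R. 1 \<le> error_rate d \<alpha> R) at_top"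
      using power_le_error_rate[of d \<alpha>] eventually_ge_at_top[of 1]
      by eventually_elim (meson one_le_power order_trans)
    show "eventually (\<lambda>R. \<forall>D. (\<forall>r. 0 \<le> r \<and> r \<le> R + c \<longrightarrow>
        \<bar>lattice_error TYPE('a) \<alpha> r\<bar> \<le> D) \<longrightarrow>
        \<bar>lattice_error TYPE('a) \<alpha> R\<bar> \<le> C * B * error_rate d \<alpha> R + D / 4) at_top"
      using ev eventually_ge_at_top[of c]
    proof eventually_elim
      case (elim R)
      then obtain M :: nat where M: "M \<ge> 1" and le: "R powr ((real (2 * d) + 3) / 2 - 2 / \<alpha>) *
        frequency_sum (real (2 * d)) (2 / \<alpha>) M + R ^ (2 * d + 1) / real M
        \<le> B * error_rate d \<alpha> R" by blast
      show ?case
      proof (intro allI impI)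
        fix D assume D: "\<forall>r. 0 \<le> r \<and> r \<le> R + c \<longrightarrow>
          \<bar>lattice_error TYPE('a) \<alpha> r\<bar> \<le> D"
        have "\<bar>lattice_error TYPE('a) \<alpha> R\<bar>
          \<le> C * (R powr ((real (2 * d) + 3) / 2 - 2 / \<alpha>) * frequency_sum (real (2 * d)) (2 / \<alpha>) M
            + R ^ (2 * d + 1) / real M) + D / 4"
          using D by (intro main elim M) auto
        also have "\<dots> \<le> C * (B * error_rate d \<alpha> R) + D / 4"
          using mult_left_mono[OF le, of C] C by simp
        finally show "\<bar>lattice_error TYPE('a) \<alpha> R\<bar> \<le> C * B * error_rate d \<alpha> R + D / 4"
          by (simp add: mult.assoc)
      qed
    qed
  qed
qed

section \<open>Counting and volume of Heisenberg balls\<close>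

lemma zlat_vec_iff: "(z :: real ^ 'n) \<in> zlat \<longleftrightarrow> (\<forall>i. z $ i \<in> \<int>)"
  by (auto simp: zlat_def Basis_vec_def inner_axis)

lemma heis_ball_iff:
  fixes z :: "real ^ 'n"
  assumes A: "A > 0" and \<alpha>: "\<alpha> > 0" and R: "R \<ge> 0"
  shows "(z, t) \<in> heis_ball \<alpha> A R \<longleftrightarrow>
    norm z \<le> R \<and> \<bar>t\<bar> \<le> A powr (- (2 / \<alpha>)) * profile \<alpha> R (norm z)"
proof -
  have root: "(x powr (\<alpha> / 2)) powr (2 / \<alpha>) = x" "(x powr (2 / \<alpha>)) powr (\<alpha> / 2) = x" if "x \<ge> 0" for x
    using \<alpha> that by (simp_all add: powr_powr)
  have nz: "norm z \<le> R \<longleftrightarrow> norm z powr \<alpha> \<le> R powr \<alpha>"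
    using \<alpha> R powr_less_mono2[of \<alpha> R "norm z"] powr_mono2[of \<alpha> "norm z" R]
    by (meson less_le_not_le linorder_not_le norm_ge_zero order_less_imp_le)
  have main: "\<bar>t\<bar> powr (\<alpha> / 2) \<le> u / A \<longleftrightarrow> \<bar>t\<bar> \<le> A powr (- (2 / \<alpha>)) * u powr (2 / \<alpha>)" if "u \<ge> 0" for u
  proof -
    have e: "A powr (- (2 / \<alpha>)) * u powr (2 / \<alpha>) = (u / A) powr (2 / \<alpha>)"
      using A that by (simp add: powr_divide powr_minus_divide)
    show ?thesis
      unfolding e
    proof
      assume "\<bar>t\<bar> powr (\<alpha> / 2) \<le> u / A"
      then have "(\<bar>t\<bar> powr (\<alpha> / 2)) powr (2 / \<alpha>) \<le> (u / A) powr (2 / \<alpha>)"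
        using \<alpha> by (intro powr_mono2) auto
      then show "\<bar>t\<bar> \<le> (u / A) powr (2 / \<alpha>)" by (simp only: root abs_ge_zero)
    next
      assume "\<bar>t\<bar> \<le> (u / A) powr (2 / \<alpha>)"
      then have "\<bar>t\<bar> powr (\<alpha> / 2) \<le> ((u / A) powr (2 / \<alpha>)) powr (\<alpha> / 2)"
        using \<alpha> by (intro powr_mono2) auto
      moreover have "0 \<le> u / A" using A that by simp
      ultimately show "\<bar>t\<bar> powr (\<alpha> / 2) \<le> u / A" by (simp only: root)
    qed
  qed
  show ?thesis
  proof (cases "norm z \<le> R")
    case True
    then have "(z, t) \<in> heis_ball \<alpha> A R \<longleftrightarrow> \<bar>t\<bar> powr (\<alpha> / 2) \<le> (R powr \<alpha> - norm z powr \<alpha>) / A"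
      using A by (simp add: heis_ball_def le_divide_eq algebra_simps)
    also have "\<dots> \<longleftrightarrow> \<bar>t\<bar> \<le> A powr (- (2 / \<alpha>)) * profile \<alpha> R (norm z)"
      using True nz by (subst main) (auto simp: profile_def max_def)
    finally show ?thesis using True by simp
  next
    case False
    then have "R powr \<alpha> < norm z powr \<alpha>" using nz by simp
    moreover have "0 \<le> A * \<bar>t\<bar> powr (\<alpha> / 2)" using A by simp
    ultimately have "(z, t) \<notin> heis_ball \<alpha> A R" by (simp add: heis_ball_def)
    then show ?thesis using False by simp
  qed
qed

text \<open>The slice over \<open>z\<close> is an interval of length \<open>2 * \<tau> z\<close>,
  and the slice lengths are integrated. Borel measurability is established so that the slicing takes
  place in \<open>lborel\<close> and carries over to its completion.\<close>

lemma heis_ball_volume: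
  assumes A: "A > 0" and \<alpha>: "\<alpha> > 0" and R: "R \<ge> 0"
  shows "measure lebesgue (heis_ball \<alpha> A R :: ((real ^ 'n) \<times> real) set)
    = 2 * A powr (- (2 / \<alpha>)) * profile_volume TYPE(real ^ 'n) \<alpha> R"
proof -
  define \<tau> where "\<tau> = (\<lambda>z :: real ^ 'n. A powr (- (2 / \<alpha>)) * profile \<alpha> R (norm z))"
  let ?B = "heis_ball \<alpha> A R :: ((real ^ 'n) \<times> real) set"
  have \<tau>0: "0 \<le> \<tau> z" for z by (simp add: \<tau>_def)
  have meas: "?B \<in> sets borel"
  proof -
    have "(\<lambda>x :: (real ^ 'n) \<times> real. norm (fst x)) \<in> borel_measurable borel"
      "(\<lambda>x :: (real ^ 'n) \<times> real. \<bar>snd x\<bar>) \<in> borel_measurable borel"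
      by (intro borel_measurable_continuous_onI continuous_intros)+
    then have "(\<lambda>x :: (real ^ 'n) \<times> real. norm (fst x) powr \<alpha> + A * \<bar>snd x\<bar> powr (\<alpha> / 2)) \<in> borel_measurable borel"
      by (intro borel_measurable_add borel_measurable_times powr_real_measurable borel_measurable_const)
    from borel_measurable_le[OF this borel_measurable_const, of "R powr \<alpha>"]
    have "{x :: (real ^ 'n) \<times> real. norm (fst x) powr \<alpha> + A * \<bar>snd x\<bar> powr (\<alpha> / 2) \<le> R powr \<alpha>} \<in> sets borel"
      unfolding space_borel by (simp only: UNIV_I simp_thms)
    also have "{x :: (real ^ 'n) \<times> real. norm (fst x) powr \<alpha> + A * \<bar>snd x\<bar> powr (\<alpha> / 2) \<le> R powr \<alpha>} = ?B"
      by (auto simp: heis_ball_def)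
    finally show ?thesis .
  qed
  have "emeasure lborel ?B = emeasure (lborel \<Otimes>\<^sub>M lborel) ?B"
    by (simp only: lborel_prod)
  also have "\<dots> = (\<integral>\<^sup>+z. emeasure lborel (Pair z -` ?B) \<partial>lborel)"
    by (rule lborel.emeasure_pair_measure_alt) (use meas in \<open>simp only: lborel_prod sets_lborel\<close>)
  also have "\<dots> = (\<integral>\<^sup>+z. ennreal (2 * \<tau> z) \<partial>lborel)"
  proof (rule nn_integral_cong)
    fix z :: "real ^ 'n"
    show "emeasure lborel (Pair z -` ?B) = ennreal (2 * \<tau> z)"
    proof (cases "norm z \<le> R")
      case True
      have "Pair z -` ?B = {- \<tau> z..\<tau> z}"
        using True heis_ball_iff[OF A \<alpha> R, of z] by (auto simp: \<tau>_def abs_le_iff)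
      then show ?thesis using \<tau>0[of z] by simp
    next
      case False
      then have "Pair z -` ?B = {}" using heis_ball_iff[OF A \<alpha> R, of z] by auto
      moreover have "\<tau> z = 0" using False \<alpha> R by (simp add: \<tau>_def profile_eq_0)
      ultimately show ?thesis by simp
    qed
  qed
  also have "\<dots> = ennreal (LBINT z. 2 * \<tau> z)"
  proof (rule nn_integral_eq_integral)
    show "integrable lborel (\<lambda>z. 2 * \<tau> z)"
      unfolding \<tau>_def using integrable_profile[OF \<alpha> R, of "\<lambda>_ :: real ^ 'n. 1"] by simp
  qed (use \<tau>0 in auto)
  also have "(LBINT z. 2 * \<tau> z) = 2 * A powr (- (2 / \<alpha>)) * profile_volume TYPE(real ^ 'n) \<alpha> R"
    by (simp add: \<tau>_def profile_volume_def)
  finally have "measure lborel ?B = 2 * A powr (- (2 / \<alpha>)) * profile_volume TYPE(real ^ 'n) \<alpha> R"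
    by (simp add: measure_def profile_volume_nonneg)
  then show ?thesis using meas by (simp add: measure_completion)
qed

lemma card_Ints_abs_le:
  fixes \<tau> :: real
  assumes "0 \<le> \<tau>"
  shows "real (card {t :: real. t \<in> \<int> \<and> \<bar>t\<bar> \<le> \<tau>}) = 2 * of_int \<lfloor>\<tau>\<rfloor> + 1"
proof -
  have "{t :: real. t \<in> \<int> \<and> \<bar>t\<bar> \<le> \<tau>} = of_int ` {- \<lfloor>\<tau>\<rfloor>..\<lfloor>\<tau>\<rfloor>}"
  proof (intro equalityI subsetI)
    fix t :: real assume "t \<in> {t. t \<in> \<int> \<and> \<bar>t\<bar> \<le> \<tau>}"
    then obtain k :: int where k: "t = of_int k" "\<bar>t\<bar> \<le> \<tau>" by (auto elim: Ints_cases)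
    then have "k \<in> {- \<lfloor>\<tau>\<rfloor>..\<lfloor>\<tau>\<rfloor>}"
      using le_floor_iff[of k \<tau>] le_floor_iff[of "- k" \<tau>] by (auto simp: abs_le_iff)
    then show "t \<in> of_int ` {- \<lfloor>\<tau>\<rfloor>..\<lfloor>\<tau>\<rfloor>}" using k by blast
  next
    fix t :: real assume "t \<in> of_int ` {- \<lfloor>\<tau>\<rfloor>..\<lfloor>\<tau>\<rfloor>}"
    then obtain k :: int where k: "t = of_int k" "k \<le> \<lfloor>\<tau>\<rfloor>" "- k \<le> \<lfloor>\<tau>\<rfloor>" by auto
    then show "t \<in> {t. t \<in> \<int> \<and> \<bar>t\<bar> \<le> \<tau>}"
      using le_floor_iff[of k \<tau>] le_floor_iff[of "- k" \<tau>] by (auto simp: abs_le_iff)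
  qed
  then have "card {t :: real. t \<in> \<int> \<and> \<bar>t\<bar> \<le> \<tau>} = card {- \<lfloor>\<tau>\<rfloor>..\<lfloor>\<tau>\<rfloor>}"
    by (simp add: card_image inj_on_def)
  moreover have "0 \<le> \<lfloor>\<tau>\<rfloor>" using assms by simp
  ultimately show ?thesis by simp
qed

text \<open>The slice over \<open>z\<close> holds \<open>2 * \<lfloor>\<tau> z\<rfloor> + 1\<close>
  integers, which differs from its length by at most 1. The total error is thus at most the number
  of lattice points \<open>z\<close> that occur.\<close>

lemma heis_ball_count:
  assumes A: "A > 0" and \<alpha>: "\<alpha> > 0" and R: "R \<ge> 1"
  shows "\<bar>real (card (int_lattice \<inter> heis_ball \<alpha> A R :: ((real ^ 'n) \<times> real) set))
      - 2 * A powr (- (2 / \<alpha>)) * lattice_sum TYPE(real ^ 'n) \<alpha> R\<bar> \<le> 5 ^ CARD('n) * R ^ CARD('n)"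
proof -
  let ?X = "int_lattice \<inter> heis_ball \<alpha> A R :: ((real ^ 'n) \<times> real) set"
  define \<tau> where "\<tau> = (\<lambda>z :: real ^ 'n. A powr (- (2 / \<alpha>)) * profile \<alpha> R (norm z))"
  define Z where "Z = {z \<in> zbox (nat \<lceil>R\<rceil>). norm (z :: real ^ 'n) \<le> R}"
  have R0: "0 \<le> R" using R by simp
  have \<tau>0: "0 \<le> \<tau> z" for z by (simp add: \<tau>_def)
  have fin: "finite Z" by (simp add: Z_def finite_zbox)
  have Z_iff: "z \<in> Z \<longleftrightarrow> z \<in> zlat \<and> norm z \<le> R" for z
  proof -
    have "infnorm z \<le> norm z" by (rule infnorm_le_norm)
    moreover have "R \<le> real (nat \<lceil>R\<rceil>)" by (rule real_nat_ceiling_ge)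
    ultimately have "norm z \<le> R \<Longrightarrow> infnorm z \<le> real (nat \<lceil>R\<rceil>)" by linarith
    then show ?thesis unfolding Z_def zbox_def by blast
  qed
  have "?X = (SIGMA z:Z. {t. t \<in> \<int> \<and> \<bar>t\<bar> \<le> \<tau> z})"
    using heis_ball_iff[OF A \<alpha> R0] by (auto simp: int_lattice_def Z_iff zlat_vec_iff \<tau>_def)
  then have "real (card ?X)
     = (\<Sum>z\<in>Z. real (card {t :: real. t \<in> \<int> \<and> \<bar>t\<bar> \<le> \<tau> z}))"
    by (simp only:) (subst card_SigmaI, use fin finite_abs_int_segment in auto)
  also have "\<dots> = (\<Sum>z\<in>Z. 2 * of_int \<lfloor>\<tau> z\<rfloor> + 1)"
    by (intro sum.cong refl card_Ints_abs_le \<tau>0)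
  finally have count: "real (card ?X)
     = (\<Sum>z\<in>Z. 2 * of_int \<lfloor>\<tau> z\<rfloor> + 1)" .
  have "2 * A powr (- (2 / \<alpha>)) * lattice_sum TYPE(real ^ 'n) \<alpha> R = (\<Sum>z\<in>zbox (nat \<lceil>R\<rceil>). 2 * \<tau> z)"
    by (simp add: lattice_sum_def \<tau>_def sum_distrib_left mult_ac)
  also have "\<dots> = (\<Sum>z\<in>Z. 2 * \<tau> z)"
  proof (rule sum.mono_neutral_right)
    show "\<forall>z\<in>zbox (nat \<lceil>R\<rceil>) - Z. 2 * \<tau> z = 0"
      using \<alpha> R0 by (auto simp: Z_def \<tau>_def intro!: profile_eq_0)
  qed (auto simp: Z_def finite_zbox)
  finally have "\<bar>real (card ?X)
      - 2 * A powr (- (2 / \<alpha>)) * lattice_sum TYPE(real ^ 'n) \<alpha> R\<bar>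
      = \<bar>\<Sum>z\<in>Z. (2 * of_int \<lfloor>\<tau> z\<rfloor> + 1) - 2 * \<tau> z\<bar>"
    unfolding count by (simp add: sum_subtractf)
  also have "\<dots> \<le> (\<Sum>z\<in>Z. \<bar>(2 * of_int \<lfloor>\<tau> z\<rfloor> + 1) - 2 * \<tau> z\<bar>)" by (rule sum_abs)
  also have "\<dots> \<le> (\<Sum>z\<in>Z. 1)"
  proof (rule sum_mono)
    fix z
    show "\<bar>(2 * of_int \<lfloor>\<tau> z\<rfloor> + 1) - 2 * \<tau> z\<bar> \<le> 1"
      using floor_correct[of "\<tau> z"] by linarith
  qed
  also have "\<dots> \<le> real (card (zbox (nat \<lceil>R\<rceil>) :: (real ^ 'n) set))"
    using finite_zbox[where 'a = "real ^ 'n"] by (auto simp: Z_def intro!: card_mono)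
  also have "\<dots> = (2 * real (nat \<lceil>R\<rceil>) + 1) ^ CARD('n)"
    by (simp add: card_zbox add.commute)
  \<comment> \<open>\<open>\<lceil>R\<rceil> \<le> R + 1\<close> gives \<open>2 * R + 3\<close>, at
    most \<open>5 * R\<close> as \<open>R \<ge> 1\<close>.\<close>
  also have "\<dots> \<le> (5 * R) ^ CARD('n)"
  proof (rule power_mono)
    have "real (nat \<lceil>R\<rceil>) = of_int \<lceil>R\<rceil>" using R by simp
    moreover have "real_of_int \<lceil>R\<rceil> \<le> R + 1" by (rule of_int_ceiling_le_add_one)
    ultimately show "2 * real (nat \<lceil>R\<rceil>) + 1 \<le> 5 * R" using R by argo
  qed simp
  finally show ?thesis by (simp add: power_mult_distrib)
qed

theorem theorem3p1:
  fixes d :: nat and A \<alpha> :: real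
  assumes "d \<ge> 1" and "CARD('n::finite) = 2 * d" and "A > 0" and "\<alpha> \<ge> 2"
  shows "\<exists>C>0. \<forall>\<^sub>F R in at_top.
    \<bar>real (card (int_lattice \<inter> heis_ball \<alpha> A R :: ((real ^ 'n) \<times> real) set))
      - measure lebesgue (heis_ball \<alpha> A R :: ((real ^ 'n) \<times> real) set)\<bar>
    \<le> C * error_rate d \<alpha> R"
proof -
  let ?N = "\<lambda>R. real (card (int_lattice \<inter> heis_ball \<alpha> A R :: ((real ^ 'n) \<times> real) set))"
  let ?\<mu> = "\<lambda>R. measure lebesgue (heis_ball \<alpha> A R :: ((real ^ 'n) \<times> real) set)"
  let ?S = "lattice_sum TYPE(real ^ 'n) \<alpha>" and ?V = "profile_volume TYPE(real ^ 'n) \<alpha>"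
  define a where "a = 2 * A powr (- (2 / \<alpha>))"
  have a: "a > 0" using assms by (simp add: a_def)
  have \<alpha>: "\<alpha> > 0" using assms by simp
  have "DIM(real ^ 'n) = 2 * d" using assms by simp
  from profile_lattice_bound[OF assms(1) assms(4) this]
  obtain C where C: "C > 0" and ev: "eventually (\<lambda>R. \<bar>?S R - ?V R\<bar>
    \<le> C * error_rate d \<alpha> R) at_top" by blast
  \<comment> \<open>The first constant is the cost of counting along the \<open>t\<close>-axis,
    which is within the rate by \<open>power_le_error_rate\<close>; the second is the profile error
    multiplied by \<open>a\<close>, the common factor of count and volume.\<close>
  have "\<forall>\<^sub>F R in at_top.
    \<bar>?N R
      - ?\<mu> R\<bar>
    \<le> (5 ^ (2 * d) + a * C) * error_rate d \<alpha> R"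
    using ev power_le_error_rate[of d \<alpha>] eventually_ge_at_top[of 1]
  proof eventually_elim
    case (elim R)
    have vol: "?\<mu> R = a * ?V R"
      using heis_ball_volume[OF assms(3) \<alpha>, of R, where 'n = 'n] elim by (simp add: a_def)
    have "\<bar>?N R - a * ?S R\<bar>
      \<le> 5 ^ (2 * d) * R ^ (2 * d)"
      using heis_ball_count[OF assms(3) \<alpha> elim(3), where 'n = 'n] by (simp add: a_def assms(2))
    also have "\<dots> \<le> 5 ^ (2 * d) * error_rate d \<alpha> R"
      using elim by (intro mult_left_mono) auto
    finally have 1: "\<bar>?N R - a * ?S R\<bar>
      \<le> 5 ^ (2 * d) * error_rate d \<alpha> R" .
    have "\<bar>a * ?S R - a * ?V R\<bar>
      = a * \<bar>?S R - ?V R\<bar>"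
      using a by (simp add: right_diff_distrib[symmetric] abs_mult)
    also have "\<dots> \<le> a * (C * error_rate d \<alpha> R)"
      using elim a by (intro mult_left_mono) auto
    finally have 2: "\<bar>a * ?S R - a * ?V R\<bar> \<le> a * C * error_rate d \<alpha> R"
      by (simp add: mult.assoc)
    show ?case using 1 2 unfolding vol distrib_right by linarith
  qed
  moreover have "5 ^ (2 * d) + a * C > 0" using a C by (simp add: add_pos_pos)
  ultimately show ?thesis by blast
qed

end
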